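(* Let $G$ be a second countable unimodular type I group, $H$ a compact closed subgroup of $G$, and $f\in C_c(G)$ with $f|_H\in L^1(H)$ and $\widehat{f}\in L^1(\widehat{G})$. Then $$\int_Hf(h)\,\mathrm{d}\mu_H(h)=\int_{H_G^\bot}\mathrm{tr}\big(P_\sigma^{(1)}\cdot\widehat{f}(\sigma)\big)\,\mathrm{d}\mu_{H_G^\bot}(\sigma).$$
   Context: $\mu_G$ is a Haar measure of $G$ and $\mu_H$ is the Haar measure of $H$ with $\mu_H(H)=1$. $\widehat{G}$ is the set of unitary equivalence classes of irreducible unitary representations $\sigma:G\to\mathrm{U}(\mathcal{H}_\sigma)$ (representatives are fixed), with the Fell topology. For $f\in L^1(G)$ the Fourier transform is $\widehat{f}(\sigma)=\int_Gf(g)\sigma(g)^*\,\mathrm{d}\mu_G(g)$. $\mu_{\widehat{G}}$ is the Plancherel measure on $\widehat{G}$, i.e. the measure for which the inversion formula $f(g)=\int_{\widehat{G}}\mathrm{tr}(\widehat{f}(\sigma)\sigma(g))\,\mathrm{d}\mu_{\widehat{G}}(\sigma)$ holds for almost every $g$ whenever $f\in L^1(G)$, $\widehat{f}\in L^1(\widehat{G})$; here $\widehat{f}\in L^1(\widehat{G})$ means that the measurable operator field $\widehat{f}$ is trace class almost everywhere with $\mu_{\widehat{G}}$-integrable trace norm. The reciprocal space of $H$ in $G$ is $H_G^\bot=\{\sigma\in\widehat{G}:$ the restriction of $\sigma$ to $H$ contains the trivial representation with multiplicity $\ge1\}$, and $\mu_{H_G^\bot}=\mu_{\widehat{G}}|_{H_G^\bot}$.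 $\mathcal{H}_\sigma^{(1)}\subseteq\mathcal{H}_\sigma$ is the subspace of $H$-fixed vectors (the sum of the trivial components of $\sigma|_H$), and $P_\sigma^{(1)}$ is the orthogonal projection of $\mathcal{H}_\sigma$ onto $\mathcal{H}_\sigma^{(1)}$. *)

theory Defs
  imports "HOL-Analysis.Analysis"
begin

section \<open>Complex Hilbert spaces\<close>

text \<open>The inner product \<open>cinner\<close> is linear in its first argument; its real part is the library's
  real inner product, so norm, topology and completeness are inherited.\<close>

class complex_hilbert_space = real_inner + complete_space +
  fixes scaleC :: "complex \<Rightarrow> 'a \<Rightarrow> 'a" (infixr \<open>*\<^sub>C\<close> 75)
    and cinner :: "'a \<Rightarrow> 'a \<Rightarrow> complex"
  assumes scaleC_add_right: "a *\<^sub>C (x + y) = a *\<^sub>C x + a *\<^sub>C y"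
    and scaleC_add_left: "(a + b) *\<^sub>C x = a *\<^sub>C x + b *\<^sub>C x"
    and scaleC_scaleC: "a *\<^sub>C (b *\<^sub>C x) = (a * b) *\<^sub>C x"
    and scaleC_of_real: "of_real r *\<^sub>C x = r *\<^sub>R x"
    and cinner_commute: "cinner x y = cnj (cinner y x)"
    and cinner_add_left: "cinner (x + y) z = cinner x z + cinner y z"
    and cinner_scaleC_left: "cinner (a *\<^sub>C x) y = a * cinner x y"
    and Re_cinner: "Re (cinner x y) = inner x y"

typedef ell2 = "{x :: nat \<Rightarrow> complex. summable (\<lambda>n. (cmod (x n))\<^sup>2)}"
  morphisms ell2_nth Abs_ell2
  by (rule exI[of _ "\<lambda>_. 0"]) simp

lemma summable_ell2: "summable (\<lambda>n. (cmod (ell2_nth x n))\<^sup>2)"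
  using ell2_nth[of x] by simp

lemma ell2_eqI: "(\<And>n. ell2_nth x n = ell2_nth y n) \<Longrightarrow> x = y"
  using ell2_nth_inject by blast

lemma cmod_mult_le: "cmod (a * b) \<le> (cmod a)\<^sup>2 + (cmod b)\<^sup>2"
proof -
  have "2 * (cmod a * cmod b) \<le> (cmod a)\<^sup>2 + (cmod b)\<^sup>2"
    using zero_le_power2[of "cmod a - cmod b"] by (simp add: power2_diff)
  moreover have "0 \<le> cmod a * cmod b" by simp
  ultimately show ?thesis unfolding norm_mult by linarith
qed

lemma cmod_add_power2_le: "(cmod (a + b))\<^sup>2 \<le> 2 * (cmod a)\<^sup>2 + 2 * (cmod b)\<^sup>2"
proof -
  have "(cmod (a + b))\<^sup>2 \<le> (cmod a + cmod b)\<^sup>2"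
    by (intro power_mono norm_triangle_ineq) auto
  also have "\<dots> \<le> 2 * (cmod a)\<^sup>2 + 2 * (cmod b)\<^sup>2"
    using zero_le_power2[of "cmod a - cmod b"] by (simp add: power2_diff power2_sum)
  finally show ?thesis .
qed

lemma summable_ell2_mult:
  "summable (\<lambda>n. ell2_nth x n * cnj (ell2_nth y n))"
proof (rule summable_comparison_test')
  show "summable (\<lambda>n. (cmod (ell2_nth x n))\<^sup>2 + (cmod (ell2_nth y n))\<^sup>2)"
    by (intro summable_add summable_ell2)
  show "norm (ell2_nth x n * cnj (ell2_nth y n)) \<le> (cmod (ell2_nth x n))\<^sup>2 + (cmod (ell2_nth y n))\<^sup>2"
    if "n \<ge> 0" for n
    using cmod_mult_le[of "ell2_nth x n" "cnj (ell2_nth y n)"] by simp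
qed

lemma ell2_add_closed:
  "summable (\<lambda>n. (cmod (ell2_nth x n + ell2_nth y n))\<^sup>2)"
proof (rule summable_comparison_test')
  show "summable (\<lambda>n. 2 * (cmod (ell2_nth x n))\<^sup>2 + 2 * (cmod (ell2_nth y n))\<^sup>2)"
    by (intro summable_add summable_mult summable_ell2)
  show "norm ((cmod (ell2_nth x n + ell2_nth y n))\<^sup>2)
      \<le> 2 * (cmod (ell2_nth x n))\<^sup>2 + 2 * (cmod (ell2_nth y n))\<^sup>2" if "n \<ge> 0" for n
    using cmod_add_power2_le[of "ell2_nth x n" "ell2_nth y n"] by simp
qed

lemma ell2_scale_closed: "summable (\<lambda>n. (cmod (a * ell2_nth x n))\<^sup>2)"
  by (simp add: norm_mult power_mult_distrib summable_ell2)

instantiation ell2 :: real_vector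
begin

definition zero_ell2 :: ell2 where "0 = Abs_ell2 (\<lambda>_. 0)"
definition plus_ell2 :: "ell2 \<Rightarrow> ell2 \<Rightarrow> ell2"
  where "x + y = Abs_ell2 (\<lambda>n. ell2_nth x n + ell2_nth y n)"
definition uminus_ell2 :: "ell2 \<Rightarrow> ell2"
  where "- x = Abs_ell2 (\<lambda>n. - ell2_nth x n)"
definition minus_ell2 :: "ell2 \<Rightarrow> ell2 \<Rightarrow> ell2"
  where "minus_ell2 x y = x + (- y)"
definition scaleR_ell2 :: "real \<Rightarrow> ell2 \<Rightarrow> ell2"
  where "r *\<^sub>R x = Abs_ell2 (\<lambda>n. of_real r * ell2_nth x n)"
lemma ell2_nth_zero: "ell2_nth 0 n = 0"
  by (simp add: zero_ell2_def Abs_ell2_inverse)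
lemma ell2_nth_add: "ell2_nth (x + y) n = ell2_nth x n + ell2_nth y n"
  by (simp add: plus_ell2_def Abs_ell2_inverse ell2_add_closed)
lemma ell2_nth_uminus: "ell2_nth (- x) n = - ell2_nth x n"
  by (simp add: uminus_ell2_def Abs_ell2_inverse summable_ell2)
lemma ell2_nth_minus: "ell2_nth (x - y) n = ell2_nth x n - ell2_nth y n"
  by (simp add: minus_ell2_def ell2_nth_add ell2_nth_uminus)
lemma ell2_nth_scaleR: "ell2_nth (r *\<^sub>R x) n = of_real r * ell2_nth x n"
  using ell2_scale_closed[of "of_real r" x] by (simp add: scaleR_ell2_def Abs_ell2_inverse)

lemmas ell2_nth_simps = ell2_nth_zero ell2_nth_add ell2_nth_uminus ell2_nth_minus ell2_nth_scaleR

instance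
proof
  fix x y z :: ell2 and a b :: real
  show "x + y + z = x + (y + z)" "x + y = y + x" "0 + x = x" "- x + x = 0" "x - y = x + - y"
    by (auto intro!: ell2_eqI simp: ell2_nth_simps)
  show "a *\<^sub>R (x + y) = a *\<^sub>R x + a *\<^sub>R y" "(a + b) *\<^sub>R x = a *\<^sub>R x + b *\<^sub>R x"
    "a *\<^sub>R b *\<^sub>R x = (a * b) *\<^sub>R x" "1 *\<^sub>R x = x"
    by (auto intro!: ell2_eqI simp: ell2_nth_simps algebra_simps)
qed

end

instantiation ell2 :: real_inner
begin

definition inner_ell2 :: "ell2 \<Rightarrow> ell2 \<Rightarrow> real"
  where "inner x y = Re (\<Sum>n. ell2_nth x n * cnj (ell2_nth y n))"
definition norm_ell2 :: "ell2 \<Rightarrow> real"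
  where "norm_ell2 x = sqrt (inner x x)"
definition dist_ell2 :: "ell2 \<Rightarrow> ell2 \<Rightarrow> real"
  where "dist_ell2 x y = norm (x - y)"
definition sgn_ell2 :: "ell2 \<Rightarrow> ell2"
  where "sgn_ell2 x = x /\<^sub>R norm x"
definition uniformity_ell2 :: "(ell2 \<times> ell2) filter"
  where "uniformity_ell2 = (INF e\<in>{0<..}. principal {(x, y). dist x y < e})"
definition open_ell2 :: "ell2 set \<Rightarrow> bool"
  where "open_ell2 U = (\<forall>x\<in>U. eventually (\<lambda>(x', y). x' = x \<longrightarrow> y \<in> U) uniformity)"

lemma inner_ell2_self: "inner x (x :: ell2) = (\<Sum>n. (cmod (ell2_nth x n))\<^sup>2)"
proof -
  have "(\<Sum>n. ell2_nth x n * cnj (ell2_nth x n)) = (\<Sum>n. of_real ((cmod (ell2_nth x n))\<^sup>2))"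
    by (simp only: complex_norm_square)
  also have "\<dots> = of_real (\<Sum>n. (cmod (ell2_nth x n))\<^sup>2)"
    by (rule suminf_of_real[symmetric]) (rule summable_ell2)
  finally show ?thesis by (simp add: inner_ell2_def)
qed

instance
proof
  fix x y z :: ell2 and a b r :: real
  show "sgn x = x /\<^sub>R norm x" "dist x y = norm (x - y)" "norm x = sqrt (inner x x)"
    "uniformity = (INF e\<in>{0<..}. principal {(x :: ell2, y). dist x y < e})"
    by (rule sgn_ell2_def dist_ell2_def norm_ell2_def uniformity_ell2_def)+
  show "open U = (\<forall>x\<in>U. \<forall>\<^sub>F (x', y) in uniformity. x' = x \<longrightarrow> y \<in> U)" for U :: "ell2 set"
    by (rule open_ell2_def)
  have Re: "inner x y = (\<Sum>n. Re (ell2_nth x n * cnj (ell2_nth y n)))" for x y :: ell2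
    unfolding inner_ell2_def using summable_ell2_mult by (rule bounded_linear.suminf[OF bounded_linear_Re])
  have sRe: "summable (\<lambda>n. Re (ell2_nth x n * cnj (ell2_nth y n)))" for x y :: ell2
    using summable_ell2_mult by (rule bounded_linear.summable[OF bounded_linear_Re])
  show "inner x y = inner y x"
    unfolding Re by (simp add: mult.commute)
  show "inner (x + y) z = inner x z + inner y z"
    unfolding Re by (subst suminf_add[OF sRe sRe]) (simp add: ell2_nth_simps algebra_simps)
  show "inner (r *\<^sub>R x) y = r * inner x y"
    unfolding Re by (subst suminf_mult[OF sRe, symmetric]) (simp add: ell2_nth_simps algebra_simps)
  show "0 \<le> inner x x"
    unfolding inner_ell2_self by (intro suminf_nonneg summable_ell2) auto
  show "inner x x = 0 \<longleftrightarrow> x = 0"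
    unfolding inner_ell2_self
    by (subst suminf_eq_zero_iff[OF summable_ell2]) (auto intro!: ell2_eqI simp: ell2_nth_simps)
qed

end

lemma norm_ell2_power2: "(norm (x :: ell2))\<^sup>2 = (\<Sum>n. (cmod (ell2_nth x n))\<^sup>2)"
  by (simp add: power2_norm_eq_inner inner_ell2_self)

lemma cmod_ell2_nth_le: "cmod (ell2_nth x n) \<le> norm x"
proof -
  have "(cmod (ell2_nth x n))\<^sup>2 \<le> (norm x)\<^sup>2"
    unfolding norm_ell2_power2
    using sum_le_suminf[OF summable_ell2[of x], of "{n}"] by simp
  then show ?thesis by (rule power2_le_imp_le) simp
qed

instance ell2 :: complete_space
proof
  fix X :: "nat \<Rightarrow> ell2"
  assume X: "Cauchy X"
  have "Cauchy (\<lambda>k. ell2_nth (X k) n)" for n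
  proof (rule metric_CauchyI)
    fix e :: real assume "e > 0"
    from metric_CauchyD[OF X this] obtain M where M: "\<forall>j\<ge>M. \<forall>k\<ge>M. dist (X j) (X k) < e" by blast
    have "dist (ell2_nth (X j) n) (ell2_nth (X k) n) < e" if "j \<ge> M" "k \<ge> M" for j k
      using M that cmod_ell2_nth_le[of "X j - X k" n]
      by (auto simp: dist_norm ell2_nth_simps intro: le_less_trans)
    then show "\<exists>M. \<forall>j\<ge>M. \<forall>k\<ge>M. dist (ell2_nth (X j) n) (ell2_nth (X k) n) < e" by blast
  qed
  then have "\<exists>l. (\<lambda>k. ell2_nth (X k) n) \<longlonglongrightarrow> l" for n
    by (simp add: Cauchy_convergent_iff convergent_def)
  then obtain l where l: "\<And>n. (\<lambda>k. ell2_nth (X k) n) \<longlonglongrightarrow> l n" by metis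
  have bound: "summable (\<lambda>n. (cmod (ell2_nth (X j) n - l n))\<^sup>2) \<and>
      (\<Sum>n. (cmod (ell2_nth (X j) n - l n))\<^sup>2) \<le> e\<^sup>2"
    if j: "j \<ge> M" and M: "\<forall>j\<ge>M. \<forall>k\<ge>M. dist (X j) (X k) < e" for j M e
  proof -
    have part: "(\<Sum>n<N. (cmod (ell2_nth (X j) n - l n))\<^sup>2) \<le> e\<^sup>2" for N
    proof (rule tendsto_upperbound)
      show "(\<lambda>k. \<Sum>n<N. (cmod (ell2_nth (X j) n - ell2_nth (X k) n))\<^sup>2)
          \<longlonglongrightarrow> (\<Sum>n<N. (cmod (ell2_nth (X j) n - l n))\<^sup>2)"
        by (intro tendsto_intros l)
      show "\<forall>\<^sub>F k in sequentially. (\<Sum>n<N. (cmod (ell2_nth (X j) n - ell2_nth (X k) n))\<^sup>2) \<le> e\<^sup>2"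
      proof (rule eventually_sequentiallyI[of M])
        fix k assume "k \<ge> M"
        then have "norm (X j - X k) \<le> e" using M j by (auto simp: dist_norm less_imp_le)
        then have "(norm (X j - X k))\<^sup>2 \<le> e\<^sup>2" by (intro power_mono) auto
        moreover have "(\<Sum>n<N. (cmod (ell2_nth (X j - X k) n))\<^sup>2) \<le> (norm (X j - X k))\<^sup>2"
          unfolding norm_ell2_power2 by (intro sum_le_suminf summable_ell2) auto
        ultimately show "(\<Sum>n<N. (cmod (ell2_nth (X j) n - ell2_nth (X k) n))\<^sup>2) \<le> e\<^sup>2"
          by (simp add: ell2_nth_simps)
      qed
    qed simp
    have "summable (\<lambda>n. (cmod (ell2_nth (X j) n - l n))\<^sup>2)"
      by (rule summableI_nonneg_bounded[of _ "e\<^sup>2"]) (use part in auto)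
    with part show ?thesis by (auto intro: suminf_le_const)
  qed
  obtain M where M: "\<forall>j\<ge>M. \<forall>k\<ge>M. dist (X j) (X k) < 1"
    using metric_CauchyD[OF X, of 1] by auto
  define d where "d = Abs_ell2 (\<lambda>n. ell2_nth (X M) n - l n)"
  have d: "ell2_nth d n = ell2_nth (X M) n - l n" for n
    using bound[OF order_refl M] by (simp add: d_def Abs_ell2_inverse)
  define L where "L = X M - d"
  have L: "ell2_nth L n = l n" for n by (simp add: L_def ell2_nth_simps d)
  have "X \<longlonglongrightarrow> L"
  proof (rule metric_LIMSEQ_I)
    fix e :: real assume e: "e > 0"
    then obtain K where K: "\<forall>j\<ge>K. \<forall>k\<ge>K. dist (X j) (X k) < e / 2"
      using metric_CauchyD[OF X, of "e / 2"] by auto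
    have "dist (X j) L < e" if "j \<ge> K" for j
    proof -
      have "(norm (X j - L))\<^sup>2 \<le> (e / 2)\<^sup>2"
        unfolding norm_ell2_power2 using bound[OF that K] by (simp add: ell2_nth_simps L)
      then have "norm (X j - L) \<le> e / 2" by (rule power2_le_imp_le) (use e in simp)
      then show ?thesis using e by (simp add: dist_norm)
    qed
    then show "\<exists>no. \<forall>n\<ge>no. dist (X n) L < e" by blast
  qed
  then show "convergent X" by (auto simp: convergent_def)
qed

instantiation ell2 :: complex_hilbert_space
begin

definition scaleC_ell2 :: "complex \<Rightarrow> ell2 \<Rightarrow> ell2"
  where "a *\<^sub>C x = Abs_ell2 (\<lambda>n. a * ell2_nth x n)"
definition cinner_ell2 :: "ell2 \<Rightarrow> ell2 \<Rightarrow> complex"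
  where "cinner x y = (\<Sum>n. ell2_nth x n * cnj (ell2_nth y n))"

lemma ell2_nth_scaleC: "ell2_nth (a *\<^sub>C x) n = a * ell2_nth x n"
  using ell2_scale_closed[of a x] by (simp add: scaleC_ell2_def Abs_ell2_inverse)

instance
proof
  fix x y z :: ell2 and a b :: complex and r :: real
  show "a *\<^sub>C (x + y) = a *\<^sub>C x + a *\<^sub>C y" "(a + b) *\<^sub>C x = a *\<^sub>C x + b *\<^sub>C x"
    "a *\<^sub>C b *\<^sub>C x = (a * b) *\<^sub>C x" "of_real r *\<^sub>C x = r *\<^sub>R x"
    by (auto intro!: ell2_eqI simp: ell2_nth_simps ell2_nth_scaleC algebra_simps)
  show "cinner x y = cnj (cinner y x)"
  proof -
    have "(\<Sum>n. cnj (ell2_nth y n * cnj (ell2_nth x n))) = cnj (cinner y x)"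
      unfolding cinner_ell2_def
      using bounded_linear.suminf[OF bounded_linear_cnj summable_ell2_mult[of y x]] by simp
    then show ?thesis by (simp add: cinner_ell2_def mult.commute)
  qed
  show "cinner (x + y) z = cinner x z + cinner y z"
    unfolding cinner_ell2_def
    by (subst suminf_add[OF summable_ell2_mult summable_ell2_mult]) (simp add: ell2_nth_simps algebra_simps)
  show "cinner (a *\<^sub>C x) y = a * cinner x y"
    unfolding cinner_ell2_def
    by (subst suminf_mult[OF summable_ell2_mult, symmetric]) (simp add: ell2_nth_scaleC algebra_simps)
  show "Re (cinner x y) = inner x y"
    by (simp add: cinner_ell2_def inner_ell2_def)
qed

end

definition ell2_unit :: "nat \<Rightarrow> ell2"
  where "ell2_unit i = Abs_ell2 (\<lambda>n. if n = i then 1 else 0)"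

lemma ell2_dense_rational:
  fixes x :: ell2 and e :: real
  assumes e: "e > 0"
  shows "\<exists>q :: (rat \<times> rat) list. dist (Abs_ell2 (\<lambda>n. if n < length q
      then Complex (of_rat (fst (q ! n))) (of_rat (snd (q ! n))) else 0)) x < e"
proof -
  have "(\<lambda>N. \<Sum>n. (cmod (ell2_nth x (n + N)))\<^sup>2) \<longlonglongrightarrow> 0"
    using summable_ell2[of x] by (rule suminf_exist_split2)
  then obtain N where N: "(\<Sum>n. (cmod (ell2_nth x (n + N)))\<^sup>2) < e\<^sup>2 / 2"
    using order_tendstoD(2)[of _ 0 sequentially "e\<^sup>2 / 2"] e
    by (fastforce simp: eventually_sequentially)
  define d where "d = e / 2 / (real N + 1) / 2"
  have d: "d > 0" using e by (simp add: d_def)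
  have "\<exists>p :: rat \<times> rat. cmod (Complex (of_rat (fst p)) (of_rat (snd p)) - z) < 2 * d" for z
  proof -
    obtain a where a: "Re z < of_rat a" "of_rat a < Re z + d"
      using of_rat_dense[of "Re z" "Re z + d"] d by auto
    obtain b where b: "Im z < of_rat b" "of_rat b < Im z + d"
      using of_rat_dense[of "Im z" "Im z + d"] d by auto
    have "cmod (Complex (of_rat a) (of_rat b) - z) \<le> \<bar>of_rat a - Re z\<bar> + \<bar>of_rat b - Im z\<bar>"
      using cmod_le[of "Complex (of_rat a) (of_rat b) - z"] by simp
    also have "\<dots> < 2 * d" using a b by auto
    finally show ?thesis by (intro exI[of _ "(a, b)"]) simp
  qed
  then obtain p :: "complex \<Rightarrow> rat \<times> rat" where
    p: "\<And>z. cmod (Complex (of_rat (fst (p z))) (of_rat (snd (p z))) - z) < 2 * d" by metis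
  define q where "q = map (\<lambda>n. p (ell2_nth x n)) [0..<N]"
  define s where "s = (\<lambda>n. if n < length q
      then Complex (of_rat (fst (q ! n))) (of_rat (snd (q ! n))) else 0)"
  have "summable (\<lambda>n. (cmod (s n))\<^sup>2)"
    by (rule summable_finite[of "{..<length q}"]) (auto simp: s_def)
  then have s: "ell2_nth (Abs_ell2 s) = s" by (simp add: Abs_ell2_inverse)
  let ?y = "Abs_ell2 s - x"
  have "(norm ?y)\<^sup>2 = (\<Sum>n. (cmod (ell2_nth ?y (n + N)))\<^sup>2) + (\<Sum>n<N. (cmod (ell2_nth ?y n))\<^sup>2)"
    unfolding norm_ell2_power2 by (rule suminf_split_initial_segment) (rule summable_ell2)
  also have "(\<Sum>n. (cmod (ell2_nth ?y (n + N)))\<^sup>2) = (\<Sum>n. (cmod (ell2_nth x (n + N)))\<^sup>2)"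
    unfolding ell2_nth_simps s by (simp add: s_def q_def)
  also have "(\<Sum>n<N. (cmod (ell2_nth ?y n))\<^sup>2) \<le> (\<Sum>n<N. (2 * d)\<^sup>2)"
  proof (intro sum_mono power_mono)
    fix n assume "n \<in> {..<N}"
    then show "cmod (ell2_nth ?y n) \<le> 2 * d"
      using p[of "ell2_nth x n"] unfolding ell2_nth_simps s by (simp add: s_def q_def)
  qed simp
  also have "(\<Sum>n<N. (2 * d)\<^sup>2) \<le> e\<^sup>2 / 4"
  proof -
    have "(\<Sum>n<N. (2 * d)\<^sup>2) = e\<^sup>2 / 4 * (real N / (real N + 1)\<^sup>2)"
    proof -
      have "2 * (a / 2) = a" for a :: real by simp
      then have "2 * d = e / 2 / (real N + 1)" unfolding d_def .
      then show ?thesis by (simp add: power_divide del: divide_divide_eq_left)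
    qed
    moreover have "real N / (real N + 1)\<^sup>2 \<le> 1"
    proof (subst divide_le_eq_1_pos)
      show "0 < (real N + 1)\<^sup>2" by simp
      show "real N \<le> (real N + 1)\<^sup>2" by (simp add: power2_sum)
    qed
    ultimately show ?thesis using e by (simp only:) (rule mult_left_le, auto)
  qed
  finally have "(norm ?y)\<^sup>2 < e\<^sup>2" using N e zero_less_power[OF e, of 2] by linarith
  then have "norm ?y < e" by (rule power2_less_imp_less) (use e in simp)
  then show ?thesis by (intro exI[of _ q]) (simp add: dist_norm s_def)
qed

instance ell2 :: second_countable_topology
proof
  let ?D = "range (\<lambda>q :: (rat \<times> rat) list. Abs_ell2 (\<lambda>n. if n < length q
      then Complex (of_rat (fst (q ! n))) (of_rat (snd (q ! n))) else 0))"
  let ?B = "(\<lambda>(c, r). ball c (of_rat r)) ` (?D \<times> (UNIV :: rat set))"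
  have "topological_basis ?B"
  proof (rule topological_basisI)
    show "open B" if "B \<in> ?B" for B using that by auto
    fix U :: "ell2 set" and x assume U: "open U" "x \<in> U"
    then obtain e where e: "e > 0" "ball x e \<subseteq> U" using open_contains_ball by blast
    obtain r where r: "0 < (of_rat r :: real)" "of_rat r < e / 2"
      using of_rat_dense[of 0 "e / 2"] e by auto
    obtain c where c: "c \<in> ?D" "dist c x < of_rat r" using ell2_dense_rational[OF r(1), of x] by auto
    have "ball c (of_rat r) \<subseteq> ball x e"
    proof
      fix y assume "y \<in> ball c (of_rat r)"
      then show "y \<in> ball x e" using c r dist_triangle3[of x y c] by auto
    qed
    moreover have "x \<in> ball c (of_rat r)" using c by auto
    ultimately show "\<exists>B\<in>?B. x \<in> B \<and> B \<subseteq> U"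
      using c(1) e(2) by (intro bexI[of _ "ball c (of_rat r)"]) auto
  qed
  then show "\<exists>B :: ell2 set set. countable B \<and> open = generate_topology B"
    by (intro exI[of _ ?B]) (auto dest: topological_basis_imp_subbasis)
qed


section \<open>Operators on a closed subspace\<close>

text \<open>A Hilbert space is represented as a closed complex subspace \<open>V\<close> of an ambient one, and an
  operator on it as a function whose values outside \<open>V\<close> are irrelevant.\<close>

definition closed_csubspace :: "'h::complex_hilbert_space set \<Rightarrow> bool" where
  "closed_csubspace V \<longleftrightarrow> closed V \<and> 0 \<in> V \<and> (\<forall>x\<in>V. \<forall>y\<in>V. x + y \<in> V) \<and> (\<forall>a. \<forall>x\<in>V. a *\<^sub>C x \<in> V)"

definition clinear_on :: "'h::complex_hilbert_space set \<Rightarrow> ('h \<Rightarrow> 'h) \<Rightarrow> bool" where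
  "clinear_on V T \<longleftrightarrow>
    (\<forall>x\<in>V. \<forall>y\<in>V. T (x + y) = T x + T y) \<and> (\<forall>a. \<forall>x\<in>V. T (a *\<^sub>C x) = a *\<^sub>C T x)"

definition bounded_operator_on :: "'h::complex_hilbert_space set \<Rightarrow> ('h \<Rightarrow> 'h) \<Rightarrow> bool" where
  "bounded_operator_on V T \<longleftrightarrow>
    T ` V \<subseteq> V \<and> clinear_on V T \<and> (\<exists>K. \<forall>x\<in>V. norm (T x) \<le> K * norm x)"

definition unitary_between ::
    "'h::complex_hilbert_space set \<Rightarrow> 'h set \<Rightarrow> ('h \<Rightarrow> 'h) \<Rightarrow> bool" where
  "unitary_between V W U \<longleftrightarrow>
    bij_betw U V W \<and> clinear_on V U \<and> (\<forall>x\<in>V. \<forall>y\<in>V. cinner (U x) (U y) = cinner x y)"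

definition cadjoint_on ::
    "'h::complex_hilbert_space set \<Rightarrow> ('h \<Rightarrow> 'h) \<Rightarrow> 'h \<Rightarrow> 'h" where
  "cadjoint_on V T y = (THE z. z \<in> V \<and> (\<forall>x\<in>V. cinner (T x) y = cinner x z))"

definition orth_proj :: "'h::complex_hilbert_space set \<Rightarrow> 'h \<Rightarrow> 'h" where
  "orth_proj W x = (THE y. y \<in> W \<and> (\<forall>z\<in>W. cinner (x - y) z = 0))"

definition is_onb :: "'h::complex_hilbert_space set \<Rightarrow> 'h set \<Rightarrow> bool" where
  "is_onb V B \<longleftrightarrow> B \<subseteq> V \<and> (\<forall>x\<in>B. \<forall>y\<in>B. cinner x y = (if x = y then 1 else 0)) \<and>
    (\<forall>x\<in>V. (\<forall>b\<in>B. cinner x b = 0) \<longrightarrow> x = 0)"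

text \<open>The choice of the orthonormal basis is immaterial wherever these are used: for trace class
  operators in \<open>op_trace\<close>, and for the positive operator \<open>|T|\<close> in \<open>trace_class_on\<close>.\<close>

definition onb_of :: "'h::complex_hilbert_space set \<Rightarrow> 'h set" where
  "onb_of V = (SOME B. is_onb V B)"

definition op_trace :: "'h::complex_hilbert_space set \<Rightarrow> ('h \<Rightarrow> 'h) \<Rightarrow> complex" where
  "op_trace V T = (\<Sum>\<^sub>\<infinity>e\<in>onb_of V. cinner (T e) e)"

definition positive_on :: "'h::complex_hilbert_space set \<Rightarrow> ('h \<Rightarrow> 'h) \<Rightarrow> bool" where
  "positive_on V A \<longleftrightarrow> bounded_operator_on V A \<and> (\<forall>x\<in>V. cinner (A x) x \<in> \<real>\<^sub>\<ge>\<^sub>0)"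

text \<open>\<open>|T| = (T\<^sup>* T)\<^bsup>1/2\<^esup>\<close>; the positive square root is unique as an operator on \<open>V\<close>.\<close>

definition op_abs :: "'h::complex_hilbert_space set \<Rightarrow> ('h \<Rightarrow> 'h) \<Rightarrow> 'h \<Rightarrow> 'h" where
  "op_abs V T = (SOME A. positive_on V A \<and> (\<forall>x\<in>V. A (A x) = cadjoint_on V T (T x)))"

definition trace_class_on :: "'h::complex_hilbert_space set \<Rightarrow> ('h \<Rightarrow> 'h) \<Rightarrow> bool" where
  "trace_class_on V T \<longleftrightarrow>
    bounded_operator_on V T \<and> (\<lambda>e. cinner (op_abs V T e) e) summable_on onb_of V"

definition trace_norm :: "'h::complex_hilbert_space set \<Rightarrow> ('h \<Rightarrow> 'h) \<Rightarrow> real" where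
  "trace_norm V T = Re (op_trace V (op_abs V T))"


section \<open>Unitary representations\<close>

text \<open>The group is written additively, following the library class \<open>topological_group_add\<close>, which
  does not assume commutativity.\<close>

datatype ('g, 'h) urep = Rep (rep_space: "'h set") (rep_op: "'g \<Rightarrow> 'h \<Rightarrow> 'h")

definition unitary_rep ::
    "('g::topological_group_add, 'h::complex_hilbert_space) urep \<Rightarrow> bool" where
  "unitary_rep \<pi> \<longleftrightarrow> closed_csubspace (rep_space \<pi>) \<and>
    (\<forall>g. unitary_between (rep_space \<pi>) (rep_space \<pi>) (rep_op \<pi> g)) \<and>
    (\<forall>g h. \<forall>x\<in>rep_space \<pi>. rep_op \<pi> (g + h) x = rep_op \<pi> g (rep_op \<pi> h x)) \<and>
    (\<forall>x\<in>rep_space \<pi>. continuous_on UNIV (\<lambda>g. rep_op \<pi> g x))"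

definition invariant_subspace ::
    "('g, 'h::complex_hilbert_space) urep \<Rightarrow> 'h set \<Rightarrow> bool" where
  "invariant_subspace \<pi> W \<longleftrightarrow>
    closed_csubspace W \<and> W \<subseteq> rep_space \<pi> \<and> (\<forall>g. rep_op \<pi> g ` W \<subseteq> W)"

definition subrep :: "('g, 'h) urep \<Rightarrow> 'h set \<Rightarrow> ('g, 'h) urep" where
  "subrep \<pi> W = Rep W (rep_op \<pi>)"

definition irreducible_rep ::
    "('g::topological_group_add, 'h::complex_hilbert_space) urep \<Rightarrow> bool" where
  "irreducible_rep \<pi> \<longleftrightarrow> unitary_rep \<pi> \<and> rep_space \<pi> \<noteq> {0} \<and>
    (\<forall>W. invariant_subspace \<pi> W \<longrightarrow> W = {0} \<or> W = rep_space \<pi>)"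

definition unitarily_equivalent ::
    "('g, 'h::complex_hilbert_space) urep \<Rightarrow> ('g, 'h) urep \<Rightarrow> bool" where
  "unitarily_equivalent \<pi> \<rho> \<longleftrightarrow> (\<exists>U. unitary_between (rep_space \<pi>) (rep_space \<rho>) U \<and>
    (\<forall>g. \<forall>x\<in>rep_space \<pi>. U (rep_op \<pi> g x) = rep_op \<rho> g (U x)))"

definition commutant ::
    "('g, 'h::complex_hilbert_space) urep \<Rightarrow> ('h \<Rightarrow> 'h) set" where
  "commutant \<pi> = {T. bounded_operator_on (rep_space \<pi>) T \<and>
    (\<forall>g. \<forall>x\<in>rep_space \<pi>. T (rep_op \<pi> g x) = rep_op \<pi> g (T x))}"

text \<open>A factor (primary) representation: the centre of the commutant consists of the scalars.\<close>

definition factor_rep ::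
    "('g::topological_group_add, 'h::complex_hilbert_space) urep \<Rightarrow> bool" where
  "factor_rep \<pi> \<longleftrightarrow> unitary_rep \<pi> \<and>
    (\<forall>T\<in>commutant \<pi>. (\<forall>S\<in>commutant \<pi>. \<forall>x\<in>rep_space \<pi>. T (S x) = S (T x)) \<longrightarrow>
      (\<exists>a. \<forall>x\<in>rep_space \<pi>. T x = a *\<^sub>C x))"

text \<open>\<open>\<pi>\<close> is the Hilbert sum of a family of copies of \<open>\<rho>\<close>. (The real span of a union of complex
  subspaces is already a complex subspace.)\<close>

definition multiple_of ::
    "('g, 'h::complex_hilbert_space) urep \<Rightarrow> ('g, 'h) urep \<Rightarrow> bool" where
  "multiple_of \<pi> \<rho> \<longleftrightarrow> (\<exists>\<W>.
    (\<forall>W\<in>\<W>. invariant_subspace \<pi> W \<and> unitarily_equivalent (subrep \<pi> W) \<rho>) \<and>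
    (\<forall>W\<in>\<W>. \<forall>W'\<in>\<W>. W \<noteq> W' \<longrightarrow> (\<forall>x\<in>W. \<forall>y\<in>W'. cinner x y = 0)) \<and>
    closure (span (\<Union>\<W>)) = rep_space \<pi>)"

text \<open>Every separable Hilbert space is isomorphic to a closed subspace of \<open>ell2\<close>. This suffices for
  second countable groups: their irreducible representations act on separable spaces, and being
  type I is determined by the separable factor representations.\<close>

definition type_I :: "'g::topological_group_add itself \<Rightarrow> bool" where
  "type_I _ \<longleftrightarrow> (\<forall>\<pi> :: ('g, ell2) urep. factor_rep \<pi> \<longrightarrow>
    (\<exists>\<rho> :: ('g, ell2) urep. irreducible_rep \<rho> \<and> multiple_of \<pi> \<rho>))"


section \<open>Haar measures\<close>

definition add_subgroup :: "'g::group_add set \<Rightarrow> bool" where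
  "add_subgroup H \<longleftrightarrow> 0 \<in> H \<and> (\<forall>x\<in>H. \<forall>y\<in>H. x + y \<in> H) \<and> (\<forall>x\<in>H. - x \<in> H)"

text \<open>Regularity is automatic for the second countable locally compact groups considered here.\<close>

definition left_haar_measure :: "'g::topological_group_add set \<Rightarrow> 'g measure \<Rightarrow> bool" where
  "left_haar_measure H \<mu> \<longleftrightarrow> sets \<mu> = sets (restrict_space borel H) \<and>
    (\<forall>h\<in>H. \<forall>A\<in>sets \<mu>. emeasure \<mu> ((+) h ` A) = emeasure \<mu> A) \<and>
    (\<forall>K\<subseteq>H. compact K \<longrightarrow> emeasure \<mu> K < \<infinity>) \<and> emeasure \<mu> H \<noteq> 0"

definition unimodular :: "'g::topological_group_add itself \<Rightarrow> bool" where
  "unimodular _ \<longleftrightarrow> (\<forall>\<mu> :: 'g measure. left_haar_measure UNIV \<mu> \<longrightarrow>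
    (\<forall>g. \<forall>A\<in>sets \<mu>. emeasure \<mu> ((\<lambda>x. x + g) ` A) = emeasure \<mu> A))"


section \<open>The unitary dual\<close>

type_synonym 'g dual_point = "('g, ell2) urep set"

definition unitary_dual :: "'g::topological_group_add dual_point set" where
  "unitary_dual = Collect irreducible_rep //
    {(\<pi>, \<rho>). irreducible_rep \<pi> \<and> irreducible_rep \<rho> \<and> unitarily_equivalent \<pi> \<rho>}"

definition positive_type_functions :: "'g dual_point \<Rightarrow> ('g \<Rightarrow> complex) set" where
  "positive_type_functions c = {\<lambda>g. cinner (rep_op \<pi> g x) x | \<pi> x. \<pi> \<in> c \<and> x \<in> rep_space \<pi>}"

definition positive_type_sums :: "'g dual_point \<Rightarrow> ('g \<Rightarrow> complex) set" where
  "positive_type_sums c =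
    {\<lambda>g. \<Sum>\<phi>\<leftarrow>\<phi>s. \<phi> g | \<phi>s. set \<phi>s \<subseteq> positive_type_functions c}"

definition fell_nbhd ::
    "('g::topological_group_add \<Rightarrow> complex) set \<Rightarrow> 'g set \<Rightarrow> real \<Rightarrow> 'g dual_point set" where
  "fell_nbhd \<Phi> Q e = {c\<in>unitary_dual.
    \<forall>\<phi>\<in>\<Phi>. \<exists>\<psi>\<in>positive_type_sums c. \<forall>g\<in>Q. cmod (\<phi> g - \<psi> g) < e}"

text \<open>The topology with basis the sets \<open>fell_nbhd \<Phi> Q e\<close>, for \<open>\<Phi>\<close> a finite set of functions of
  positive type associated with some point, \<open>Q\<close> compact and \<open>e > 0\<close>.\<close>

definition fell_topology :: "'g::topological_group_add dual_point topology" where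
  "fell_topology = topology_generated_by {fell_nbhd \<Phi> Q e | \<Phi> Q e c.
    c \<in> unitary_dual \<and> finite \<Phi> \<and> \<Phi> \<subseteq> positive_type_functions c \<and> compact Q \<and> 0 < e}"

definition dual_borel :: "'g::topological_group_add dual_point measure" where
  "dual_borel = sigma unitary_dual {U. openin fell_topology U}"

text \<open>An operator field is measurable if its matrix coefficients with respect to the projections of
  the standard basis of \<open>ell2\<close>, which form a fundamental sequence of vector fields, are measurable.
  Here \<open>V c\<close> is the Hilbert space over the point \<open>c\<close>.\<close>

definition measurable_operator_field ::
    "'c measure \<Rightarrow> ('c \<Rightarrow> ell2 set) \<Rightarrow> ('c \<Rightarrow> ell2 \<Rightarrow> ell2) \<Rightarrow> bool" where
  "measurable_operator_field M V T \<longleftrightarrow> (\<forall>i j.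
    (\<lambda>c. cinner (T c (orth_proj (V c) (ell2_unit i))) (orth_proj (V c) (ell2_unit j)))
      \<in> borel_measurable M)"

text \<open>The fixed representatives form a measurable field of representations, which is what gives
  the notion of a measurable operator field on the dual its meaning. At \<open>g = 0\<close> the
  condition says that the Hilbert spaces form a measurable field.\<close>

definition dual_representatives ::
    "('g::topological_group_add dual_point \<Rightarrow> ('g, ell2) urep) \<Rightarrow> bool" where
  "dual_representatives R \<longleftrightarrow> (\<forall>c\<in>unitary_dual. R c \<in> c) \<and>
    (\<forall>g. measurable_operator_field dual_borel (\<lambda>c. rep_space (R c)) (\<lambda>c. rep_op (R c) g))"


section \<open>Fourier transform and Plancherel measure\<close>

definition fourier ::
    "'g measure \<Rightarrow> ('g \<Rightarrow> complex) \<Rightarrow> ('g, ell2) urep \<Rightarrow> ell2 \<Rightarrow> ell2" where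
  "fourier \<mu> f \<sigma> x = (\<integral>g. f g *\<^sub>C cadjoint_on (rep_space \<sigma>) (rep_op \<sigma> g) x \<partial>\<mu>)"

definition integrable_operator_field ::
    "'c measure \<Rightarrow> ('c \<Rightarrow> ell2 set) \<Rightarrow> ('c \<Rightarrow> ell2 \<Rightarrow> ell2) \<Rightarrow> bool" where
  "integrable_operator_field M V T \<longleftrightarrow> measurable_operator_field M V T \<and>
    (AE c in M. trace_class_on (V c) (T c)) \<and> integrable M (\<lambda>c. trace_norm (V c) (T c))"

definition fourier_integrable ::
    "'g measure \<Rightarrow> ('g dual_point \<Rightarrow> ('g, ell2) urep) \<Rightarrow> 'g dual_point measure \<Rightarrow>
      ('g \<Rightarrow> complex) \<Rightarrow> bool" where
  "fourier_integrable \<mu> R M f \<longleftrightarrow>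
    integrable_operator_field M (\<lambda>c. rep_space (R c)) (\<lambda>c. fourier \<mu> f (R c))"

text \<open>A Borel measure on the dual for which the inversion formula holds. It is completed, so that
  functions that are only determined almost everywhere (such as the trace of an almost everywhere
  trace class field) can be integrated.\<close>

definition plancherel_measure ::
    "'g::topological_group_add measure \<Rightarrow> ('g dual_point \<Rightarrow> ('g, ell2) urep) \<Rightarrow>
      'g dual_point measure \<Rightarrow> bool" where
  "plancherel_measure \<mu> R M \<longleftrightarrow>
    (\<exists>N. sets N = sets (dual_borel :: 'g dual_point measure) \<and> M = completion N) \<and>
    (\<forall>f. integrable \<mu> f \<and> fourier_integrable \<mu> R M f \<longrightarrow>
      (AE g in \<mu>. f g =
        (\<integral>c. op_trace (rep_space (R c)) (\<lambda>x. fourier \<mu> f (R c) (rep_op (R c) g x)) \<partial>M)))"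


section \<open>The reciprocal space\<close>

definition fixed_vectors :: "'g set \<Rightarrow> ('g, 'h) urep \<Rightarrow> 'h set" where
  "fixed_vectors H \<sigma> = {x\<in>rep_space \<sigma>. \<forall>h\<in>H. rep_op \<sigma> h x = x}"

text \<open>The restriction to \<open>H\<close> contains the trivial representation iff it has a nonzero fixed vector.\<close>

definition reciprocal_space :: "'g::topological_group_add set \<Rightarrow> 'g dual_point set" where
  "reciprocal_space H = {c\<in>unitary_dual. \<exists>\<sigma>\<in>c. \<exists>x\<in>fixed_vectors H \<sigma>. x \<noteq> 0}"

end

theory Submission
  imports Defs
begin

text \<open>A trace class operator \<open>T\<close> on \<open>\<H>\<^sub>\<sigma>\<close> is a sum of rank one operators \<open>\<langle>\<cdot>, b\<^sub>n\<rangle> a\<^sub>n\<close> with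
  \<open>\<Sum> \<parallel>a\<^sub>n\<parallel> \<parallel>b\<^sub>n\<parallel> \<le> \<parallel>T\<parallel>\<^sub>1\<close>, so \<open>tr (T \<sigma>(g)) = \<Sum> \<langle>\<sigma>(g) a\<^sub>n, b\<^sub>n\<rangle>\<close> is continuous in \<open>g\<close> and bounded by
  \<open>\<parallel>T\<parallel>\<^sub>1\<close>. By dominated convergence the right-hand side of the inversion formula is continuous in
  \<open>g\<close>; since nonempty open sets have positive Haar measure, the formula holds for every \<open>g\<close>, in
  particular on the (possibly null) set \<open>H\<close>. Integrate it over \<open>H\<close>, interchange the integrals, and
  use that \<open>\<integral>\<^sub>H \<sigma>(h) dh\<close> is the projection onto the \<open>H\<close>-fixed vectors, which vanishes off the
  reciprocal space.\<close>

section \<open>Hilbert space preliminaries\<close>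

text \<open>Measurability shapes the proof. \<open>op_trace\<close> uses an arbitrarily chosen
  orthonormal basis of each fibre, with no measurable dependence on the point of the dual, whereas
  the hypotheses give measurable coefficients only at the projections of the standard basis of
  \<open>ell2\<close>. These projections form a Parseval frame of the fibre, in general not an
  orthonormal basis, so the trace has to be computable in every Parseval frame. The rank one
  expansion provides this. It also settles the order of the factors: averaging
  \<open>T \<sigma>(h)\<close> over H gives \<open>\<Sum> <P a_n, b_n>\<close>, which is the trace
  of \<open>P T\<close> because P is self-adjoint. The reciprocal space is not assumed measurable
  either: it is the set where P has a nonzero diagonal coefficient at some frame vector, and these
  coefficients are integrals over H of coefficients of \<sigma>. Since the trace norm is defined
  through |T|, the expansion rests on positive square roots and a polar decomposition, obtained here
  from one minimisation and one iteration.\<close>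

lemma cinner_scaleC_right:
  "cinner x (a *\<^sub>C y) = cnj a * cinner x (y :: 'h::complex_hilbert_space)"
  by (metis cinner_commute cinner_scaleC_left complex_cnj_mult complex_cnj_cnj)

lemma norm_scaleC: "norm (a *\<^sub>C x) = cmod a * norm (x :: 'h::complex_hilbert_space)"
proof -
  have "(norm (a *\<^sub>C x))\<^sup>2 = Re ((a * cnj a) * cinner x x)"
    unfolding power2_norm_eq_inner Re_cinner[symmetric] cinner_scaleC_left cinner_scaleC_right by (simp add: mult_ac)
  also have "\<dots> = (cmod a * norm x)\<^sup>2"
    unfolding complex_norm_square[symmetric]
    by (simp add: Re_cinner power2_norm_eq_inner power_mult_distrib)
  finally show ?thesis by (rule power2_eq_imp_eq) auto
qed

lemma cinner_add_right:
  "cinner x (y + z) = cinner x y + cinner x (z :: 'h::complex_hilbert_space)"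
  by (metis cinner_commute cinner_add_left complex_cnj_add)

lemma cinner_self: "cinner x x = of_real ((norm (x :: 'h::complex_hilbert_space))\<^sup>2)"
proof -
  have "Im (cinner x x) = 0"
    using cinner_commute[of x x] by (metis Reals_cnj_iff complex_is_Real_iff)
  then show ?thesis by (simp add: complex_eq_iff Re_cinner power2_norm_eq_inner)
qed

text \<open>Reduces to the real Cauchy-Schwarz inequality: multiplying x by the phase
  \<open>u\<close> turns the complex inner product into its modulus, hence into a real inner
  product.\<close>

lemma cmod_cinner_le: "cmod (cinner x y) \<le> norm x * norm (y :: 'h::complex_hilbert_space)"
proof (cases "cinner x y = 0")
  case False
  define u where "u = cnj (cinner x y) / of_real (cmod (cinner x y))"
  have u: "cmod u = 1" using False by (simp add: u_def norm_divide)
  have "u * cinner x y = of_real (cmod (cinner x y))"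
    using False complex_norm_square[of "cinner x y"] by (simp add: u_def field_simps power2_eq_square)
  then have "cmod (cinner x y) = inner (u *\<^sub>C x) y"
    unfolding Re_cinner[symmetric] cinner_scaleC_left by simp
  also have "\<dots> \<le> norm (u *\<^sub>C x) * norm y" by (rule norm_cauchy_schwarz)
  finally show ?thesis by (simp add: norm_scaleC u)
qed simp

lemma cinner_scaleR_left: "cinner (r *\<^sub>R x) y = of_real r * cinner x (y :: 'h::complex_hilbert_space)"
  by (metis cinner_scaleC_left scaleC_of_real)

lemma cinner_scaleR_right: "cinner x (r *\<^sub>R y) = of_real r * cinner x (y :: 'h::complex_hilbert_space)"
  by (metis cinner_scaleC_right complex_cnj_complex_of_real scaleC_of_real)

text \<open>Conjugate linearity in the second argument is still real linearity, so the rules for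
  limits, continuity and finite sums of bounded bilinear maps become available.\<close>

interpretation cinner: bounded_bilinear "cinner :: 'h::complex_hilbert_space \<Rightarrow> 'h \<Rightarrow> complex"
proof
  show "\<exists>K. \<forall>a b :: 'h. cmod (cinner a b) \<le> norm a * norm b * K"
    by (rule exI[of _ 1]) (simp add: cmod_cinner_le)
qed (simp_all add: cinner_add_left cinner_add_right cinner_scaleR_left cinner_scaleR_right scaleR_conv_of_real)

lemma scaleC_diff_right: "a *\<^sub>C (x - y) = a *\<^sub>C x - a *\<^sub>C (y :: 'h::complex_hilbert_space)"
  using scaleC_add_right[of a "x - y" y] by simp

lemma bounded_linear_scaleC: "bounded_linear (\<lambda>x :: 'h::complex_hilbert_space. a *\<^sub>C x)"
  by (rule bounded_linear_intro[where K = "cmod a"])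
    (simp_all add: scaleC_add_right norm_scaleC scaleC_of_real[symmetric] scaleC_scaleC mult.commute)

lemma closed_csubspaceD:
  assumes "closed_csubspace V"
  shows "closed V" "0 \<in> V" "x \<in> V \<Longrightarrow> y \<in> V \<Longrightarrow> x + y \<in> V" "x \<in> V \<Longrightarrow> a *\<^sub>C x \<in> V"
    "x \<in> V \<Longrightarrow> r *\<^sub>R x \<in> V" "x \<in> V \<Longrightarrow> y \<in> V \<Longrightarrow> x - y \<in> V"
proof -
  show "closed V" "0 \<in> V" "x \<in> V \<Longrightarrow> a *\<^sub>C x \<in> V"
    and add: "\<And>x y. x \<in> V \<Longrightarrow> y \<in> V \<Longrightarrow> x + y \<in> V"
    using assms by (auto simp: closed_csubspace_def)
  show R: "x \<in> V \<Longrightarrow> r *\<^sub>R x \<in> V" for x r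
    unfolding scaleC_of_real[symmetric] using assms by (simp add: closed_csubspace_def)
  show "x \<in> V \<Longrightarrow> y \<in> V \<Longrightarrow> x - y \<in> V"
    using add[of x "(-1) *\<^sub>R y"] R[of y "-1"] by simp
qed

lemma cinner_eqI:
  assumes "closed_csubspace V" "x \<in> V" "y \<in> V" "\<And>z. z \<in> V \<Longrightarrow> cinner z x = cinner z y"
  shows "x = y"
proof -
  have "cinner (x - y) (x - y) = 0"
    using assms(4)[of "x - y"] closed_csubspaceD(6)[OF assms(1-3)] by (simp add: cinner.diff_right)
  then show ?thesis by (simp add: cinner_self)
qed

lemma clinear_onD:
  assumes "clinear_on V T"
  shows "x \<in> V \<Longrightarrow> y \<in> V \<Longrightarrow> T (x + y) = T x + T y" "x \<in> V \<Longrightarrow> T (a *\<^sub>C x) = a *\<^sub>C T x"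
    "x \<in> V \<Longrightarrow> T (r *\<^sub>R x) = r *\<^sub>R T x"
  using assms unfolding clinear_on_def scaleC_of_real[symmetric] by auto

lemma clinear_on_diff:
  assumes "clinear_on V T" "closed_csubspace V" "x \<in> V" "y \<in> V"
  shows "T (x - y) = T x - T y"
  using clinear_onD(1)[OF assms(1) assms(3), of "(-1) *\<^sub>R y"] clinear_onD(3)[OF assms(1) assms(4), of "-1"]
    closed_csubspaceD(5)[OF assms(2,4), of "-1"] by simp

text \<open>The first-order condition for a minimum. With \<open>c\<close> a positive bound for b,
  the choice \<open>t = - a / c\<close> would give at most \<open>- a\<^sup>2 / c\<close>.\<close>

lemma linear_coefficient_zero:
  fixes a b :: real
  assumes "\<And>t. 0 \<le> 2 * t * a + t\<^sup>2 * b"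
  shows "a = 0"
proof (rule ccontr)
  assume a: "a \<noteq> 0"
  define c where "c = \<bar>b\<bar> + 1"
  have c: "c > 0" "b \<le> c" by (auto simp: c_def)
  have "2 * (- a / c) * a + (- a / c)\<^sup>2 * b \<le> 2 * (- a / c) * a + (- a / c)\<^sup>2 * c"
    by (intro add_left_mono mult_left_mono c) auto
  also have "\<dots> = - (a\<^sup>2 / c)" using c(1) by (simp add: field_simps power2_eq_square)
  also have "\<dots> < 0" using a c(1) by simp
  finally show False using assms[of "- a / c"] by simp
qed

text \<open>The Riesz representation theorem in the form of Douglas' factorisation lemma: \<open>A = id\<close> gives
  Riesz, projections and adjoints, and \<open>A = |T|\<close>, \<open>\<phi> = \<langle>T \<cdot>, y\<rangle>\<close> gives the polar decomposition.
  The vector \<open>z\<close> is the limit of \<open>A x\<^sub>n\<close> along a minimising sequence of \<open>J\<close>.\<close>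

lemma douglas_riesz:
  fixes A :: "'h::complex_hilbert_space \<Rightarrow> 'h" and \<phi> :: "'h \<Rightarrow> complex"
  assumes V: "closed_csubspace V" and A: "clinear_on V A"
    and add: "\<And>x y. x \<in> V \<Longrightarrow> y \<in> V \<Longrightarrow> \<phi> (x + y) = \<phi> x + \<phi> y"
    and scale: "\<And>a x. x \<in> V \<Longrightarrow> \<phi> (a *\<^sub>C x) = a * \<phi> x"
    and K: "K \<ge> 0" and bound: "\<And>x. x \<in> V \<Longrightarrow> cmod (\<phi> x) \<le> K * norm (A x)"
  obtains z where "z \<in> closure (A ` V)" "norm z \<le> K" "\<And>x. x \<in> V \<Longrightarrow> \<phi> x = cinner (A x) z"
proof -
  \<comment> \<open>If \<phi> is represented by z, then \<open>J x\<close> is the squared distance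
    from \<open>A x\<close> to z minus the squared norm of z, so minimising \<open>J\<close> drives
    \<open>A x\<close> towards z.\<close>
  define J where "J x = (norm (A x))\<^sup>2 - 2 * Re (\<phi> x)" for x
  have scaleR: "\<phi> (r *\<^sub>R x) = of_real r * \<phi> x" if "x \<in> V" for r x
    using scale[OF that, of "of_real r"] by (simp add: scaleC_of_real)
  have Jlow: "- K\<^sup>2 \<le> J x" if "x \<in> V" for x
  proof -
    have "Re (\<phi> x) \<le> K * norm (A x)" using bound[OF that] complex_Re_le_cmod[of "\<phi> x"] by linarith
    moreover have "0 \<le> (norm (A x) - K)\<^sup>2" by (rule zero_le_power2)
    ultimately show ?thesis unfolding J_def power2_diff mult.commute[of K] by linarith
  qed
  define j where "j = Inf (J ` V)"
  have bdd: "bdd_below (J ` V)" using Jlow by (auto simp: bdd_below_def)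
  have jle: "j \<le> J x" if "x \<in> V" for x
    unfolding j_def using bdd that by (intro cInf_lower) auto
  have "\<exists>x\<in>V. J x < j + 1 / (real n + 1)" for n
  proof -
    have 1: "J ` V \<noteq> {}" using closed_csubspaceD(2)[OF V] by auto
    have 2: "Inf (J ` V) < j + 1 / (real n + 1)" by (simp add: j_def)
    show ?thesis using cInf_lessD[OF 1 2] by auto
  qed
  then obtain u where uV: "\<And>n. u n \<in> V" and uJ: "\<And>n. J (u n) < j + 1 / (real n + 1)" by metis
  \<comment> \<open>Parallelogram law: the linear terms of \<open>J\<close> cancel against those at
    the midpoint \<open>w\<close>, where \<open>J\<close> is at least \<open>j\<close>.\<close>
  have par: "(norm (A (u n) - A (u m)))\<^sup>2 \<le> 2 / (real n + 1) + 2 / (real m + 1)" for n m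
  proof -
    define w where "w = (1/2) *\<^sub>R (u n + u m)"
    have s: "u n + u m \<in> V" using uV closed_csubspaceD(3)[OF V] by auto
    then have w: "w \<in> V" unfolding w_def using closed_csubspaceD(5)[OF V] by auto
    have Aw: "A w = (1/2) *\<^sub>R (A (u n) + A (u m))"
      unfolding w_def using clinear_onD(3)[OF A s] clinear_onD(1)[OF A uV uV] by simp
    have pw: "Re (\<phi> w) = (Re (\<phi> (u n)) + Re (\<phi> (u m))) / 2"
      unfolding w_def using scaleR[OF s] add[OF uV uV] by simp
    have "(norm (A (u n) - A (u m)))\<^sup>2 = 2 * J (u n) + 2 * J (u m) - 4 * J w"
      unfolding J_def pw Aw power2_norm_eq_inner
      by (simp add: inner_add_left inner_add_right inner_diff_left inner_diff_right inner_commute algebra_simps)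
    also have "\<dots> \<le> 2 * (j + 1 / (real n + 1)) + 2 * (j + 1 / (real m + 1)) - 4 * j"
      using uJ[of n] uJ[of m] jle[OF w] by (intro diff_mono add_mono mult_left_mono less_imp_le) auto
    finally show ?thesis by (simp add: algebra_simps)
  qed
  have "Cauchy (\<lambda>n. A (u n))"
  proof (rule metric_CauchyI)
    fix e :: real assume e: "e > 0"
    obtain N :: nat where N: "4 / e\<^sup>2 < real N" using reals_Archimedean2 by blast
    have small: "2 / (real n + 1) < e\<^sup>2 / 2" if "n \<ge> N" for n
    proof -
      have "4 / e\<^sup>2 < real n + 1" using N that by linarith
      then show ?thesis using e by (simp add: field_simps)
    qed
    have "dist (A (u m)) (A (u n)) < e" if "m \<ge> N" "n \<ge> N" for m n
    proof -
      have "(norm (A (u m) - A (u n)))\<^sup>2 < e\<^sup>2"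
        using par[of m n] small[OF that(1)] small[OF that(2)] by linarith
      then show ?thesis unfolding dist_norm using e by (meson power2_less_imp_less less_imp_le)
    qed
    then show "\<exists>M. \<forall>m\<ge>M. \<forall>n\<ge>M. dist (A (u m)) (A (u n)) < e" by blast
  qed
  then obtain z where z: "(\<lambda>n. A (u n)) \<longlonglongrightarrow> z"
    by (auto simp: Cauchy_convergent_iff convergent_def)
  have zc: "z \<in> closure (A ` V)"
    using z uV unfolding closure_sequential by (intro exI[of _ "\<lambda>n. A (u n)"]) auto
  \<comment> \<open>The sequence \<open>u\<close> itself need not converge, so there may be no
    minimiser in V. The variation in direction x is carried out at \<open>u n\<close>, and the
    defect \<open>1 / (n + 1)\<close> disappears in the limit.\<close>
  have re: "Re (\<phi> x) = Re (cinner (A x) z)" if x: "x \<in> V" for x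
  proof -
    have "inner z (A x) - Re (\<phi> x) = 0"
    proof (rule linear_coefficient_zero[where b = "(norm (A x))\<^sup>2"])
      fix t :: real
      have "0 \<le> 1 / (real n + 1) + 2 * t * (inner (A (u n)) (A x) - Re (\<phi> x)) + t\<^sup>2 * (norm (A x))\<^sup>2" for n
      proof -
        have tx: "t *\<^sub>R x \<in> V" using closed_csubspaceD(5)[OF V x] .
        have "J (u n + t *\<^sub>R x) = J (u n) + 2 * t * (inner (A (u n)) (A x) - Re (\<phi> x)) + t\<^sup>2 * (norm (A x))\<^sup>2"
          unfolding J_def add[OF uV tx] clinear_onD(1)[OF A uV tx] clinear_onD(3)[OF A x] scaleR[OF x]
            power2_norm_eq_inner
          by (simp add: inner_add_left inner_add_right inner_commute algebra_simps power2_eq_square)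
        moreover have "j \<le> J (u n + t *\<^sub>R x)" using jle closed_csubspaceD(3)[OF V uV tx] by blast
        ultimately show ?thesis using uJ[of n] by linarith
      qed
      moreover have "(\<lambda>n. 1 / (real n + 1) + 2 * t * (inner (A (u n)) (A x) - Re (\<phi> x)) + t\<^sup>2 * (norm (A x))\<^sup>2)
          \<longlonglongrightarrow> 0 + 2 * t * (inner z (A x) - Re (\<phi> x)) + t\<^sup>2 * (norm (A x))\<^sup>2"
        using LIMSEQ_inverse_real_of_nat
        by (intro tendsto_intros z) (simp add: inverse_eq_divide add.commute)
      ultimately have "0 \<le> 0 + 2 * t * (inner z (A x) - Re (\<phi> x)) + t\<^sup>2 * (norm (A x))\<^sup>2"
        by (intro LIMSEQ_le_const) blast+
      then show "0 \<le> 2 * t * (inner z (A x) - Re (\<phi> x)) + t\<^sup>2 * (norm (A x))\<^sup>2" by simp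
    qed
    then show ?thesis by (simp add: Re_cinner inner_commute)
  qed
  have eq: "\<phi> x = cinner (A x) z" if x: "x \<in> V" for x
  proof (rule complex_eqI)
    show "Re (\<phi> x) = Re (cinner (A x) z)" using re[OF x] .
    have "Re (\<i> * \<phi> x) = Re (\<i> * cinner (A x) z)"
      using re[OF closed_csubspaceD(4)[OF V x, of \<i>]] scale[OF x] clinear_onD(2)[OF A x]
      by (simp add: cinner_scaleC_left)
    then show "Im (\<phi> x) = Im (cinner (A x) z)" by simp
  qed
  \<comment> \<open>The bound on \<phi> is tested on \<open>u n\<close>, whose image tends to z;
    this gives the sharp constant K for the norm of z.\<close>
  have "Re (cinner (A (u n)) z) \<le> K * norm (A (u n))" for n
    using bound[OF uV[of n]] complex_Re_le_cmod[of "\<phi> (u n)"] eq[OF uV[of n]] by simp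
  moreover have "(\<lambda>n. Re (cinner (A (u n)) z)) \<longlonglongrightarrow> Re (cinner z z)"
    by (intro tendsto_intros cinner.tendsto z)
  moreover have "(\<lambda>n. K * norm (A (u n))) \<longlonglongrightarrow> K * norm z" by (intro tendsto_intros z)
  ultimately have "Re (cinner z z) \<le> K * norm z" by (meson LIMSEQ_le)
  then have "norm z * norm z \<le> K * norm z" by (simp add: cinner_self power2_eq_square)
  then have "norm z \<le> K" using K by (cases "norm z = 0") (auto simp: mult_le_cancel_right)
  with zc eq show ?thesis using that by blast
qed

section \<open>Riesz representation, orthogonal projections and adjoints\<close>

lemma riesz:
  fixes \<phi> :: "'h::complex_hilbert_space \<Rightarrow> complex"
  assumes V: "closed_csubspace V"
    and "\<And>x y. x \<in> V \<Longrightarrow> y \<in> V \<Longrightarrow> \<phi> (x + y) = \<phi> x + \<phi> y"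
    and "\<And>a x. x \<in> V \<Longrightarrow> \<phi> (a *\<^sub>C x) = a * \<phi> x"
    and "K \<ge> 0" and "\<And>x. x \<in> V \<Longrightarrow> cmod (\<phi> x) \<le> K * norm x"
  obtains z where "z \<in> V" "norm z \<le> K" "\<And>x. x \<in> V \<Longrightarrow> \<phi> x = cinner x z"
proof -
  obtain z where "z \<in> closure ((\<lambda>x. x) ` V)" "norm z \<le> K" "\<And>x. x \<in> V \<Longrightarrow> \<phi> x = cinner x z"
    by (rule douglas_riesz[OF V, where A = "\<lambda>x. x" and \<phi> = \<phi> and K = K])
      (use assms in \<open>auto simp: clinear_on_def\<close>)
  then show ?thesis using that closed_csubspaceD(1)[OF V] by auto
qed

lemma orth_proj_eqI:
  assumes W: "closed_csubspace W" and y: "y \<in> W" and eq: "\<And>z. z \<in> W \<Longrightarrow> cinner z y = cinner z x"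
  shows "orth_proj W x = y"
  unfolding orth_proj_def
proof (rule the_equality)
  have "cinner x z = cinner y z" if "z \<in> W" for z
    using eq[OF that] by (metis cinner_commute)
  then show "y \<in> W \<and> (\<forall>z\<in>W. cinner (x - y) z = 0)" using y by (simp add: cinner.diff_left)
  fix y' assume y': "y' \<in> W \<and> (\<forall>z\<in>W. cinner (x - y') z = 0)"
  show "y' = y"
  proof (rule cinner_eqI[OF W])
    fix z assume z: "z \<in> W"
    then have "cinner x z = cinner y' z" using y' by (simp add: cinner.diff_left)
    then show "cinner z y' = cinner z y" using eq[OF z] by (metis cinner_commute)
  qed (use y y' in auto)
qed

lemma orth_proj:
  assumes W: "closed_csubspace W"
  shows orth_proj_in: "orth_proj W x \<in> W"
    and cinner_orth_proj: "z \<in> W \<Longrightarrow> cinner z (orth_proj W x) = cinner z x"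
    and cinner_orth_proj_left: "z \<in> W \<Longrightarrow> cinner (orth_proj W x) z = cinner x z"
proof -
  obtain y where y: "y \<in> W" "\<And>z. z \<in> W \<Longrightarrow> cinner z x = cinner z y"
    by (rule riesz[OF W, where \<phi> = "\<lambda>z. cinner z x" and K = "norm x"])
      (auto simp: cinner_add_left cinner_scaleC_left mult.commute intro: order_trans[OF cmod_cinner_le])
  have "orth_proj W x = y" by (rule orth_proj_eqI[OF W y(1)]) (simp add: y(2))
  then show "orth_proj W x \<in> W" and 1: "\<And>z. z \<in> W \<Longrightarrow> cinner z (orth_proj W x) = cinner z x"
    using y by auto
  show "z \<in> W \<Longrightarrow> cinner (orth_proj W x) z = cinner x z"
    using 1[of z] by (metis cinner_commute)
qed

lemma bounded_operator_onD:
  assumes "bounded_operator_on V T"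
  shows "x \<in> V \<Longrightarrow> T x \<in> V" "clinear_on V T"
  using assms by (auto simp: bounded_operator_on_def)

lemma bounded_operator_on_bound:
  assumes "bounded_operator_on V T"
  obtains K where "K > 0" "\<And>x. x \<in> V \<Longrightarrow> norm (T x) \<le> K * norm x"
proof -
  obtain K where K: "\<And>x. x \<in> V \<Longrightarrow> norm (T x) \<le> K * norm x"
    using assms by (auto simp: bounded_operator_on_def)
  show ?thesis
  proof (rule that[of "max K 1"])
    fix x assume "x \<in> V"
    show "norm (T x) \<le> max K 1 * norm x"
      using K[OF \<open>x \<in> V\<close>] mult_right_mono[of K "max K 1" "norm x"] by simp
  qed simp
qed

lemma cadjoint_on:
  assumes V: "closed_csubspace V" and T: "bounded_operator_on V T"
  shows cadjoint_on_in: "cadjoint_on V T y \<in> V"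
    and cinner_cadjoint_on: "x \<in> V \<Longrightarrow> cinner (T x) y = cinner x (cadjoint_on V T y)"
proof -
  obtain K where K: "K > 0" "\<And>x. x \<in> V \<Longrightarrow> norm (T x) \<le> K * norm x"
    using bounded_operator_on_bound[OF T] by blast
  have lin: "clinear_on V T" using bounded_operator_onD(2)[OF T] .
  obtain z where z: "z \<in> V" "\<And>x. x \<in> V \<Longrightarrow> cinner (T x) y = cinner x z"
  proof (rule riesz[OF V, where \<phi> = "\<lambda>x. cinner (T x) y" and K = "K * norm y"])
    fix x assume "x \<in> V"
    have "cmod (cinner (T x) y) \<le> norm (T x) * norm y" by (rule cmod_cinner_le)
    also have "\<dots> \<le> K * norm x * norm y" using K(2)[OF \<open>x \<in> V\<close>] by (intro mult_right_mono) auto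
    finally show "cmod (cinner (T x) y) \<le> K * norm y * norm x" by (simp add: mult_ac)
  qed (use K(1) in \<open>auto simp: clinear_onD[OF lin] cinner_add_left cinner_scaleC_left\<close>)
  have "cadjoint_on V T y = z"
    unfolding cadjoint_on_def
  proof (rule the_equality)
    show "z \<in> V \<and> (\<forall>x\<in>V. cinner (T x) y = cinner x z)" using z by auto
    show "z' = z" if "z' \<in> V \<and> (\<forall>x\<in>V. cinner (T x) y = cinner x z')" for z'
      by (rule cinner_eqI[OF V]) (use that z in auto)
  qed
  then show "cadjoint_on V T y \<in> V" "x \<in> V \<Longrightarrow> cinner (T x) y = cinner x (cadjoint_on V T y)"
    using z by auto
qed

section \<open>Parseval frames\<close>

text \<open>The vectors may be linearly dependent or zero. Orthonormal bases (with v the identity)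
  and projections of orthonormal bases of a larger space are both covered. Unordered sums are used
  because the basis \<open>onb_of V\<close> comes without an enumeration.\<close>

definition parseval_frame :: "'h::complex_hilbert_space set \<Rightarrow> 'i set \<Rightarrow> ('i \<Rightarrow> 'h) \<Rightarrow> bool" where
  "parseval_frame V I v \<longleftrightarrow> v ` I \<subseteq> V \<and>
    (\<forall>x\<in>V. \<forall>y\<in>V. ((\<lambda>i. cinner x (v i) * cinner (v i) y) has_sum cinner x y) I)"

lemma parseval_frameD:
  assumes "parseval_frame V I v"
  shows "i \<in> I \<Longrightarrow> v i \<in> V"
    and "x \<in> V \<Longrightarrow> y \<in> V \<Longrightarrow> ((\<lambda>i. cinner x (v i) * cinner (v i) y) has_sum cinner x y) I"
  using assms by (auto simp: parseval_frame_def)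

lemma cinner_mult_commuted: "cinner x y * cinner y x = of_real ((cmod (cinner x y))\<^sup>2)"
  by (subst cinner_commute[of y x]) (simp only: complex_norm_square)

lemma cmod_cinner_commute: "cmod (cinner x y) = cmod (cinner y x)"
  by (metis cinner_commute complex_mod_cnj)

lemma parseval_frame_norm:
  assumes "parseval_frame V I v" "x \<in> V"
  shows "((\<lambda>i. (cmod (cinner x (v i)))\<^sup>2) has_sum (norm x)\<^sup>2) I"
  using has_sum_Re[OF parseval_frameD(2)[OF assms assms(2)]]
  unfolding cinner_mult_commuted cinner_self Re_complex_of_real .

lemma parseval_frame_partial:
  assumes "parseval_frame V I v" "x \<in> V" "finite F" "F \<subseteq> I"
  shows "(\<Sum>i\<in>F. (cmod (cinner x (v i)))\<^sup>2) \<le> (norm x)\<^sup>2"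
  by (rule has_sum_mono_neutral[OF has_sum_finite[OF assms(3)] parseval_frame_norm[OF assms(1,2)]])
    (use assms(4) in auto)

text \<open>Cauchy-Schwarz on finite subsets. The hypotheses bound finite partial sums only, which
  is exactly what Bessel's inequality delivers before any summability is known.\<close>

lemma abs_summable_on_mult_L2:
  fixes f g :: "'i \<Rightarrow> complex"
  assumes ab: "0 \<le> a" "0 \<le> b"
    and f: "\<And>F. finite F \<Longrightarrow> F \<subseteq> I \<Longrightarrow> (\<Sum>i\<in>F. (cmod (f i))\<^sup>2) \<le> a\<^sup>2"
    and g: "\<And>F. finite F \<Longrightarrow> F \<subseteq> I \<Longrightarrow> (\<Sum>i\<in>F. (cmod (g i))\<^sup>2) \<le> b\<^sup>2"
  shows "(\<lambda>i. cmod (f i * g i)) summable_on I"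
    and "(\<Sum>\<^sub>\<infinity>i\<in>I. cmod (f i * g i)) \<le> a * b"
proof -
  have fin: "(\<Sum>i\<in>F. cmod (f i * g i)) \<le> a * b" if "finite F" "F \<subseteq> I" for F
  proof -
    have "(\<Sum>i\<in>F. cmod (f i * g i)) = (\<Sum>i\<in>F. \<bar>cmod (f i)\<bar> * \<bar>cmod (g i)\<bar>)"
      by (simp add: norm_mult)
    also have "\<dots> \<le> L2_set (\<lambda>i. cmod (f i)) F * L2_set (\<lambda>i. cmod (g i)) F"
      by (rule L2_set_mult_ineq)
    also have "\<dots> \<le> a * b"
      using ab f[OF that] g[OF that] unfolding L2_set_def
      by (intro mult_mono real_le_lsqrt) (auto intro: sum_nonneg)
    finally show ?thesis .
  qed
  show s: "(\<lambda>i. cmod (f i * g i)) summable_on I"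
    by (rule nonneg_bdd_above_summable_on) (use fin in \<open>auto simp: bdd_above_def\<close>)
  show "(\<Sum>\<^sub>\<infinity>i\<in>I. cmod (f i * g i)) \<le> a * b"
    by (rule infsum_le_finite_sums[OF s fin])
qed

text \<open>By Zorn's lemma there is a maximal orthonormal set; it is total, since a nonzero vector
  orthogonal to it could be normalised and added.\<close>

lemma is_onb_onb_of:
  assumes V: "closed_csubspace V"
  shows "is_onb V (onb_of V)"
proof -
  let ?A = "{B. B \<subseteq> V \<and> (\<forall>x\<in>B. \<forall>y\<in>B. cinner x y = (if x = y then 1 else 0))}"
  have "\<exists>M\<in>?A. \<forall>X\<in>?A. M \<subseteq> X \<longrightarrow> X = M"
  proof (rule Zorn_Lemma, rule ballI)
    fix C assume "C \<in> chains ?A"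
    then have C: "C \<subseteq> ?A" "\<And>B B'. B \<in> C \<Longrightarrow> B' \<in> C \<Longrightarrow> B \<subseteq> B' \<or> B' \<subseteq> B"
      by (auto simp: chains_def chain_subset_def)
    have "cinner x y = (if x = y then 1 else 0)" if xy: "x \<in> \<Union>C" "y \<in> \<Union>C" for x y
    proof -
      obtain B B' where B: "B \<in> C" "x \<in> B" "B' \<in> C" "y \<in> B'" using xy by auto
      then obtain B'' where "B'' \<in> C" "x \<in> B''" "y \<in> B''" using C(2)[of B B'] by blast
      then show ?thesis using C(1) by auto
    qed
    then show "\<Union>C \<in> ?A" using C(1) by auto
  qed
  then obtain B where B: "B \<subseteq> V" "\<And>x y. x \<in> B \<Longrightarrow> y \<in> B \<Longrightarrow> cinner x y = (if x = y then 1 else 0)"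
    and max: "\<And>X. X \<in> ?A \<Longrightarrow> B \<subseteq> X \<Longrightarrow> X = B" by auto
  have "x = 0" if x: "x \<in> V" "\<forall>b\<in>B. cinner x b = 0" for x
  proof (rule ccontr)
    assume nz: "x \<noteq> 0"
    define u where "u = inverse (norm x) *\<^sub>R x"
    have u: "u \<in> V" using closed_csubspaceD(5)[OF V x(1)] by (simp add: u_def)
    have ub: "cinner u b = 0" "cinner b u = 0" if "b \<in> B" for b
      using x(2) that cinner_commute[of b x] by (auto simp: u_def cinner_scaleR_left cinner_scaleR_right)
    have uu: "cinner u u = 1"
      using nz by (simp add: cinner_self u_def)
    have "u \<notin> B" using ub(1)[of u] uu by auto
    then have "insert u B \<in> ?A" using B u ub uu by auto
    then have "insert u B = B" using max by blast
    then have "cinner u u = 0" using ub(1) by blast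
    then show False using uu by simp
  qed
  then have "is_onb V B" using B by (auto simp: is_onb_def)
  then show ?thesis unfolding onb_of_def by (rule someI)
qed

text \<open>For the projection \<open>p\<close> of x to the span of F, both
  \<open>cinner x p\<close> and the squared norm of \<open>p\<close> equal the sum, so
  Cauchy-Schwarz shows that \<open>p\<close> is no longer than x.\<close>

lemma onb_bessel:
  assumes B: "is_onb V B" and F: "finite F" "F \<subseteq> B"
  shows "(\<Sum>b\<in>F. (cmod (cinner x b))\<^sup>2) \<le> (norm x)\<^sup>2"
proof -
  let ?s = "\<Sum>b\<in>F. (cmod (cinner x b))\<^sup>2"
  define p where "p = (\<Sum>b\<in>F. cinner x b *\<^sub>C b)"
  have pb: "cinner p c = cinner x c" if "c \<in> F" for c
  proof -
    have "cinner p c = (\<Sum>b\<in>F. cinner x b * cinner b c)"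
      by (simp add: p_def cinner.sum_left cinner_scaleC_left)
    also have "\<dots> = (\<Sum>b\<in>F. if b = c then cinner x b else 0)"
    proof (rule sum.cong[OF refl])
      fix b assume "b \<in> F"
      then have "cinner b c = (if b = c then 1 else 0)"
        using B F(2) that by (simp add: is_onb_def subset_iff)
      then show "cinner x b * cinner b c = (if b = c then cinner x b else 0)" by simp
    qed
    also have "\<dots> = cinner x c" using F that by simp
    finally show ?thesis .
  qed
  have "cinner p p = (\<Sum>b\<in>F. cnj (cinner x b) * cinner p b)"
    by (subst (2) p_def) (simp add: cinner.sum_right cinner_scaleC_right)
  also have "\<dots> = (\<Sum>b\<in>F. of_real ((cmod (cinner x b))\<^sup>2))"
    by (intro sum.cong refl) (simp only: pb complex_norm_square mult.commute)
  finally have pp: "(norm p)\<^sup>2 = ?s"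
    unfolding cinner_self of_real_sum[symmetric] of_real_eq_iff .
  have "cinner x p = (\<Sum>b\<in>F. cnj (cinner x b) * cinner x b)"
    by (simp add: p_def cinner.sum_right cinner_scaleC_right)
  also have "\<dots> = (\<Sum>b\<in>F. of_real ((cmod (cinner x b))\<^sup>2))"
    by (intro sum.cong refl) (simp only: complex_norm_square mult.commute)
  finally have xp: "cinner x p = of_real ((norm p)\<^sup>2)" by (simp add: pp)
  have "(norm p)\<^sup>2 \<le> norm x * norm p"
    using cmod_cinner_le[of x p] unfolding xp by (simp add: power2_eq_square norm_mult)
  then have "norm p \<le> norm x"
    by (cases "norm p = 0") (auto simp: power2_eq_square mult_le_cancel_right)
  then show ?thesis unfolding pp[symmetric] by (intro power_mono) auto
qed

text \<open>By Bessel the candidate sum is a bounded functional \<phi> of z, represented by some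
  \<open>y\<close>. On B it takes the values of the functional of x, so \<open>x - y\<close> is
  orthogonal to B and vanishes by totality. No norm convergence of Fourier series is
  involved.\<close>

lemma onb_parseval_frame:
  assumes V: "closed_csubspace V" and B: "is_onb V B"
  shows "parseval_frame V B (\<lambda>b. b)"
proof -
  have BV: "B \<subseteq> V" using B by (simp add: is_onb_def)
  have abs: "(\<lambda>b. cmod (cinner z b * cinner b x)) summable_on B"
    and le: "(\<Sum>\<^sub>\<infinity>b\<in>B. cmod (cinner z b * cinner b x)) \<le> norm z * norm x" for x z
    by (rule abs_summable_on_mult_L2[where a = "norm z" and b = "norm x"];
        use onb_bessel[OF B] in \<open>simp add: cmod_cinner_commute[of _ x]\<close>)+
  have summ: "(\<lambda>b. cinner z b * cinner b x) summable_on B" for x z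
    using abs by (rule abs_summable_summable)
  have "((\<lambda>b. cinner z b * cinner b x) has_sum cinner z x) B" if z: "z \<in> V" and x: "x \<in> V" for z x
  proof -
    define \<phi> where "\<phi> z = (\<Sum>\<^sub>\<infinity>b\<in>B. cinner z b * cinner b x)" for z
    obtain y where y: "y \<in> V" "\<And>z. z \<in> V \<Longrightarrow> \<phi> z = cinner z y"
    proof (rule riesz[OF V, where \<phi> = \<phi> and K = "norm x"])
      show "\<phi> (z + w) = \<phi> z + \<phi> w" for z w
        unfolding \<phi>_def by (simp add: cinner_add_left distrib_right infsum_add[OF summ summ])
      show "\<phi> (a *\<^sub>C z) = a * \<phi> z" for a z
        unfolding \<phi>_def cinner_scaleC_left mult.assoc by (intro infsum_cmult_right summ)
      show "cmod (\<phi> z) \<le> norm x * norm z" for z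
        unfolding \<phi>_def using norm_infsum_bound[OF abs[of z x]] le[of z x] by (simp add: mult.commute)
    qed auto
    have "cinner (x - y) c = 0" if c: "c \<in> B" for c
    proof -
      have "\<phi> c = (\<Sum>\<^sub>\<infinity>b\<in>{c}. cinner c b * cinner b x)"
        unfolding \<phi>_def by (rule infsum_cong_neutral) (use B c in \<open>auto simp: is_onb_def\<close>)
      also have "\<dots> = cinner c x" using B c by (simp add: is_onb_def)
      finally have "cinner c y = cinner c x" using y(2) c BV by auto
      then have "cinner y c = cinner x c" by (metis cinner_commute)
      then show ?thesis by (simp add: cinner.diff_left)
    qed
    moreover have "x - y \<in> V" using closed_csubspaceD(6)[OF V x y(1)] .
    ultimately have "x - y = 0" using B unfolding is_onb_def by blast
    then show ?thesis using has_sum_infsum[OF summ[of z x]] y(2)[OF z] by (simp add: \<phi>_def)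
  qed
  then show ?thesis using BV by (auto simp: parseval_frame_def)
qed

section \<open>Square roots of positive operators\<close>

lemma positive_onD:
  assumes "positive_on V A"
  shows "bounded_operator_on V A" "x \<in> V \<Longrightarrow> A x \<in> V" "clinear_on V A"
    "x \<in> V \<Longrightarrow> Im (cinner (A x) x) = 0" "x \<in> V \<Longrightarrow> 0 \<le> Re (cinner (A x) x)"
  using assms by (auto simp: positive_on_def complex_nonneg_Reals_iff bounded_operator_on_def)

text \<open>Polarisation: the quadratic form is real at \<open>x + y\<close>, which compares
  imaginary parts, and at \<open>\<i> *\<^sub>C x + y\<close>, which compares real parts.\<close>

lemma positive_on_symmetric:
  assumes V: "closed_csubspace V" and A: "positive_on V A" and x: "x \<in> V" and y: "y \<in> V"
  shows "cinner (A x) y = cinner x (A y)"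
proof -
  note lin = positive_onD(3)[OF A]
  have im: "Im (cinner (A u) w + cinner (A w) u) = 0" if "u \<in> V" "w \<in> V" for u w
  proof -
    have "Im (cinner (A (u + w)) (u + w)) = 0"
      using positive_onD(4)[OF A closed_csubspaceD(3)[OF V that]] .
    then show ?thesis
      using positive_onD(4)[OF A that(1)] positive_onD(4)[OF A that(2)]
      by (simp add: clinear_onD(1)[OF lin that] cinner_add_left cinner_add_right)
  qed
  have 1: "Im (cinner (A x) y) + Im (cinner (A y) x) = 0" using im[OF x y] by simp
  have "Im (cinner (A (\<i> *\<^sub>C x)) y + cinner (A y) (\<i> *\<^sub>C x)) = 0"
    by (rule im[OF closed_csubspaceD(4)[OF V x] y])
  then have 2: "Re (cinner (A x) y) = Re (cinner (A y) x)"
    by (simp add: clinear_onD(2)[OF lin x] cinner_scaleC_left cinner_scaleC_right)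
  show ?thesis
    by (subst cinner_commute[of x]) (use 1 2 in \<open>simp add: complex_eq_iff\<close>)
qed

text \<open>The inequality \<open>A\<^sup>2 \<le> K A\<close>, proved before square roots exist by
  testing positivity on \<open>x - (1 / K) *\<^sub>R A x\<close>. It makes \<open>1 - A / K\<close>
  a contraction.\<close>

lemma positive_on_norm_le:
  assumes V: "closed_csubspace V" and A: "positive_on V A" and x: "x \<in> V"
    and K: "K > 0" "\<And>x. x \<in> V \<Longrightarrow> norm (A x) \<le> K * norm x"
  shows "(norm (A x))\<^sup>2 \<le> K * Re (cinner (A x) x)"
proof -
  note lin = positive_onD(3)[OF A]
  have Ax: "A x \<in> V" using positive_onD(2)[OF A x] .
  define w where "w = (1 / K) *\<^sub>R A x"
  have w: "w \<in> V" unfolding w_def using closed_csubspaceD(5)[OF V Ax] .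
  have xw: "x - w \<in> V" using closed_csubspaceD(6)[OF V x w] .
  have "Re (cinner (A (x - w)) (x - w)) =
      Re (cinner (A x) x) - 2 * Re (cinner (A x) w) + Re (cinner (A w) w)"
    using arg_cong[OF positive_on_symmetric[OF V A w x], of Re] cinner_commute[of w "A x"]
    by (simp add: clinear_on_diff[OF lin V x w] cinner.diff_left cinner.diff_right)
  moreover have "Re (cinner (A x) w) = (norm (A x))\<^sup>2 / K"
    by (simp add: w_def cinner_scaleR_right cinner_self)
  moreover have "Re (cinner (A w) w) \<le> (norm (A x))\<^sup>2 / K"
  proof -
    have "Re (cinner (A w) w) \<le> norm (A w) * norm w"
      using complex_Re_le_cmod[of "cinner (A w) w"] cmod_cinner_le[of "A w" w] by linarith
    also have "\<dots> \<le> (K * norm w) * norm w" using K(2)[OF w] by (intro mult_right_mono) auto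
    also have "\<dots> = (norm (A x))\<^sup>2 / K" using K(1) by (simp add: w_def power2_eq_square field_simps)
    finally show ?thesis .
  qed
  ultimately have "(norm (A x))\<^sup>2 / K \<le> Re (cinner (A x) x)"
    using positive_onD(5)[OF A xw] by linarith
  then show ?thesis using K(1) by (simp add: field_simps)
qed

text \<open>Polymorphic in the vector space: the same recursion runs for operators and, with the
  identity on the reals as C, for their scalar majorant.\<close>

fun sqrt_iter :: "('a::real_vector \<Rightarrow> 'a) \<Rightarrow> nat \<Rightarrow> 'a \<Rightarrow> 'a" where
  "sqrt_iter C 0 x = 0"
| "sqrt_iter C (Suc n) x = (1 / 2) *\<^sub>R (C x + sqrt_iter C n (sqrt_iter C n x))"

text \<open>The fixed point \<open>Y = (C + Y\<^sup>2) / 2\<close> satisfies \<open>(1 - Y)\<^sup>2 = 1 - C\<close>. The increments of the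
  iteration are dominated in norm by those of the scalar iteration for \<open>C = 1\<close>.\<close>

lemma sqrt_one_minus:
  fixes C :: "'h::complex_hilbert_space \<Rightarrow> 'h"
  assumes V: "closed_csubspace V" and CV: "\<And>x. x \<in> V \<Longrightarrow> C x \<in> V" and C: "clinear_on V C"
    and le: "\<And>x. x \<in> V \<Longrightarrow> norm (C x) \<le> norm x"
    and sym: "\<And>x y. x \<in> V \<Longrightarrow> y \<in> V \<Longrightarrow> cinner (C x) y = cinner x (C y)"
  obtains Y where "\<And>x. x \<in> V \<Longrightarrow> Y x \<in> V" "clinear_on V Y" "\<And>x. x \<in> V \<Longrightarrow> norm (Y x) \<le> norm x"
    "\<And>x y. x \<in> V \<Longrightarrow> y \<in> V \<Longrightarrow> cinner (Y x) y = cinner x (Y y)"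
    "\<And>x. x \<in> V \<Longrightarrow> 2 *\<^sub>R Y x = C x + Y (Y x)"
proof -
  define Y where "Y = sqrt_iter C"
  define y :: "nat \<Rightarrow> real" where "y n = sqrt_iter (\<lambda>x. x) n 1" for n
  \<comment> \<open>The scalar iterate is linear in its argument, with factor \<open>y n\<close>;
    hence \<open>y\<close> obeys \<open>y (Suc n) = (1 + (y n)\<^sup>2) / 2\<close> and increases
    inside the unit interval.\<close>
  have hom: "sqrt_iter (\<lambda>x. x) n r = r * sqrt_iter (\<lambda>x. x) n 1" for n and r :: real
  proof (induction n arbitrary: r)
    case (Suc n)
    have "sqrt_iter (\<lambda>x. x) n (sqrt_iter (\<lambda>x. x) n r) = (r * y n) * y n"
      unfolding y_def by (subst Suc, subst Suc) simp
    moreover have "sqrt_iter (\<lambda>x. x) n (sqrt_iter (\<lambda>x. x) n (1::real)) = y n * y n"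
      unfolding y_def by (subst Suc) simp
    ultimately show ?case by (simp add: algebra_simps)
  qed simp
  have ySuc: "y (Suc n) = (1 + (y n)\<^sup>2) / 2" for n
    using hom[of n "y n"] by (simp add: y_def power2_eq_square)
  have y0: "y 0 = 0" by (simp add: y_def)
  have Y0: "Y 0 x = 0" and YSuc: "Y (Suc n) x = (1 / 2) *\<^sub>R (C x + Y n (Y n x))" for n x
    by (simp_all add: Y_def)
  have y01: "0 \<le> y n \<and> y n \<le> 1" for n
  proof (induction n)
    case (Suc n)
    then have "(y n)\<^sup>2 \<le> 1" by (simp add: power_le_one)
    then show ?case by (simp add: ySuc)
  qed (simp add: y0)
  have ymono: "y n \<le> y (Suc n)" for n
    using zero_le_power2[of "y n - 1"] unfolding ySuc power2_diff by simp
  have YV: "Y n x \<in> V" if "x \<in> V" for n x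
    using that by (induction n arbitrary: x) (auto simp: Y0 YSuc intro: closed_csubspaceD[OF V] CV)
  have Yadd: "Y n (u + w) = Y n u + Y n w" if "u \<in> V" "w \<in> V" for n u w
    using that by (induction n arbitrary: u w)
      (auto simp: Y0 YSuc YV clinear_onD(1)[OF C] algebra_simps)
  have Yscale: "Y n (a *\<^sub>C u) = a *\<^sub>C Y n u" if "u \<in> V" for n a u
    using that
  proof (induction n arbitrary: u)
    case 0
    have "a *\<^sub>C (0 :: 'h) = 0" using norm_scaleC[of a "0 :: 'h"] by simp
    then show ?case by (simp add: Y0)
  next
    case (Suc n)
    then show ?case
      by (simp add: YSuc YV clinear_onD(2)[OF C] scaleC_of_real[symmetric] scaleC_scaleC
        scaleC_add_right mult.commute del: of_real_divide of_real_1 of_real_numeral)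
  qed
  have Ylin: "clinear_on V (Y n)" for n by (simp add: clinear_on_def Yadd Yscale)
  have Ysym: "cinner (Y n u) w = cinner u (Y n w)" if "u \<in> V" "w \<in> V" for n u w
    using that
    by (induction n arbitrary: u w)
      (auto simp: Y0 YSuc YV cinner_scaleR_left cinner_scaleR_right cinner_add_left cinner_add_right sym
        cinner.zero_left cinner.zero_right)
  have Ynorm: "norm (Y n x) \<le> y n * norm x" if "x \<in> V" for n x
    using that
  proof (induction n arbitrary: x)
    case (Suc n)
    have "norm (Y n (Y n x)) \<le> y n * norm (Y n x)" using Suc YV by blast
    also have "\<dots> \<le> y n * (y n * norm x)" using Suc y01 by (intro mult_left_mono) auto
    finally have "norm (C x + Y n (Y n x)) \<le> norm x + y n * (y n * norm x)"
      using norm_triangle_ineq[of "C x" "Y n (Y n x)"] le[OF Suc.prems] by linarith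
    then have "norm (Y (Suc n) x) \<le> (norm x + y n * (y n * norm x)) / 2"
      unfolding YSuc norm_scaleR by simp
    then show ?case by (simp add: ySuc power2_eq_square algebra_simps)
  qed (simp add: Y0 y0)
  have step: "norm (Y (Suc n) x - Y n x) \<le> (y (Suc n) - y n) * norm x" if "x \<in> V" for n x
    using that
  proof (induction n arbitrary: x)
    case 0
    then show ?case using Ynorm[of x "Suc 0"] by (simp add: Y0 y0)
  next
    case (Suc n)
    let ?d = "y (Suc n) - y n"
    have d: "0 \<le> ?d" using ymono[of n] by simp
    have e: "y (Suc (Suc n)) - y (Suc n) = ((y (Suc n))\<^sup>2 - (y n)\<^sup>2) / 2"
    proof -
      have "a - c = (b - d) / 2" if "a = (1 + b) / 2" "c = (1 + d) / 2" for a b c d :: real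
        using that by (simp add: field_simps)
      then show ?thesis using ySuc by blast
    qed
    \<comment> \<open>The difference of the squares is split as \<open>Y (Suc n)\<close> times the
      increment plus the increment times \<open>Y n\<close>, with no commutation. The second term
      uses the induction hypothesis at \<open>Y n x\<close>, so x is kept arbitrary.\<close>
    have "Y (Suc n) (Y (Suc n) x - Y n x) = Y (Suc n) (Y (Suc n) x) - Y (Suc n) (Y n x)"
      by (rule clinear_on_diff[OF Ylin V YV YV]) (use Suc.prems in auto)
    then have "Y (Suc (Suc n)) x - Y (Suc n) x = (1 / 2) *\<^sub>R (Y (Suc n) (Y (Suc n) x - Y n x)
        + (Y (Suc n) (Y n x) - Y n (Y n x)))"
      unfolding YSuc[of "Suc n"] by (subst YSuc[of n]) (simp add: algebra_simps)
    then have "norm (Y (Suc (Suc n)) x - Y (Suc n) x) \<le>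
        (norm (Y (Suc n) (Y (Suc n) x - Y n x)) + norm (Y (Suc n) (Y n x) - Y n (Y n x))) / 2"
      using norm_triangle_ineq by simp
    also have "norm (Y (Suc n) (Y (Suc n) x - Y n x)) \<le> y (Suc n) * norm (Y (Suc n) x - Y n x)"
      by (rule Ynorm) (use Suc.prems YV closed_csubspaceD(6)[OF V] in auto)
    also have "\<dots> \<le> y (Suc n) * (?d * norm x)"
      using Suc y01 by (intro mult_left_mono) auto
    also have "norm (Y (Suc n) (Y n x) - Y n (Y n x)) \<le> ?d * norm (Y n x)"
      using Suc YV by auto
    also have "\<dots> \<le> ?d * (y n * norm x)"
      using Ynorm[OF Suc.prems] d by (intro mult_left_mono) auto
    also have "(y (Suc n) * (?d * norm x) + ?d * (y n * norm x)) / 2 = (y (Suc (Suc n)) - y (Suc n)) * norm x"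
      unfolding e by (simp add: algebra_simps power2_eq_square diff_divide_distrib)
    finally show ?case by simp
  qed
  have diff: "norm (Y m x - Y n x) \<le> (y m - y n) * norm x" if "x \<in> V" "n \<le> m" for x m n
    using that(2)
  proof (induction m rule: dec_induct)
    case (step m)
    have "norm (Y (Suc m) x - Y n x) \<le> norm (Y (Suc m) x - Y m x) + norm (Y m x - Y n x)"
      using norm_triangle_ineq[of "Y (Suc m) x - Y m x" "Y m x - Y n x"] by simp
    also have "\<dots> \<le> (y (Suc m) - y m) * norm x + (y m - y n) * norm x"
      using \<open>\<And>n x. x \<in> V \<Longrightarrow> norm (Y (Suc n) x - Y n x) \<le> (y (Suc n) - y n) * norm x\<close> that(1) step
      by (intro add_mono) auto
    finally show ?case by (simp add: algebra_simps)
  qed simp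
  have "convergent y"
    using Bseq_mono_convergent[of y] incseq_SucI[of y] ymono y01
    by (meson Bseq_eq_bounded incseq_convergent convergent_def incseqD)
  then have yC: "Cauchy y" by (rule convergent_Cauchy)
  have "Cauchy (\<lambda>n. Y n x)" if x: "x \<in> V" for x
  proof (rule metric_CauchyI)
    fix e :: real assume e: "e > 0"
    have p: "e / (norm x + 1) > 0" using e by (simp add: add_nonneg_pos)
    obtain N where N: "\<And>m n. m \<ge> N \<Longrightarrow> n \<ge> N \<Longrightarrow> dist (y m) (y n) < e / (norm x + 1)"
      using metric_CauchyD[OF yC p] by blast
    have le: "norm (Y m x - Y n x) < e" if "m \<ge> N" "n \<ge> N" "n \<le> m" for m n
    proof -
      have "norm (Y m x - Y n x) \<le> (y m - y n) * norm x" by (rule diff[OF x that(3)])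
      also have "\<dots> \<le> (e / (norm x + 1)) * norm x"
        using N[OF that(1,2)] by (intro mult_right_mono) (auto simp: dist_real_def)
      also have "\<dots> < (e / (norm x + 1)) * (norm x + 1)" using p by (intro mult_strict_left_mono) auto
      also have "\<dots> = e" by (simp add: add_nonneg_eq_0_iff)
      finally show ?thesis .
    qed
    have "dist (Y m x) (Y n x) < e" if "m \<ge> N" "n \<ge> N" for m n
      using le[OF that] le[OF that(2,1)] by (cases "n \<le> m") (auto simp: dist_norm norm_minus_commute)
    then show "\<exists>M. \<forall>m\<ge>M. \<forall>n\<ge>M. dist (Y m x) (Y n x) < e" by blast
  qed
  then have "\<exists>l. (\<lambda>n. Y n x) \<longlonglongrightarrow> l" if "x \<in> V" for x
    using that by (simp add: Cauchy_convergent_iff convergent_def)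
  then obtain L where L: "\<And>x. x \<in> V \<Longrightarrow> (\<lambda>n. Y n x) \<longlonglongrightarrow> L x" by metis
  have LV: "L x \<in> V" if "x \<in> V" for x
    using closed_sequentially[OF closed_csubspaceD(1)[OF V] _ L[OF that]] YV[OF that] by blast
  have Llin: "clinear_on V L"
    unfolding clinear_on_def
  proof (intro conjI ballI allI)
    fix u w assume uw: "u \<in> V" "w \<in> V"
    show "L (u + w) = L u + L w"
      by (rule LIMSEQ_unique[OF L[OF closed_csubspaceD(3)[OF V uw]]])
        (simp add: Yadd[OF uw], intro tendsto_add L uw)
  next
    fix a u assume u: "u \<in> V"
    show "L (a *\<^sub>C u) = a *\<^sub>C L u"
      by (rule LIMSEQ_unique[OF L[OF closed_csubspaceD(4)[OF V u]]])
        (simp add: Yscale[OF u], intro bounded_linear.tendsto[OF bounded_linear_scaleC] L u)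
  qed
  have Lnorm: "norm (L x) \<le> norm x" if "x \<in> V" for x
  proof (rule LIMSEQ_le_const2[OF tendsto_norm[OF L[OF that]]])
    have "norm (Y n x) \<le> norm x" for n
      using Ynorm[OF that, of n] y01[of n] mult_right_mono[of "y n" 1 "norm x"] by simp
    then show "\<exists>N. \<forall>n\<ge>N. norm (Y n x) \<le> norm x" by blast
  qed
  have Lsym: "cinner (L u) w = cinner u (L w)" if "u \<in> V" "w \<in> V" for u w
  proof (rule LIMSEQ_unique)
    show "(\<lambda>n. cinner (Y n u) w) \<longlonglongrightarrow> cinner (L u) w"
      by (intro cinner.tendsto tendsto_const L that)
    show "(\<lambda>n. cinner (Y n u) w) \<longlonglongrightarrow> cinner u (L w)"
      unfolding Ysym[OF that] by (intro cinner.tendsto tendsto_const L that)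
  qed
  have Lfix: "2 *\<^sub>R L x = C x + L (L x)" if x: "x \<in> V" for x
  proof (rule LIMSEQ_unique)
    show "(\<lambda>n. 2 *\<^sub>R Y (Suc n) x) \<longlonglongrightarrow> 2 *\<^sub>R L x"
      by (intro tendsto_intros LIMSEQ_Suc L x)
    \<comment> \<open>Operator and argument move together; since every \<open>Y n\<close> is a
      contraction, replacing \<open>Y n x\<close> by its limit costs no more than their
      distance.\<close>
    have "(\<lambda>n. Y n (Y n x) - Y n (L x)) \<longlonglongrightarrow> 0"
    proof (rule Lim_null_comparison)
      show "\<forall>\<^sub>F n in sequentially. norm (Y n (Y n x) - Y n (L x)) \<le> norm (Y n x - L x)"
      proof (rule always_eventually, rule allI)
        fix n
        have "norm (Y n (Y n x - L x)) \<le> y n * norm (Y n x - L x)"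
          by (rule Ynorm) (use YV LV x closed_csubspaceD(6)[OF V] in auto)
        also have "\<dots> \<le> norm (Y n x - L x)"
          using y01[of n] mult_right_mono[of "y n" 1 "norm (Y n x - L x)"] by simp
        finally show "norm (Y n (Y n x) - Y n (L x)) \<le> norm (Y n x - L x)"
          using clinear_on_diff[OF Ylin V YV[OF x] LV[OF x]] by simp
      qed
      show "(\<lambda>n. norm (Y n x - L x)) \<longlonglongrightarrow> 0"
        using L[OF x] by (simp add: LIM_zero tendsto_norm_zero)
    qed
    from tendsto_add[OF this L[OF LV[OF x]]] have "(\<lambda>n. Y n (Y n x)) \<longlonglongrightarrow> L (L x)" by simp
    then show "(\<lambda>n. 2 *\<^sub>R Y (Suc n) x) \<longlonglongrightarrow> C x + L (L x)"
      unfolding YSuc by (auto intro: tendsto_intros)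
  qed
  show ?thesis by (rule that[of L]) (use LV Llin Lnorm Lsym Lfix in auto)
qed

text \<open>After scaling, \<open>C = 1 - B / K\<close> is a symmetric contraction, and the fixed
  point \<open>Y\<close> of the iteration for \<open>C\<close> gives the root
  \<open>sqrt K *\<^sub>R (1 - Y)\<close>. It is positive because \<open>Y\<close> is symmetric with
  norm at most 1.\<close>

lemma positive_sqrt_exists:
  assumes V: "closed_csubspace V" and B: "positive_on V B"
  obtains A where "positive_on V A" "\<And>x. x \<in> V \<Longrightarrow> A (A x) = B x"
proof -
  note BV = positive_onD(2)[OF B] and lin = positive_onD(3)[OF B]
  obtain K where K: "K > 0" "\<And>x. x \<in> V \<Longrightarrow> norm (B x) \<le> K * norm x"
    using bounded_operator_on_bound[OF positive_onD(1)[OF B]] by blast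
  define C where "C x = x - (1 / K) *\<^sub>R B x" for x
  have CV: "C x \<in> V" if "x \<in> V" for x
    unfolding C_def using that BV closed_csubspaceD(5,6)[OF V] by auto
  have Clin: "clinear_on V C"
    unfolding clinear_on_def
  proof (intro conjI ballI allI)
    show "C (x + y) = C x + C y" if "x \<in> V" "y \<in> V" for x y
      unfolding C_def clinear_onD(1)[OF lin that] by (simp add: algebra_simps)
    show "C (a *\<^sub>C x) = a *\<^sub>C C x" if "x \<in> V" for a x
      unfolding C_def clinear_onD(2)[OF lin that] scaleC_diff_right
      by (simp only: scaleC_of_real[symmetric] scaleC_scaleC mult.commute)
  qed
  have Cnorm: "norm (C x) \<le> norm x" if x: "x \<in> V" for x
  proof -
    let ?q = "Re (cinner (B x) x) / K"
    have "(norm (C x))\<^sup>2 = (norm x)\<^sup>2 - 2 * ?q + (norm (B x))\<^sup>2 / K\<^sup>2"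
      unfolding C_def power2_norm_eq_inner Re_cinner
      by (simp add: inner_diff_left inner_diff_right inner_commute field_simps power2_eq_square)
    moreover have "(norm (B x))\<^sup>2 / K\<^sup>2 \<le> K * Re (cinner (B x) x) / K\<^sup>2"
      using positive_on_norm_le[OF V B x K] by (intro divide_right_mono) auto
    moreover have "K * Re (cinner (B x) x) / K\<^sup>2 = ?q" using K(1) by (simp add: power2_eq_square)
    moreover have "0 \<le> ?q" using positive_onD(5)[OF B x] K(1) by simp
    ultimately have "(norm (C x))\<^sup>2 \<le> (norm x)\<^sup>2" by linarith
    then show ?thesis by (rule power2_le_imp_le) (rule norm_ge_zero)
  qed
  have Csym: "cinner (C x) y = cinner x (C y)" if "x \<in> V" "y \<in> V" for x y
    unfolding C_def using positive_on_symmetric[OF V B that]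
    by (simp add: cinner.diff_left cinner.diff_right cinner_scaleR_left cinner_scaleR_right)
  obtain Y where YV: "\<And>x. x \<in> V \<Longrightarrow> Y x \<in> V" and Ylin: "clinear_on V Y"
    and Ynorm: "\<And>x. x \<in> V \<Longrightarrow> norm (Y x) \<le> norm x"
    and Ysym: "\<And>x y. x \<in> V \<Longrightarrow> y \<in> V \<Longrightarrow> cinner (Y x) y = cinner x (Y y)"
    and Yfix: "\<And>x. x \<in> V \<Longrightarrow> 2 *\<^sub>R Y x = C x + Y (Y x)"
    by (rule sqrt_one_minus[OF V CV Clin Cnorm Csym]) blast+
  define S where "S x = sqrt K *\<^sub>R (x - Y x)" for x
  have SV: "S x \<in> V" if "x \<in> V" for x
    unfolding S_def using that YV closed_csubspaceD(5,6)[OF V] by auto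
  have Slin: "clinear_on V S"
    unfolding clinear_on_def
  proof (intro conjI ballI allI)
    show "S (x + y) = S x + S y" if "x \<in> V" "y \<in> V" for x y
      unfolding S_def clinear_onD(1)[OF Ylin that] by (simp add: algebra_simps)
    show "S (a *\<^sub>C x) = a *\<^sub>C S x" if "x \<in> V" for a x
      unfolding S_def clinear_onD(2)[OF Ylin that] scaleC_diff_right[symmetric]
      by (simp only: scaleC_of_real[symmetric] scaleC_scaleC mult.commute)
  qed
  have "positive_on V S"
    unfolding positive_on_def bounded_operator_on_def
  proof (intro conjI ballI)
    show "\<exists>L. \<forall>x\<in>V. norm (S x) \<le> L * norm x"
    proof (rule exI[of _ "sqrt K * 2"], rule ballI)
      fix x assume x: "x \<in> V"
      have "norm (x - Y x) \<le> 2 * norm x"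
        using norm_triangle_ineq4[of x "Y x"] Ynorm[OF x] by linarith
      then show "norm (S x) \<le> sqrt K * 2 * norm x"
        unfolding S_def using K(1) by (simp add: mult.assoc)
    qed
    fix x assume x: "x \<in> V"
    have "cinner (Y x) x = cnj (cinner (Y x) x)" using Ysym[OF x x] cinner_commute by metis
    then have im: "Im (cinner (Y x) x) = 0" by (metis Reals_cnj_iff complex_is_Real_iff)
    have "Re (cinner (Y x) x) \<le> norm (Y x) * norm x"
      using complex_Re_le_cmod[of "cinner (Y x) x"] cmod_cinner_le[of "Y x" x] by linarith
    also have "\<dots> \<le> (norm x)\<^sup>2" unfolding power2_eq_square using Ynorm[OF x] by (intro mult_right_mono) auto
    finally show "cinner (S x) x \<in> \<real>\<^sub>\<ge>\<^sub>0"
      using im K(1)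
      by (simp add: S_def complex_nonneg_Reals_iff cinner_scaleR_left cinner.diff_left cinner_self del: of_real_power)
  qed (use SV Slin in auto)
  moreover have "S (S x) = B x" if x: "x \<in> V" for x
  proof -
    have "Y (x - Y x) = Y x - Y (Y x)" by (rule clinear_on_diff[OF Ylin V x YV[OF x]])
    then have "S (x - Y x) = sqrt K *\<^sub>R (x - 2 *\<^sub>R Y x + Y (Y x))"
      by (simp add: S_def scaleR_2)
    moreover have "S (S x) = sqrt K *\<^sub>R S (x - Y x)"
      by (subst (2) S_def) (intro clinear_onD(3)[OF Slin] closed_csubspaceD(6)[OF V] x YV)
    ultimately have "S (S x) = K *\<^sub>R (x - 2 *\<^sub>R Y x + Y (Y x))"
      using K(1) by simp
    also have "\<dots> = K *\<^sub>R (x - C x)" unfolding Yfix[OF x] by simp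
    finally show ?thesis using K(1) by (simp add: C_def)
  qed
  ultimately show ?thesis using that by blast
qed

section \<open>Trace class operators\<close>

lemma positive_on_adjoint_self:
  assumes V: "closed_csubspace V" and T: "bounded_operator_on V T"
  shows "positive_on V (\<lambda>x. cadjoint_on V T (T x))"
proof -
  note TV = bounded_operator_onD(1)[OF T] and lin = bounded_operator_onD(2)[OF T]
  note adV = cadjoint_on_in[OF V T] and ad = cinner_cadjoint_on[OF V T]
  obtain K where K: "K > 0" "\<And>x. x \<in> V \<Longrightarrow> norm (T x) \<le> K * norm x"
    using bounded_operator_on_bound[OF T] by blast
  have ad_norm: "norm (cadjoint_on V T y) \<le> K * norm y" for y
  proof -
    let ?z = "cadjoint_on V T y"
    have "(norm ?z)\<^sup>2 = cmod (cinner (T ?z) y)"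
      unfolding ad[OF adV] cinner_self by (simp add: norm_power)
    also have "\<dots> \<le> norm (T ?z) * norm y" by (rule cmod_cinner_le)
    also have "\<dots> \<le> K * norm ?z * norm y" using K(2)[OF adV] by (intro mult_right_mono) auto
    finally have "norm ?z * norm ?z \<le> (K * norm y) * norm ?z" by (simp add: power2_eq_square mult_ac)
    then show ?thesis using K(1) by (cases "norm ?z = 0") (auto simp: mult_le_cancel_right)
  qed
  show ?thesis
    unfolding positive_on_def bounded_operator_on_def clinear_on_def
  proof (intro conjI ballI allI)
    show "cadjoint_on V T (T (x + y)) = cadjoint_on V T (T x) + cadjoint_on V T (T y)"
      if "x \<in> V" "y \<in> V" for x y
      by (rule cinner_eqI[OF V adV closed_csubspaceD(3)[OF V adV adV]])
        (simp add: cinner_add_right ad[symmetric] clinear_onD(1)[OF lin that])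
    show "cadjoint_on V T (T (a *\<^sub>C x)) = a *\<^sub>C cadjoint_on V T (T x)" if "x \<in> V" for a x
      by (rule cinner_eqI[OF V adV closed_csubspaceD(4)[OF V adV]])
        (simp add: cinner_scaleC_right ad[symmetric] clinear_onD(2)[OF lin that])
    show "\<exists>L. \<forall>x\<in>V. norm (cadjoint_on V T (T x)) \<le> L * norm x"
    proof (rule exI[of _ "K * K"], rule ballI)
      fix x assume "x \<in> V"
      have "norm (cadjoint_on V T (T x)) \<le> K * norm (T x)" by (rule ad_norm)
      also have "\<dots> \<le> K * (K * norm x)" using K \<open>x \<in> V\<close> by (intro mult_left_mono) auto
      finally show "norm (cadjoint_on V T (T x)) \<le> K * K * norm x" by simp
    qed
    fix x assume x: "x \<in> V"
    have "cinner (cadjoint_on V T (T x)) x = cnj (cinner (T x) (T x))"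
      unfolding ad[OF x] by (rule cinner_commute)
    then show "cinner (cadjoint_on V T (T x)) x \<in> \<real>\<^sub>\<ge>\<^sub>0"
      by (simp add: cinner_self complex_nonneg_Reals_iff del: of_real_power)
  qed (use adV in auto)
qed

text \<open>The square root of \<open>T\<^sup>* T\<close> is the witness for the choice in
  \<open>op_abs\<close>. Equality of norms is what makes |T| x -> T x a well defined isometry, that
  is, the polar part.\<close>

lemma op_abs:
  assumes V: "closed_csubspace V" and T: "bounded_operator_on V T"
  shows positive_on_op_abs: "positive_on V (op_abs V T)"
    and norm_op_abs: "x \<in> V \<Longrightarrow> norm (op_abs V T x) = norm (T x)"
proof -
  let ?A = "op_abs V T"
  have "\<exists>A. positive_on V A \<and> (\<forall>x\<in>V. A (A x) = cadjoint_on V T (T x))"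
    using positive_sqrt_exists[OF V positive_on_adjoint_self[OF V T]] by metis
  from someI_ex[OF this, folded op_abs_def]
  have A: "positive_on V ?A" and AA: "\<And>x. x \<in> V \<Longrightarrow> ?A (?A x) = cadjoint_on V T (T x)"
    by auto
  show "positive_on V ?A" by (rule A)
  show "norm (?A x) = norm (T x)" if x: "x \<in> V"
  proof -
    have "cinner (?A x) (?A x) = cinner (T x) (T x)"
      using positive_on_symmetric[OF V A x positive_onD(2)[OF A x]] AA[OF x] cinner_cadjoint_on[OF V T x]
      by simp
    then have "(norm (?A x))\<^sup>2 = (norm (T x))\<^sup>2" unfolding cinner_self of_real_eq_iff .
    then show ?thesis by (rule power2_eq_imp_eq) auto
  qed
qed

text \<open>Applied to the range of |T|: in its closure the vectors supplied by the factorisation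
  lemma are unique, so choosing them is linear.\<close>

lemma closed_csubspace_closure_image:
  assumes V: "closed_csubspace V" and A: "clinear_on V A"
  shows "closed_csubspace (closure (A ` V))"
  unfolding closed_csubspace_def
proof (intro conjI ballI allI)
  have "A 0 = 0" using clinear_onD(3)[OF A closed_csubspaceD(2)[OF V], of 0] by simp
  then show "0 \<in> closure (A ` V)" using closed_csubspaceD(2)[OF V] closure_subset by force
  show "x + y \<in> closure (A ` V)" if xy: "x \<in> closure (A ` V)" "y \<in> closure (A ` V)" for x y
  proof -
    obtain u where u: "\<And>n. u n \<in> A ` V" "u \<longlonglongrightarrow> x" using xy(1) unfolding closure_sequential by blast
    obtain w where w: "\<And>n. w n \<in> A ` V" "w \<longlonglongrightarrow> y" using xy(2) unfolding closure_sequential by blast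
    have "u n + w n \<in> A ` V" for n
    proof -
      obtain p q where pq: "p \<in> V" "q \<in> V" "u n = A p" "w n = A q" using u(1)[of n] w(1)[of n] by auto
      then have "u n + w n = A (p + q)" using clinear_onD(1)[OF A] by simp
      then show ?thesis using closed_csubspaceD(3)[OF V pq(1,2)] by blast
    qed
    then show ?thesis unfolding closure_sequential
      by (intro exI[of _ "\<lambda>n. u n + w n"]) (auto intro: tendsto_add u(2) w(2))
  qed
  show "a *\<^sub>C x \<in> closure (A ` V)" if x: "x \<in> closure (A ` V)" for a x
  proof -
    obtain u where u: "\<And>n. u n \<in> A ` V" "u \<longlonglongrightarrow> x" using x unfolding closure_sequential by blast
    have "a *\<^sub>C u n \<in> A ` V" for n
    proof -
      obtain p where p: "p \<in> V" "u n = A p" using u(1)[of n] by auto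
      then have "a *\<^sub>C u n = A (a *\<^sub>C p)" using clinear_onD(2)[OF A] by simp
      then show ?thesis using closed_csubspaceD(4)[OF V p(1)] by blast
    qed
    then show ?thesis unfolding closure_sequential
      by (intro exI[of _ "\<lambda>n. a *\<^sub>C u n"]) (auto intro: bounded_linear.tendsto[OF bounded_linear_scaleC] u(2))
  qed
qed simp

text \<open>The squared moduli of \<open>cinner (S (w j)) (v i)\<close> are summed in both orders,
  with Parseval on either side and symmetry of S in between. This moves the trace norm from the
  chosen basis to an arbitrary frame.\<close>

lemma hilbert_schmidt_frame:
  assumes v: "parseval_frame V I v" and w: "parseval_frame V J w"
    and SV: "\<And>x. x \<in> V \<Longrightarrow> S x \<in> V"
    and sym: "\<And>x y. x \<in> V \<Longrightarrow> y \<in> V \<Longrightarrow> cinner (S x) y = cinner x (S y)"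
    and summ: "(\<lambda>j. (norm (S (w j)))\<^sup>2) summable_on J"
  shows "((\<lambda>i. (norm (S (v i)))\<^sup>2) has_sum (\<Sum>\<^sub>\<infinity>j\<in>J. (norm (S (w j)))\<^sup>2)) I"
proof -
  define k where "k = (\<lambda>(j, i). (cmod (cinner (S (w j)) (v i)))\<^sup>2)"
  have rows: "((\<lambda>i. k (j, i)) has_sum (norm (S (w j)))\<^sup>2) I" if "j \<in> J" for j
    unfolding k_def using parseval_frame_norm[OF v SV[OF parseval_frameD(1)[OF w that]]] by simp
  have "k summable_on (J \<times> I)"
    by (rule summable_on_SigmaI[OF rows summ]) (auto simp: k_def)
  then have "(k has_sum (\<Sum>\<^sub>\<infinity>j\<in>J. (norm (S (w j)))\<^sup>2)) (J \<times> I)"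
    by (intro has_sum_SigmaI[OF rows has_sum_infsum[OF summ]])
  then have "((\<lambda>(i, j). k (j, i)) has_sum (\<Sum>\<^sub>\<infinity>j\<in>J. (norm (S (w j)))\<^sup>2)) (I \<times> J)"
    by (subst (asm) has_sum_swap)
  then show ?thesis
  proof (rule has_sum_SigmaD)
    fix i assume i: "i \<in> I"
    have "k (j, i) = (cmod (cinner (S (v i)) (w j)))\<^sup>2" if "j \<in> J" for j
      using sym[OF parseval_frameD(1)[OF w that] parseval_frameD(1)[OF v i]]
      by (simp add: k_def cmod_cinner_commute[of "w j"])
    then show "((\<lambda>j. (\<lambda>(i, j). k (j, i)) (i, j)) has_sum (norm (S (v i)))\<^sup>2) J"
      using parseval_frame_norm[OF w SV[OF parseval_frameD(1)[OF v i]]]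
      by (simp cong: has_sum_cong)
  qed
qed

text \<open>With \<open>|T| = S\<^sup>2\<close> and the polar decomposition \<open>T = W |T|\<close>, take \<open>b\<^sub>i = S v\<^sub>i\<close> and
  \<open>a\<^sub>i = W S v\<^sub>i\<close>; below \<open>z\<close> is \<open>W\<^sup>*\<close>.\<close>

lemma trace_class_nuclear:
  fixes v :: "'i \<Rightarrow> 'h::complex_hilbert_space"
  assumes V: "closed_csubspace V" and tc: "trace_class_on V T" and v: "parseval_frame V I v"
  obtains a b where "\<And>i. i \<in> I \<Longrightarrow> a i \<in> V" "\<And>i. i \<in> I \<Longrightarrow> b i \<in> V"
    "(\<lambda>i. norm (a i) * norm (b i)) summable_on I"
    "(\<Sum>\<^sub>\<infinity>i\<in>I. norm (a i) * norm (b i)) \<le> trace_norm V T"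
    "\<And>x y. x \<in> V \<Longrightarrow> y \<in> V \<Longrightarrow> ((\<lambda>i. cinner x (b i) * cinner (a i) y) has_sum cinner (T x) y) I"
proof -
  have T: "bounded_operator_on V T" using tc by (simp add: trace_class_on_def)
  note TV = bounded_operator_onD(1)[OF T] and Tlin = bounded_operator_onD(2)[OF T]
  define A where "A = op_abs V T"
  have A: "positive_on V A" unfolding A_def by (rule positive_on_op_abs[OF V T])
  note AV = positive_onD(2)[OF A] and Alin = positive_onD(3)[OF A]
  have normA: "norm (A x) = norm (T x)" if "x \<in> V" for x
    unfolding A_def by (rule norm_op_abs[OF V T that])
  obtain S where S: "positive_on V S" and SS: "\<And>x. x \<in> V \<Longrightarrow> S (S x) = A x"
    using positive_sqrt_exists[OF V A] by blast
  note SV = positive_onD(2)[OF S] and sym = positive_on_symmetric[OF V S]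
  let ?B = "onb_of V"
  have B: "parseval_frame V ?B (\<lambda>b. b)" by (rule onb_parseval_frame[OF V is_onb_onb_of[OF V]])
  \<comment> \<open>The trace norm of T becomes the squared Hilbert-Schmidt norm of
    \<open>S\<close>.\<close>
  have Ae: "cinner (A e) e = of_real ((norm (S e))\<^sup>2)" if "e \<in> ?B" for e
    using sym[OF SV, of e e] SS[of e] parseval_frameD(1)[OF B that] by (simp add: cinner_self)
  have "(\<lambda>e. cinner (A e) e) summable_on ?B" using tc by (simp add: trace_class_on_def A_def)
  then have s: "(\<lambda>e. of_real ((norm (S e))\<^sup>2) :: complex) summable_on ?B"
    by (rule summable_on_cong[THEN iffD1, rotated]) (use Ae in auto)
  have sR: "(\<lambda>e. (norm (S e))\<^sup>2) summable_on ?B"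
    using has_sum_Re[OF has_sum_infsum[OF s]] by (auto simp: summable_on_def simp del: of_real_power)
  have "trace_norm V T = Re (\<Sum>\<^sub>\<infinity>e\<in>?B. of_real ((norm (S e))\<^sup>2))"
    unfolding trace_norm_def op_trace_def A_def[symmetric] using Ae by (simp cong: infsum_cong)
  also have "\<dots> = (\<Sum>\<^sub>\<infinity>e\<in>?B. (norm (S e))\<^sup>2)"
    using infsumI[OF has_sum_of_real[OF has_sum_infsum[OF sR], where 'a = complex]] by simp
  finally have tn: "((\<lambda>i. (norm (S (v i)))\<^sup>2) has_sum trace_norm V T) I"
    using hilbert_schmidt_frame[OF v B SV sym sR] by simp
  let ?R = "closure (A ` V)"
  have R: "closed_csubspace ?R" by (rule closed_csubspace_closure_image[OF V Alin])
  have RV: "?R \<subseteq> V" using AV closed_csubspaceD(1)[OF V] by (intro closure_minimal) auto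
  \<comment> \<open>By Cauchy-Schwarz the functional \<open>cinner (T x) y\<close> is bounded by the
    norm of y times that of \<open>A x\<close>, which is the hypothesis of the factorisation
    lemma.\<close>
  have "\<exists>z. z \<in> ?R \<and> norm z \<le> norm y \<and> (\<forall>x\<in>V. cinner (T x) y = cinner (A x) z)" for y
  proof -
    obtain z where "z \<in> ?R" "norm z \<le> norm y" "\<And>x. x \<in> V \<Longrightarrow> cinner (T x) y = cinner (A x) z"
    proof (rule douglas_riesz[OF V Alin, where \<phi> = "\<lambda>x. cinner (T x) y" and K = "norm y"])
      show "cmod (cinner (T x) y) \<le> norm y * norm (A x)" if "x \<in> V" for x
        using cmod_cinner_le[of "T x" y] by (simp add: normA[OF that] mult.commute)
    qed (auto simp: clinear_onD[OF Tlin] cinner_add_left cinner_scaleC_left)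
    then show ?thesis by blast
  qed
  then obtain z where zR: "\<And>y. z y \<in> ?R" and znorm: "\<And>y. norm (z y) \<le> norm y"
    and z: "\<And>x y. x \<in> V \<Longrightarrow> cinner (T x) y = cinner (A x) (z y)" by metis
  have zeq: "z y = u" if u: "u \<in> ?R" and eq: "\<And>x. x \<in> V \<Longrightarrow> cinner (T x) y = cinner (A x) u" for y u
  proof (rule cinner_eqI[OF R zR u])
    fix w assume "w \<in> ?R"
    then obtain p where p: "\<And>n. p n \<in> A ` V" "p \<longlonglongrightarrow> w" unfolding closure_sequential by blast
    have "cinner (p n) (z y) = cinner (p n) u" for n
      using p(1)[of n] eq z by fastforce
    then have "(\<lambda>n. cinner (p n) (z y)) \<longlonglongrightarrow> cinner w u"
      by (simp only:) (intro cinner.tendsto p tendsto_const)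
    moreover have "(\<lambda>n. cinner (p n) (z y)) \<longlonglongrightarrow> cinner w (z y)"
      by (intro cinner.tendsto p tendsto_const)
    ultimately show "cinner w (z y) = cinner w u" using LIMSEQ_unique by blast
  qed
  have zadd: "z (x + y) = z x + z y" for x y
    by (rule zeq[OF closed_csubspaceD(3)[OF R zR zR]]) (simp add: cinner_add_right z)
  have zscale: "z (c *\<^sub>C x) = c *\<^sub>C z x" for c x
    by (rule zeq[OF closed_csubspaceD(4)[OF R zR]]) (simp add: cinner_scaleC_right z)
  define b where "b i = S (v i)" for i
  have bV: "b i \<in> V" if "i \<in> I" for i
    unfolding b_def using SV parseval_frameD(1)[OF v that] .
  \<comment> \<open>Riesz applied to the linear map \<open>z\<close> paired with \<open>b i\<close>:
    this is the polar part applied to \<open>b i\<close>, and \<open>z\<close> being contractive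
    gives the norm bound.\<close>
  have "\<exists>a. a \<in> V \<and> norm a \<le> norm (b i) \<and> (\<forall>y\<in>V. cinner (z y) (b i) = cinner y a)" for i
  proof -
    obtain a where "a \<in> V" "norm a \<le> norm (b i)" "\<And>y. y \<in> V \<Longrightarrow> cinner (z y) (b i) = cinner y a"
    proof (rule riesz[OF V, where \<phi> = "\<lambda>y. cinner (z y) (b i)" and K = "norm (b i)"])
      fix y
      have "cmod (cinner (z y) (b i)) \<le> norm (z y) * norm (b i)" by (rule cmod_cinner_le)
      also have "\<dots> \<le> norm y * norm (b i)" using znorm by (intro mult_right_mono) auto
      finally show "cmod (cinner (z y) (b i)) \<le> norm (b i) * norm y" by (simp add: mult.commute)
    qed (auto simp: zadd zscale cinner_add_left cinner_scaleC_left)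
    then show ?thesis by blast
  qed
  then obtain a where aV: "\<And>i. a i \<in> V" and anorm: "\<And>i. norm (a i) \<le> norm (b i)"
    and a: "\<And>i y. y \<in> V \<Longrightarrow> cinner (z y) (b i) = cinner y (a i)" by metis
  have le: "norm (a i) * norm (b i) \<le> (norm (S (v i)))\<^sup>2" for i
    unfolding power2_eq_square b_def[symmetric] by (intro mult_right_mono anorm) auto
  have summ: "(\<lambda>i. norm (a i) * norm (b i)) summable_on I"
    by (rule summable_on_comparison_test[OF has_sum_imp_summable[OF tn]]) (use le in auto)
  show ?thesis
  proof (rule that[of a b])
    show "(\<Sum>\<^sub>\<infinity>i\<in>I. norm (a i) * norm (b i)) \<le> trace_norm V T"
      using infsum_mono[OF summ has_sum_imp_summable[OF tn]] le infsumI[OF tn] by auto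
    fix x y assume x: "x \<in> V" and y: "y \<in> V"
    have zV: "z y \<in> V" using zR RV by blast
    \<comment> \<open>Since |T| is the square of the symmetric \<open>S\<close>,
      \<open>cinner (T x) y\<close> equals \<open>cinner (S x) (S (z y))\<close>, which the frame
      expands.\<close>
    have "((\<lambda>i. cinner (S x) (v i) * cinner (v i) (S (z y))) has_sum cinner (S x) (S (z y))) I"
      by (rule parseval_frameD(2)[OF v SV[OF x] SV[OF zV]])
    moreover have "cinner (S x) (S (z y)) = cinner (T x) y"
      using sym[OF SV[OF x] zV] SS[OF x] z[OF x] by simp
    moreover have "cinner (S x) (v i) * cinner (v i) (S (z y)) = cinner x (b i) * cinner (a i) y"
      if i: "i \<in> I" for i
    proof -
      note vi = parseval_frameD(1)[OF v i]
      have "cinner (v i) (S (z y)) = cinner (b i) (z y)" using sym[OF vi zV] by (simp add: b_def)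
      also have "\<dots> = cinner (a i) y" using a[OF y, of i] by (metis cinner_commute)
      finally show ?thesis using sym[OF x vi] by (simp add: b_def)
    qed
    ultimately show "((\<lambda>i. cinner x (b i) * cinner (a i) y) has_sum cinner (T x) y) I"
      using has_sum_cong[of I "\<lambda>i. cinner (S x) (v i) * cinner (v i) (S (z y))"
          "\<lambda>i. cinner x (b i) * cinner (a i) y"] by simp
  qed (use aV bV summ in auto)
qed

text \<open>The family \<open>k\<close> sums over i to \<open>cinner (X (a j)) (b j)\<close> by
  Parseval, and over j to a diagonal coefficient of \<open>T X\<close> by the expansion of T. The
  common value does not involve v, so all Parseval frames give the same trace; \<open>X'\<close> is
  the adjoint of X.\<close>

lemma trace_nuclear:
  fixes v :: "'i \<Rightarrow> 'h::complex_hilbert_space" and a b :: "'j \<Rightarrow> 'h"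
  assumes v: "parseval_frame V I v"
    and aV: "\<And>j. j \<in> J \<Longrightarrow> a j \<in> V" and bV: "\<And>j. j \<in> J \<Longrightarrow> b j \<in> V"
    and summ: "(\<lambda>j. norm (a j) * norm (b j)) summable_on J"
    and T: "\<And>x y. x \<in> V \<Longrightarrow> y \<in> V \<Longrightarrow> ((\<lambda>j. cinner x (b j) * cinner (a j) y) has_sum cinner (T x) y) J"
    and XV: "\<And>x. x \<in> V \<Longrightarrow> X x \<in> V" and X'V: "\<And>x. x \<in> V \<Longrightarrow> X' x \<in> V"
    and X': "\<And>x y. x \<in> V \<Longrightarrow> y \<in> V \<Longrightarrow> cinner (X x) y = cinner x (X' y)"
    and X'norm: "\<And>x. x \<in> V \<Longrightarrow> norm (X' x) \<le> norm x"
  shows "((\<lambda>i. cinner (T (X (v i))) (v i)) has_sum (\<Sum>\<^sub>\<infinity>j\<in>J. cinner (X (a j)) (b j))) I"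
proof -
  define k where "k = (\<lambda>(j, i). cinner (v i) (X' (b j)) * cinner (a j) (v i))"
  have k: "(\<lambda>i. cmod (k (j, i))) summable_on I"
    "(\<Sum>\<^sub>\<infinity>i\<in>I. cmod (k (j, i))) \<le> norm (X' (b j)) * norm (a j)" if j: "j \<in> J" for j
  proof -
    have "(\<Sum>i\<in>F. (cmod (cinner (v i) (X' (b j))))\<^sup>2) \<le> (norm (X' (b j)))\<^sup>2"
      "(\<Sum>i\<in>F. (cmod (cinner (a j) (v i)))\<^sup>2) \<le> (norm (a j))\<^sup>2" if "finite F" "F \<subseteq> I" for F
      using parseval_frame_partial[OF v X'V[OF bV[OF j]] that] parseval_frame_partial[OF v aV[OF j] that]
      by (simp_all only: cmod_cinner_commute[of _ "X' (b j)"])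
    note * = abs_summable_on_mult_L2[OF norm_ge_zero norm_ge_zero this]
    show "(\<lambda>i. cmod (k (j, i))) summable_on I"
      "(\<Sum>\<^sub>\<infinity>i\<in>I. cmod (k (j, i))) \<le> norm (X' (b j)) * norm (a j)"
      unfolding k_def prod.case by (rule *; assumption)+
  qed
  \<comment> \<open>Absolute summability licenses the exchange; contractivity of \<open>X'\<close>
    bounds row j by the summable product of the norms of \<open>a j\<close> and
    \<open>b j\<close>.\<close>
  have "(\<lambda>p. cmod (k p)) summable_on (J \<times> I)"
  proof (rule summable_on_SigmaI)
    show "((\<lambda>i. cmod (k (j, i))) has_sum (\<Sum>\<^sub>\<infinity>i\<in>I. cmod (k (j, i)))) I" if "j \<in> J" for j
      using k(1)[OF that] by (rule has_sum_infsum)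
    show "(\<lambda>j. \<Sum>\<^sub>\<infinity>i\<in>I. cmod (k (j, i))) summable_on J"
    proof (rule summable_on_comparison_test[OF summ])
      fix j assume j: "j \<in> J"
      have "norm (X' (b j)) * norm (a j) \<le> norm (b j) * norm (a j)"
        using X'norm[OF bV[OF j]] by (rule mult_right_mono) simp
      with k(2)[OF j] show "(\<Sum>\<^sub>\<infinity>i\<in>I. cmod (k (j, i))) \<le> norm (a j) * norm (b j)"
        by (simp add: mult.commute)
    qed (auto intro: infsum_nonneg)
  qed simp
  then have K: "(k has_sum (\<Sum>\<^sub>\<infinity>p\<in>J \<times> I. k p)) (J \<times> I)"
    by (rule has_sum_infsum[OF abs_summable_summable])
  have rows: "((\<lambda>i. k (j, i)) has_sum cinner (X (a j)) (b j)) I" if j: "j \<in> J" for j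
    using parseval_frameD(2)[OF v aV[OF j] X'V[OF bV[OF j]]] X'[OF aV[OF j] bV[OF j]]
    by (simp add: k_def mult.commute)
  have "(\<Sum>\<^sub>\<infinity>p\<in>J \<times> I. k p) = (\<Sum>\<^sub>\<infinity>j\<in>J. cinner (X (a j)) (b j))"
    using infsumI[OF has_sum_SigmaD[OF K rows]] by simp
  with K have "(k has_sum (\<Sum>\<^sub>\<infinity>j\<in>J. cinner (X (a j)) (b j))) (J \<times> I)" by simp
  then have "((\<lambda>(i, j). k (j, i)) has_sum (\<Sum>\<^sub>\<infinity>j\<in>J. cinner (X (a j)) (b j))) (I \<times> J)"
    by (subst (asm) has_sum_swap)
  then show ?thesis
  proof (rule has_sum_SigmaD)
    fix i assume i: "i \<in> I"
    note vi = parseval_frameD(1)[OF v i]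
    have "k (j, i) = cinner (X (v i)) (b j) * cinner (a j) (v i)" if "j \<in> J" for j
      using X'[OF vi bV[OF that]] by (simp add: k_def)
    then show "((\<lambda>j. (\<lambda>(i, j). k (j, i)) (i, j)) has_sum cinner (T (X (v i))) (v i)) J"
      using T[OF XV[OF vi] vi] by (simp cong: has_sum_cong)
  qed
qed

section \<open>The standard basis of \<open>ell2\<close> projected to a closed subspace\<close>

lemma ell2_nth_unit: "ell2_nth (ell2_unit i) n = (if n = i then 1 else 0)"
proof -
  have "summable (\<lambda>n. (cmod (if n = i then 1 else 0))\<^sup>2)"
    by (rule summable_finite[of "{i}"]) auto
  then show ?thesis by (simp add: ell2_unit_def Abs_ell2_inverse)
qed

lemma cinner_ell2_unit: "cinner x (ell2_unit i) = ell2_nth x i"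
proof -
  have "cinner x (ell2_unit i) = (\<Sum>n\<in>{i}. ell2_nth x n * cnj (ell2_nth (ell2_unit i) n))"
    unfolding cinner_ell2_def by (rule suminf_finite) (auto simp: ell2_nth_unit)
  then show ?thesis by (simp add: ell2_nth_unit)
qed

text \<open>For x in V the coefficient at a projected unit vector is just the coordinate of x, so
  this is Parseval in \<open>ell2\<close>. Measurability of operator fields is tested on exactly
  these vectors.\<close>

lemma ell2_parseval_frame:
  assumes V: "closed_csubspace V"
  shows "parseval_frame V UNIV (\<lambda>i. orth_proj V (ell2_unit i))"
  unfolding parseval_frame_def
proof (intro conjI ballI)
  show "range (\<lambda>i. orth_proj V (ell2_unit i)) \<subseteq> V" using orth_proj_in[OF V] by auto
  fix x y assume x: "x \<in> V" and y: "y \<in> V"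
  have eq: "cinner x (orth_proj V (ell2_unit i)) * cinner (orth_proj V (ell2_unit i)) y
      = ell2_nth x i * cnj (ell2_nth y i)" for i
    unfolding cinner_orth_proj[OF V x] cinner_orth_proj_left[OF V y] cinner_ell2_unit
    by (subst cinner_commute) (simp add: cinner_ell2_unit)
  have "summable (\<lambda>n. norm (ell2_nth x n * cnj (ell2_nth y n)))"
  proof (rule summable_comparison_test')
    show "summable (\<lambda>n. (cmod (ell2_nth x n))\<^sup>2 + (cmod (ell2_nth y n))\<^sup>2)"
      by (intro summable_add summable_ell2)
    show "norm (norm (ell2_nth x n * cnj (ell2_nth y n))) \<le> (cmod (ell2_nth x n))\<^sup>2 + (cmod (ell2_nth y n))\<^sup>2"
      if "n \<ge> 0" for n
      using cmod_mult_le[of "ell2_nth x n" "cnj (ell2_nth y n)"] by simp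
  qed
  then show "((\<lambda>i. cinner x (orth_proj V (ell2_unit i)) * cinner (orth_proj V (ell2_unit i)) y)
      has_sum cinner x y) UNIV"
    unfolding eq by (rule norm_summable_imp_has_sum)
      (simp add: cinner_ell2_def summable_sums summable_ell2_mult)
qed

section \<open>Interchanging integrals of functions continuous in one variable\<close>

text \<open>\<open>s n h\<close> is a chosen point of \<open>H\<close> lying in the same ones of the first \<open>n\<close> basic open sets
  as \<open>h\<close>.\<close>

lemma finite_valued_approximation:
  fixes H :: "'a::second_countable_topology set"
  obtains s :: "nat \<Rightarrow> 'a \<Rightarrow> 'a" where
    "\<And>n h. h \<in> H \<Longrightarrow> s n h \<in> H" "\<And>n. finite (s n ` H)"
    "\<And>n x. {h \<in> H. s n h = x} \<in> sets (restrict_space borel H)"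
    "\<And>h. h \<in> H \<Longrightarrow> (\<lambda>n. s n h) \<longlonglongrightarrow> h"
proof -
  obtain B :: "'a set set" where B: "countable B" "topological_basis B"
    using ex_countable_basis by blast
  have "B \<noteq> {}" using topological_basisE[OF B(2) open_UNIV UNIV_I] by blast
  define U where "U = from_nat_into B"
  have UB: "U k \<in> B" for k unfolding U_def using \<open>B \<noteq> {}\<close> by (rule from_nat_into)
  have Uopen: "open (U k)" for k using topological_basis_open[OF B(2) UB] .
  define pat where "pat n h = {k\<in>{..<n}. h \<in> U k}" for n and h :: 'a
  define g where "g p n = (SOME h. h \<in> H \<and> pat n h = p)" for p n
  define s where "s n h = g (pat n h) n" for n h
  have s: "s n h \<in> H \<and> pat n (s n h) = pat n h" if "h \<in> H" for n h
    unfolding s_def g_def using that by (intro someI[of "\<lambda>h'. h' \<in> H \<and> pat n h' = pat n h" h]) auto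
  have pm: "{h. pat n h = p} \<in> sets borel" for n p
  proof (cases "p \<subseteq> {..<n}")
    case True
    have "{h. pat n h = p} = {h \<in> space borel. \<forall>k\<in>{..<n}. h \<in> U k \<longleftrightarrow> k \<in> p}"
      using True unfolding pat_def by auto
    moreover have "\<dots> \<in> sets borel"
    proof (rule sets.sets_Collect_finite_All)
      fix k
      have "{h \<in> space borel. (h \<in> U k) = (k \<in> p)} = (if k \<in> p then U k else - U k)" by auto
      also have "\<dots> \<in> sets borel" using Uopen[of k] by auto
      finally show "{h \<in> space borel. (h \<in> U k) = (k \<in> p)} \<in> sets borel" .
    qed simp
    ultimately show ?thesis by simp
  next
    case False
    then have "{h. pat n h = p} = {}" unfolding pat_def by auto
    then show ?thesis by simp
  qed
  show ?thesis
  proof (rule that[of s])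
    show "s n h \<in> H" if "h \<in> H" for n h using s[OF that] by simp
    show "finite (s n ` H)" for n
      by (rule finite_subset[of _ "(\<lambda>p. g p n) ` Pow {..<n}"]) (auto simp: s_def pat_def)
    show "{h \<in> H. s n h = x} \<in> sets (restrict_space borel H)" for n x
    proof -
      have "{h \<in> H. s n h = x} = H \<inter> (\<Union>p\<in>{p\<in>Pow {..<n}. g p n = x}. {h. pat n h = p})"
        by (auto simp: s_def pat_def)
      moreover have "(\<Union>p\<in>{p\<in>Pow {..<n}. g p n = x}. {h. pat n h = p}) \<in> sets borel"
        by (rule sets.finite_UN) (auto intro: pm)
      ultimately show ?thesis by (auto simp: sets_restrict_space)
    qed
    show "(\<lambda>n. s n h) \<longlonglongrightarrow> h" if h: "h \<in> H" for h
    proof (rule topological_tendstoI)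
      fix W assume "open W" "h \<in> W"
      then obtain D where D: "D \<in> B" "h \<in> D" "D \<subseteq> W" using topological_basisE[OF B(2)] by metis
      then obtain k where k: "U k = D"
        unfolding U_def using from_nat_into_surj[OF B(1)] by blast
      have "s n h \<in> W" if "n > k" for n
      proof -
        have "k \<in> pat n h" using that D k by (simp add: pat_def)
        then have "k \<in> pat n (s n h)" using s[OF h, of n] by simp
        then show ?thesis using k D by (auto simp: pat_def)
      qed
      then show "\<forall>\<^sub>F n in sequentially. s n h \<in> W"
        by (auto simp: eventually_sequentially intro!: exI[of _ "Suc k"])
    qed
  qed
qed

section \<open>Integration over a probability measure carried by H\<close>

locale borel_probability_on =
  fixes H :: "'a::second_countable_topology set" and \<mu> :: "'a measure"
  assumes sets_eq: "sets \<mu> = sets (restrict_space borel H)" and prob: "emeasure \<mu> H = 1"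
begin

lemma space_eq: "space \<mu> = H"
  using sets_eq_imp_space_eq[OF sets_eq] by (simp add: space_restrict_space)

sublocale finite_measure \<mu>
  by standard (simp add: space_eq prob)

lemma measure_H: "measure \<mu> H = 1"
  using prob by (simp add: measure_def)

text \<open>If F is not integrable its integral is 0 by convention; \<open>0 \<le> C\<close> covers
  that case and saves integrability proofs later.\<close>

lemma norm_integral_le:
  fixes F :: "'a \<Rightarrow> complex"
  assumes "\<And>h. h \<in> H \<Longrightarrow> cmod (F h) \<le> C" and "0 \<le> C"
  shows "cmod (\<integral>h. F h \<partial>\<mu>) \<le> C"
proof (cases "integrable \<mu> F")
  case True
  have "cmod (\<integral>h. F h \<partial>\<mu>) \<le> (\<integral>h. cmod (F h) \<partial>\<mu>)" by (rule integral_norm_bound)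
  also have "\<dots> \<le> (\<integral>h. C \<partial>\<mu>)"
    using True assms by (intro integral_mono) (auto simp: space_eq)
  also have "\<dots> = C" by (simp add: space_eq measure_H)
  finally show ?thesis .
qed (simp add: not_integrable_integral_eq assms)

lemma continuous_measurable:
  fixes F :: "'a \<Rightarrow> 'b::topological_space"
  assumes "continuous_on H F"
  shows "F \<in> borel_measurable \<mu>"
  using borel_measurable_continuous_on_restrict[OF assms] measurable_cong_sets[OF sets_eq refl] by blast

lemma continuous_bounded_integrable:
  fixes F :: "'a \<Rightarrow> complex"
  assumes "continuous_on H F" and "\<And>h. h \<in> H \<Longrightarrow> cmod (F h) \<le> C"
  shows "integrable \<mu> F"
  by (rule integrable_const_bound[of _ C])
    (use assms continuous_measurable in \<open>auto simp: space_eq intro!: AE_I2\<close>)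

context
  fixes s :: "nat \<Rightarrow> 'a \<Rightarrow> 'a"
  assumes sH: "\<And>n h. h \<in> H \<Longrightarrow> s n h \<in> H" and fin: "\<And>n. finite (s n ` H)"
    and meas: "\<And>n x. {h \<in> H. s n h = x} \<in> sets (restrict_space borel H)"
begin

text \<open>\<open>F (s n h)\<close> is a finite combination of indicators of the measurable level
  sets of \<open>s n\<close>, whatever F is.\<close>

lemma simple_integral:
  fixes F :: "'a \<Rightarrow> complex"
  shows "(\<integral>h. F (s n h) \<partial>\<mu>) = (\<Sum>x\<in>s n ` H. measure \<mu> {h \<in> H. s n h = x} *\<^sub>R F x)"
    and "(\<lambda>h. F (s n h)) \<in> borel_measurable \<mu>"
proof -
  have [measurable]: "{h \<in> H. s n h = x} \<in> sets \<mu>" for x using meas by (simp add: sets_eq)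
  have eq: "F (s n h) = (\<Sum>x\<in>s n ` H. indicator {h \<in> H. s n h = x} h *\<^sub>R F x)" if "h \<in> H" for h
  proof -
    have "(\<Sum>x\<in>s n ` H. indicator {h \<in> H. s n h = x} h *\<^sub>R F x) = (\<Sum>x\<in>s n ` H. if x = s n h then F x else 0)"
      using that by (intro sum.cong) (auto simp: indicator_def)
    then show ?thesis using that fin by simp
  qed
  have "(\<integral>h. F (s n h) \<partial>\<mu>) = (\<integral>h. (\<Sum>x\<in>s n ` H. indicator {h \<in> H. s n h = x} h *\<^sub>R F x) \<partial>\<mu>)"
    by (rule Bochner_Integration.integral_cong) (simp_all add: eq space_eq)
  also have "\<dots> = (\<Sum>x\<in>s n ` H. (\<integral>h. indicator {h \<in> H. s n h = x} h *\<^sub>R F x \<partial>\<mu>))"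
    by (rule Bochner_Integration.integral_sum) (auto simp: less_top[symmetric])
  also have "\<dots> = (\<Sum>x\<in>s n ` H. measure \<mu> {h \<in> H. s n h = x} *\<^sub>R F x)"
    by (intro sum.cong refl) (simp add: less_top[symmetric] space_eq Int_def conj_commute conj_left_commute)
  finally show "(\<integral>h. F (s n h) \<partial>\<mu>) = (\<Sum>x\<in>s n ` H. measure \<mu> {h \<in> H. s n h = x} *\<^sub>R F x)" .
  show "(\<lambda>h. F (s n h)) \<in> borel_measurable \<mu>"
    by (subst measurable_cong[OF eq]) (auto simp: space_eq)
qed

text \<open>Convergence is demanded along \<open>s\<close> only, so the lemma also applies to
  functions of h that are themselves integrals over another space.\<close>

lemma simple_integral_tendsto:
  fixes F :: "'a \<Rightarrow> complex"
  assumes "\<And>h. h \<in> H \<Longrightarrow> (\<lambda>n. F (s n h)) \<longlonglongrightarrow> F h" and "\<And>h. h \<in> H \<Longrightarrow> cmod (F h) \<le> C"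
  shows "(\<lambda>n. \<integral>h. F (s n h) \<partial>\<mu>) \<longlonglongrightarrow> (\<integral>h. F h \<partial>\<mu>)"
proof (rule integral_dominated_convergence[where w = "\<lambda>_. C"])
  show "F \<in> borel_measurable \<mu>"
    by (rule borel_measurable_LIMSEQ_metric[where f = "\<lambda>n h. F (s n h)", OF simple_integral(2)])
      (simp add: assms(1) space_eq)
qed (use assms sH in \<open>auto intro!: AE_I2 simp: space_eq simple_integral(2)\<close>)

end

text \<open>This replaces Fubini's theorem, which would need \<open>M\<close> to be \<open>\<sigma>\<close>-finite and \<open>\<phi>\<close> to be
  jointly measurable: for finitely valued \<open>s n\<close> the interchange is trivial.\<close>

lemma
  fixes \<phi> :: "'a \<Rightarrow> 'c \<Rightarrow> complex" and w :: "'c \<Rightarrow> real"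
  assumes meas: "\<And>h. h \<in> H \<Longrightarrow> \<phi> h \<in> borel_measurable M"
    and bound: "\<And>h c. h \<in> H \<Longrightarrow> c \<in> space M \<Longrightarrow> cmod (\<phi> h c) \<le> w c"
    and cont: "\<And>c. c \<in> space M \<Longrightarrow> continuous_on H (\<lambda>h. \<phi> h c)"
  shows measurable_integral_continuous: "(\<lambda>c. \<integral>h. \<phi> h c \<partial>\<mu>) \<in> borel_measurable M"
    and integrable_integral_continuous: "integrable M w \<Longrightarrow> integrable M (\<lambda>c. \<integral>h. \<phi> h c \<partial>\<mu>)"
    and integral_swap_continuous:
      "integrable M w \<Longrightarrow> (\<integral>h. \<integral>c. \<phi> h c \<partial>M \<partial>\<mu>) = (\<integral>c. \<integral>h. \<phi> h c \<partial>\<mu> \<partial>M)"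
proof -
  obtain s :: "nat \<Rightarrow> 'a \<Rightarrow> 'a" where sH: "\<And>n h. h \<in> H \<Longrightarrow> s n h \<in> H" and fin: "\<And>n. finite (s n ` H)"
    and sm: "\<And>n x. {h \<in> H. s n h = x} \<in> sets (restrict_space borel H)"
    and lim: "\<And>h. h \<in> H \<Longrightarrow> (\<lambda>n. s n h) \<longlonglongrightarrow> h"
    by (rule finite_valued_approximation[of H]) blast
  note simple = simple_integral[where s = s, OF sH fin sm] and tends = simple_integral_tendsto[where s = s, OF sH fin sm]
  have H: "H \<noteq> {}" using prob by auto
  have w0: "0 \<le> w c" if "c \<in> space M" for c
    using H bound[OF _ that] norm_ge_zero order_trans by blast
  have cl: "(\<lambda>n. \<phi> (s n h) c) \<longlonglongrightarrow> \<phi> h c" if "h \<in> H" "c \<in> space M" for h c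
    by (rule continuous_on_tendsto_compose[OF cont[OF that(2)] lim[OF that(1)] that(1)])
      (simp add: sH that(1))
  define A where "A n c = (\<integral>h. \<phi> (s n h) c \<partial>\<mu>)" for n c
  have A_eq: "A n c = (\<Sum>x\<in>s n ` H. measure \<mu> {h \<in> H. s n h = x} *\<^sub>R \<phi> x c)" for n c
    unfolding A_def by (rule simple(1))
  have Am: "A n \<in> borel_measurable M" for n
    unfolding A_eq using sH by (intro borel_measurable_sum borel_measurable_scaleR meas) auto
  have Alim: "(\<lambda>n. A n c) \<longlonglongrightarrow> (\<integral>h. \<phi> h c \<partial>\<mu>)" if "c \<in> space M" for c
    unfolding A_def by (rule tends[where C = "w c"]) (use cl bound that in auto)
  show Im: "(\<lambda>c. \<integral>h. \<phi> h c \<partial>\<mu>) \<in> borel_measurable M"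
    by (rule borel_measurable_LIMSEQ_metric[OF Am Alim])
  assume w: "integrable M w"
  have Abound: "cmod (A n c) \<le> w c" if "c \<in> space M" for n c
    unfolding A_def by (rule norm_integral_le) (use bound sH that w0 in auto)
  have AE: "AE c in M. (\<lambda>n. A n c) \<longlonglongrightarrow> (\<integral>h. \<phi> h c \<partial>\<mu>)" "\<And>n. AE c in M. cmod (A n c) \<le> w c"
    using Alim Abound by (auto intro!: AE_I2)
  note dc = integrable_dominated_convergence[OF Im Am w AE] integral_dominated_convergence[OF Im Am w AE]
  show "integrable M (\<lambda>c. \<integral>h. \<phi> h c \<partial>\<mu>)" by (rule dc(1))
  have int: "integrable M (\<phi> h)" if "h \<in> H" for h
    by (rule Bochner_Integration.integrable_bound[OF w meas[OF that]])
      (use bound[OF that] in \<open>force intro!: AE_I2\<close>)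
  \<comment> \<open>The inner integral of the left-hand side; it converges along
    \<open>s n h\<close> by dominated convergence in M, with \<open>w\<close> as majorant.\<close>
  define g where "g h = (\<integral>c. \<phi> h c \<partial>M)" for h
  have gbound: "cmod (g h) \<le> (\<integral>c. w c \<partial>M)" if "h \<in> H" for h
  proof -
    have "cmod (g h) \<le> (\<integral>c. cmod (\<phi> h c) \<partial>M)" unfolding g_def by (rule integral_norm_bound)
    also have "\<dots> \<le> (\<integral>c. w c \<partial>M)"
      using int[OF that] w bound[OF that] by (intro integral_mono) auto
    finally show ?thesis .
  qed
  have glim: "(\<lambda>n. g (s n h)) \<longlonglongrightarrow> g h" if "h \<in> H" for h
    unfolding g_def
    by (rule integral_dominated_convergence[OF meas[OF that] meas[OF sH[OF that]] w])
      (use cl[OF that] bound[OF sH[OF that]] in \<open>auto intro!: AE_I2\<close>)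
  \<comment> \<open>The interchange for finitely many values of \<open>s n\<close> is linearity of
    the integral; afterwards both sides are limits of the same sequence.\<close>
  have "(\<integral>c. A n c \<partial>M) = (\<Sum>x\<in>s n ` H. measure \<mu> {h \<in> H. s n h = x} *\<^sub>R g x)" for n
    unfolding A_eq g_def using sH int by (subst Bochner_Integration.integral_sum) auto
  then have "(\<integral>c. A n c \<partial>M) = (\<integral>h. g (s n h) \<partial>\<mu>)" for n
    by (simp add: simple(1)[where F = g])
  moreover have "(\<lambda>n. \<integral>h. g (s n h) \<partial>\<mu>) \<longlonglongrightarrow> (\<integral>h. g h \<partial>\<mu>)"
    by (rule tends[where C = "\<integral>c. w c \<partial>M"]) (use glim gbound in auto)
  ultimately have "(\<lambda>n. \<integral>c. A n c \<partial>M) \<longlonglongrightarrow> (\<integral>h. g h \<partial>\<mu>)"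
    by simp
  then show "(\<integral>h. \<integral>c. \<phi> h c \<partial>M \<partial>\<mu>) = (\<integral>c. \<integral>h. \<phi> h c \<partial>\<mu> \<partial>M)"
    using LIMSEQ_unique[OF _ dc(2)] by (simp add: g_def)
qed

end

text \<open>Preimages under f and g differ inside a null set, hence by a measurable set. This
  handles traces that are controlled only almost everywhere.\<close>

lemma (in complete_measure) borel_measurable_cong_AE:
  assumes f: "f \<in> borel_measurable M" and eq: "AE x in M. f x = g x"
  shows "g \<in> borel_measurable M"
proof (rule measurableI)
  fix A :: "'b set" assume A: "A \<in> sets borel"
  show "g -` A \<inter> space M \<in> sets M"
  proof (rule in_sets_AE)
    show "AE x in M. (x \<in> f -` A \<inter> space M) \<longleftrightarrow> (x \<in> g -` A \<inter> space M)"
      using eq by eventually_elim auto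
  qed (use measurable_sets[OF f A] in auto)
qed simp

section \<open>Haar measures\<close>

lemma left_haar_measure_UNIV_sets: "left_haar_measure UNIV \<mu> \<Longrightarrow> sets \<mu> = sets borel"
  by (simp add: left_haar_measure_def sets_restrict_space)

text \<open>The translates of U cover the group, by Lindelof countably many suffice, and if U were
  null, so would be the whole group.\<close>

lemma haar_emeasure_open_pos:
  fixes \<mu> :: "'g::{topological_group_add, second_countable_topology} measure"
  assumes haar: "left_haar_measure UNIV \<mu>" and U: "open U" "U \<noteq> {}"
  shows "emeasure \<mu> U \<noteq> 0"
proof
  assume zero: "emeasure \<mu> U = 0"
  have sets: "sets \<mu> = sets borel" using haar by (rule left_haar_measure_UNIV_sets)
  obtain u where u: "u \<in> U" using U by auto
  have op: "open ((+) g ` U)" for g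
  proof -
    have "(+) g ` U = (\<lambda>x. - g + x) -` U"
    proof (intro set_eqI iffI)
      fix x assume "x \<in> (\<lambda>x. - g + x) -` U"
      then show "x \<in> (+) g ` U" by (intro image_eqI[of _ _ "- g + x"]) (auto simp: add.assoc[symmetric])
    qed (auto simp: add.assoc[symmetric])
    moreover have "continuous_on UNIV (\<lambda>x. - g + x)" by (intro continuous_intros)
    ultimately show ?thesis using U(1) by (simp add: open_vimage)
  qed
  have null: "(+) g ` U \<in> null_sets \<mu>" for g
    using haar U(1) zero op[of g] unfolding left_haar_measure_def
    by (auto simp: null_sets_def sets)
  obtain F' where F': "F' \<subseteq> range (\<lambda>g. (+) g ` U)" "countable F'" "\<Union>F' = \<Union>(range (\<lambda>g. (+) g ` U))"
    using Lindelof[of "range (\<lambda>g. (+) g ` U)"] op by blast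
  have "x \<in> \<Union>(range (\<lambda>g. (+) g ` U))" for x
    using u by (intro UnionI[of "(+) (x - u) ` U"]) (auto intro!: image_eqI[of _ _ u])
  then have "\<Union>F' = UNIV" using F'(3) by auto
  moreover have "\<Union>F' \<in> null_sets \<mu>"
    using null_sets_UN'[OF F'(2), of "\<lambda>x. x"] F'(1) null by auto
  ultimately show False using haar by (auto simp: left_haar_measure_def)
qed

lemma haar_continuous_AE_eq:
  fixes f F :: "'g::{topological_group_add, second_countable_topology} \<Rightarrow> 'b::t2_space"
  assumes haar: "left_haar_measure UNIV \<mu>" and cont: "continuous_on UNIV f" "continuous_on UNIV F"
    and ae: "AE g in \<mu>. f g = F g"
  shows "f = F"
proof (rule ccontr)
  assume "f \<noteq> F"
  then have ne: "{g. f g \<noteq> F g} \<noteq> {}" by auto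
  have sets: "sets \<mu> = sets borel" using haar by (rule left_haar_measure_UNIV_sets)
  have op: "open {g. f g \<noteq> F g}" using cont by (rule open_Collect_neq)
  have "emeasure \<mu> {g \<in> space \<mu>. f g \<noteq> F g} = 0"
    using emeasure_eq_0_AE[of "\<lambda>g. f g \<noteq> F g" \<mu>] ae by simp
  then show False using haar_emeasure_open_pos[OF haar op ne] sets_eq_imp_space_eq[OF sets] by simp
qed

lemma continuous_compact_support_integrable:
  fixes f :: "'g::{topological_group_add, t2_space, second_countable_topology} \<Rightarrow> complex"
  assumes haar: "left_haar_measure UNIV \<mu>" and cont: "continuous_on UNIV f"
    and supp: "compact (closure {g. f g \<noteq> 0})"
  shows "integrable \<mu> f"
proof -
  let ?K = "closure {g. f g \<noteq> 0}"
  have sets: "sets \<mu> = sets borel" using haar by (rule left_haar_measure_UNIV_sets)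
  have K: "?K \<in> sets \<mu>" using sets by auto
  have finK: "emeasure \<mu> ?K < \<infinity>" using haar supp by (simp add: left_haar_measure_def)
  have "compact (f ` ?K)" using cont supp by (intro compact_continuous_image continuous_on_subset[OF cont]) auto
  then obtain C where C: "\<And>g. g \<in> ?K \<Longrightarrow> cmod (f g) \<le> C"
    using compact_imp_bounded[of "f ` ?K"] unfolding bounded_iff by auto
  show ?thesis
  proof (rule Bochner_Integration.integrable_bound)
    show "integrable \<mu> (\<lambda>g. indicator ?K g * C)"
      using K finK by (intro integrable_mult_left) (simp add: integrable_indicator_iff less_top)
    show "f \<in> borel_measurable \<mu>"
      using borel_measurable_continuous_onI[OF cont] measurable_cong_sets[OF sets refl] by blast
    show "AE g in \<mu>. norm (f g) \<le> norm (indicator ?K g * C)"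
    proof (rule AE_I2)
      fix g
      show "norm (f g) \<le> norm (indicator ?K g * C)"
      proof (cases "g \<in> ?K")
        case True then show ?thesis using C[OF True] by simp
      next
        case False then show ?thesis using closure_subset[of "{g. f g \<noteq> 0}"] by auto
      qed
    qed
  qed
qed

text \<open>Invariance is assumed for images of sets; the preimage under translation by k is the
  image under translation by \<open>- k\<close>, which identifies the image measure.\<close>

lemma haar_integral_translate:
  fixes \<mu> :: "'g::{topological_group_add, second_countable_topology} measure" and F :: "'g \<Rightarrow> complex"
  assumes haar: "left_haar_measure H \<mu>" and H: "add_subgroup H" and k: "k \<in> H"
    and F: "F \<in> borel_measurable \<mu>"
  shows "(\<integral>h. F (k + h) \<partial>\<mu>) = (\<integral>h. F h \<partial>\<mu>)"
proof -
  have sets: "sets \<mu> = sets (restrict_space borel H)"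
    and inv: "\<And>h A. h \<in> H \<Longrightarrow> A \<in> sets \<mu> \<Longrightarrow> emeasure \<mu> ((+) h ` A) = emeasure \<mu> A"
    using haar by (auto simp: left_haar_measure_def)
  have space: "space \<mu> = H" using sets_eq_imp_space_eq[OF sets] by (simp add: space_restrict_space)
  have "(+) k \<in> borel_measurable borel"
    by (intro borel_measurable_continuous_onI continuous_intros)
  then have "(+) k \<in> restrict_space borel H \<rightarrow>\<^sub>M restrict_space borel H"
    using H k by (intro measurable_restrict_space3) (auto simp: add_subgroup_def)
  then have meas: "(+) k \<in> \<mu> \<rightarrow>\<^sub>M \<mu>" using measurable_cong_sets[OF sets sets] by blast
  have "distr \<mu> \<mu> ((+) k) = \<mu>"
  proof (rule measure_eqI)
    fix A assume "A \<in> sets (distr \<mu> \<mu> ((+) k))"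
    then have A: "A \<in> sets \<mu>" by simp
    have AH: "A \<subseteq> H" using sets.sets_into_space[OF A] space by simp
    have "(+) k -` A \<inter> space \<mu> = (+) (- k) ` A"
    proof (intro set_eqI iffI)
      fix x assume "x \<in> (+) k -` A \<inter> space \<mu>"
      then show "x \<in> (+) (- k) ` A" by (intro image_eqI[of _ _ "k + x"]) (auto simp: add.assoc[symmetric])
    next
      fix x assume "x \<in> (+) (- k) ` A"
      then show "x \<in> (+) k -` A \<inter> space \<mu>"
        using AH H k by (auto simp: add.assoc[symmetric] space add_subgroup_def subset_iff)
    qed
    then show "emeasure (distr \<mu> \<mu> ((+) k)) A = emeasure \<mu> A"
      using inv[of "- k" A] A H k by (simp add: emeasure_distr[OF meas A] add_subgroup_def)
  qed simp
  then show ?thesis using integral_distr[OF meas F] by simp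
qed

section \<open>Unitary representations\<close>

locale unitary_representation =
  fixes \<pi> :: "('g::topological_group_add, 'h::complex_hilbert_space) urep"
  assumes rep: "unitary_rep \<pi>"
begin

abbreviation "V \<equiv> rep_space \<pi>"
abbreviation "\<sigma> \<equiv> rep_op \<pi>"

lemma V: "closed_csubspace V"
  and unitary: "unitary_between V V (\<sigma> g)"
  and rep_add: "x \<in> V \<Longrightarrow> \<sigma> (g + h) x = \<sigma> g (\<sigma> h x)"
  and rep_cont: "x \<in> V \<Longrightarrow> continuous_on UNIV (\<lambda>g. \<sigma> g x)"
  using rep by (auto simp: unitary_rep_def)

lemma rep_in: "x \<in> V \<Longrightarrow> \<sigma> g x \<in> V"
  and rep_lin: "clinear_on V (\<sigma> g)"
  and cinner_rep: "x \<in> V \<Longrightarrow> y \<in> V \<Longrightarrow> cinner (\<sigma> g x) (\<sigma> g y) = cinner x y"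
  and rep_inj: "inj_on (\<sigma> g) V"
  using unitary[of g] by (auto simp: unitary_between_def bij_betw_def)

text \<open>Not an axiom of \<open>unitary_rep\<close>: the operator at 0 is idempotent and
  injective.\<close>

lemma rep_zero: "x \<in> V \<Longrightarrow> \<sigma> 0 x = x"
  using rep_add[of x 0 0] inj_onD[OF rep_inj[of 0], of "\<sigma> 0 x" x] rep_in by simp

lemma norm_rep: "x \<in> V \<Longrightarrow> norm (\<sigma> g x) = norm x"
  using cinner_rep[of x x g] by (simp add: norm_eq_sqrt_inner Re_cinner[symmetric])

lemma cinner_rep_adjoint:
  assumes "x \<in> V" "y \<in> V"
  shows "cinner (\<sigma> g x) y = cinner x (\<sigma> (- g) y)"
proof -
  have "y = \<sigma> g (\<sigma> (- g) y)" using rep_add[OF assms(2), of g "- g"] rep_zero[OF assms(2)] by simp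
  then show ?thesis using cinner_rep[OF assms(1) rep_in[OF assms(2), of "- g"], of g] by simp
qed

lemma fixed_vectors_subset: "fixed_vectors H \<pi> \<subseteq> V"
  by (auto simp: fixed_vectors_def)

lemma fixed_iff:
  assumes "x \<in> V"
  shows "\<sigma> h x = x \<longleftrightarrow> (\<forall>z\<in>V. cinner z (\<sigma> h x) = cinner z x)"
  using cinner_eqI[OF V rep_in[OF assms] assms] by auto

text \<open>Off V the values of \<open>\<sigma> h\<close> are arbitrary, so closedness cannot be
  read off from \<open>\<sigma> h x = x\<close>. Moving the operator onto a test vector z gives
  equations continuous in x on the ambient space.\<close>

lemma closed_csubspace_fixed_vectors: "closed_csubspace (fixed_vectors H \<pi>)"
  unfolding closed_csubspace_def
proof (intro conjI ballI allI)
  have "cinner z (\<sigma> h x) = cinner (\<sigma> (- h) z) x" if "x \<in> V" "z \<in> V" for x z h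
    using cinner_rep_adjoint[OF that(2,1), of "- h"] by simp
  then have "fixed_vectors H \<pi> = V \<inter> (\<Inter>h\<in>H. \<Inter>z\<in>V. {x. cinner (\<sigma> (- h) z) x = cinner z x})"
    unfolding fixed_vectors_def using fixed_iff by auto
  moreover have "closed (\<Inter>h\<in>H. \<Inter>z\<in>V. {x. cinner (\<sigma> (- h) z) x = cinner z x})"
    by (intro closed_INT ballI closed_Collect_eq cinner.continuous_on continuous_intros)
  ultimately show "closed (fixed_vectors H \<pi>)" using closed_csubspaceD(1)[OF V] by auto
  show "0 \<in> fixed_vectors H \<pi>"
    using closed_csubspaceD(2)[OF V] clinear_onD(3)[OF rep_lin closed_csubspaceD(2)[OF V], of _ 0]
    by (auto simp: fixed_vectors_def)
qed (auto simp: fixed_vectors_def clinear_onD[OF rep_lin] intro: closed_csubspaceD[OF V])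

end

section \<open>Averaging a representation over the compact subgroup\<close>

locale compact_subgroup_average = borel_probability_on H \<mu> + unitary_representation \<pi>
  for H :: "'g::{topological_group_add, second_countable_topology} set" and \<mu>
    and \<pi> :: "('g, 'h::complex_hilbert_space) urep" +
  assumes haar: "left_haar_measure H \<mu>" and H: "add_subgroup H"
begin

abbreviation "P \<equiv> orth_proj (fixed_vectors H \<pi>)"

lemma P_in: "P x \<in> fixed_vectors H \<pi>"
  and P_in_V: "P x \<in> V"
  using orth_proj_in[OF closed_csubspace_fixed_vectors] fixed_vectors_subset by auto

lemma cinner_P: "x \<in> V \<Longrightarrow> y \<in> V \<Longrightarrow> cinner (P x) y = cinner x (P y)"
  using cinner_orth_proj[OF closed_csubspace_fixed_vectors P_in]
    cinner_orth_proj_left[OF closed_csubspace_fixed_vectors P_in] by metis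

lemma norm_P_le: "norm (P x) \<le> norm x"
proof -
  have "(norm (P x))\<^sup>2 = cmod (cinner x (P x))"
    unfolding cinner_orth_proj_left[OF closed_csubspace_fixed_vectors P_in, of x x, symmetric] cinner_self
    by (simp add: norm_power)
  also have "\<dots> \<le> norm x * norm (P x)" by (rule cmod_cinner_le)
  finally show ?thesis by (cases "norm (P x) = 0") (auto simp: power2_eq_square mult_le_cancel_right)
qed

lemma coefficient_continuous: "x \<in> V \<Longrightarrow> continuous_on A (\<lambda>g. cinner (\<sigma> g x) y)"
  by (intro cinner.continuous_on continuous_on_const continuous_on_subset[OF rep_cont]) auto

lemma coefficient_le: "x \<in> V \<Longrightarrow> cmod (cinner (\<sigma> g x) y) \<le> norm x * norm y"
  using cmod_cinner_le[of "\<sigma> g x" y] by (simp add: norm_rep)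

lemma coefficient_integrable: "x \<in> V \<Longrightarrow> integrable \<mu> (\<lambda>h. cinner (\<sigma> h x) y)"
  by (rule continuous_bounded_integrable[OF coefficient_continuous coefficient_le])

text \<open>Riesz yields a vector \<open>y\<close> that is the weak integral of
  \<open>\<sigma> h a\<close>. Invariance of the measure makes \<open>y\<close> fixed by H; against
  a fixed vector z the integrand is the constant \<open>cinner z a\<close> and the mass is 1. These
  two properties characterise the projection.\<close>

lemma integral_rep:
  assumes a: "a \<in> V" and b: "b \<in> V"
  shows "(\<integral>h. cinner (\<sigma> h a) b \<partial>\<mu>) = cinner (P a) b"
proof -
  have int: "integrable \<mu> (\<lambda>h. cinner b (\<sigma> h a))" for b
    using integrable_cnj[OF coefficient_integrable[OF a, of b]]
    by (simp flip: cinner_commute)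
  obtain y where y: "y \<in> V" "\<And>b. b \<in> V \<Longrightarrow> (\<integral>h. cinner b (\<sigma> h a) \<partial>\<mu>) = cinner b y"
  proof (rule riesz[OF V, where \<phi> = "\<lambda>b. \<integral>h. cinner b (\<sigma> h a) \<partial>\<mu>" and K = "norm a"])
    show "cmod (\<integral>h. cinner b (\<sigma> h a) \<partial>\<mu>) \<le> norm a * norm b" for b
      by (rule norm_integral_le)
        (use coefficient_le[OF a] in \<open>auto simp: cmod_cinner_commute[of b]\<close>)
  qed (use int in \<open>auto simp: cinner_add_left cinner_scaleC_left\<close>)
  have "P a = y"
  proof (rule orth_proj_eqI[OF closed_csubspace_fixed_vectors])
    have "\<sigma> k y = y" if k: "k \<in> H" for k
      unfolding fixed_iff[OF y(1)]
    proof
      fix z assume z: "z \<in> V"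
      \<comment> \<open>Passing \<open>\<sigma> (- k)\<close> to the other side turns it into left
        translation of the integration variable.\<close>
      have eq: "cinner (\<sigma> (- k) z) (\<sigma> h a) = cinner z (\<sigma> (k + h) a)" for h
        using cinner_rep_adjoint[OF z rep_in[OF a], of "- k" h] rep_add[OF a] by simp
      have "cinner z (\<sigma> k y) = cinner (\<sigma> (- k) z) y"
        using cinner_rep_adjoint[OF z y(1), of "- k"] by simp
      also have "\<dots> = (\<integral>h. cinner z (\<sigma> (k + h) a) \<partial>\<mu>)"
        unfolding y(2)[OF rep_in[OF z], symmetric] eq ..
      also have "\<dots> = (\<integral>h. cinner z (\<sigma> h a) \<partial>\<mu>)"
        by (rule haar_integral_translate[OF haar H k borel_measurable_integrable[OF int]])
      finally show "cinner z (\<sigma> k y) = cinner z y" by (simp add: y(2)[OF z])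
    qed
    then show "y \<in> fixed_vectors H \<pi>" using y(1) by (simp add: fixed_vectors_def)
    fix z assume z: "z \<in> fixed_vectors H \<pi>"
    then have zV: "z \<in> V" using fixed_vectors_subset by auto
    have "cinner z (\<sigma> h a) = cinner z a" if h: "h \<in> H" for h
    proof -
      have "\<sigma> h z = z" using z h by (simp add: fixed_vectors_def)
      then show ?thesis using cinner_rep[OF zV a, of h] by simp
    qed
    then have "(\<integral>h. cinner z (\<sigma> h a) \<partial>\<mu>) = (\<integral>h. cinner z a \<partial>\<mu>)"
      by (intro Bochner_Integration.integral_cong) (auto simp: space_eq)
    then show "cinner z y = cinner z a" by (simp add: y(2)[OF zV] measure_H space_eq)
  qed
  then have "cinner b (P a) = (\<integral>h. cinner b (\<sigma> h a) \<partial>\<mu>)" using y(2)[OF b] by simp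
  then have "cnj (cinner b (P a)) = (\<integral>h. cnj (cinner b (\<sigma> h a)) \<partial>\<mu>)" by (simp add: integral_cnj)
  then show ?thesis by (simp flip: cinner_commute)
qed

end

context compact_subgroup_average
begin

text \<open>Everything is read off from the series
  \<open>\<Sum>j. cinner (\<sigma> g (a j)) (b j)\<close>, whose terms are dominated uniformly in g
  by a convergent series: the Weierstrass test gives continuity, and termwise integration replaces
  \<open>\<sigma> h\<close> by P. Indexing the expansion by the frame v makes it an ordinary
  series.\<close>

lemma
  fixes v :: "nat \<Rightarrow> 'h"
  assumes tc: "trace_class_on V T" and v: "parseval_frame V UNIV v"
  shows cmod_trace_le: "cmod (op_trace V (\<lambda>x. T (\<sigma> g x))) \<le> trace_norm V T"
    and continuous_trace: "continuous_on UNIV (\<lambda>g. op_trace V (\<lambda>x. T (\<sigma> g x)))"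
    and integral_trace: "(\<integral>h. op_trace V (\<lambda>x. T (\<sigma> h x)) \<partial>\<mu>) = op_trace V (\<lambda>x. P (T x))"
    and trace_frame_sums:
      "(\<lambda>i. cinner (T (\<sigma> g (v i))) (v i)) sums op_trace V (\<lambda>x. T (\<sigma> g x))"
proof -
  have TV: "T x \<in> V" if "x \<in> V" for x
    using tc that bounded_operator_onD(1) unfolding trace_class_on_def by blast
  obtain a b :: "nat \<Rightarrow> 'h" where aV: "\<And>i. a i \<in> V" and bV: "\<And>i. b i \<in> V"
    and summ: "(\<lambda>i. norm (a i) * norm (b i)) summable_on UNIV"
    and le: "(\<Sum>\<^sub>\<infinity>i. norm (a i) * norm (b i)) \<le> trace_norm V T"
    and ab: "\<And>x y. x \<in> V \<Longrightarrow> y \<in> V \<Longrightarrow> ((\<lambda>i. cinner x (b i) * cinner (a i) y) has_sum cinner (T x) y) UNIV"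
  proof (rule trace_class_nuclear[OF V tc v], goal_cases)
    case (1 a b)
    show ?case by (rule 1(1)[of a b]) (use 1(2-) in simp_all)
  qed
  have B: "parseval_frame V (onb_of V) (\<lambda>b. b)"
    by (rule onb_parseval_frame[OF V is_onb_onb_of[OF V]])
  have sN: "summable (\<lambda>i. norm (a i) * norm (b i))" using summ by (rule summable_on_imp_summable)
  have sN_le: "(\<Sum>i. norm (a i) * norm (b i)) \<le> trace_norm V T"
    using le sums_unique[OF has_sum_imp_sums[OF has_sum_infsum[OF summ]]] by simp
  have nuc: "((\<lambda>i. cinner (T (\<sigma> g (w i))) (w i)) has_sum (\<Sum>\<^sub>\<infinity>j. cinner (\<sigma> g (a j)) (b j))) I"
    if "parseval_frame V I w" for g and w :: "'i \<Rightarrow> 'h" and I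
    by (rule trace_nuclear[OF that aV bV summ ab, where X = "\<sigma> g" and X' = "\<sigma> (- g)"])
      (auto simp: rep_in norm_rep cinner_rep_adjoint)
  have tr_inf: "op_trace V (\<lambda>x. T (\<sigma> g x)) = (\<Sum>\<^sub>\<infinity>j. cinner (\<sigma> g (a j)) (b j))" for g
    unfolding op_trace_def by (rule infsumI[OF nuc[OF B]])
  have cle: "cmod (cinner (\<sigma> g (a i)) (b i)) \<le> norm (a i) * norm (b i)" for g i
    by (rule coefficient_le[OF aV])
  have abs: "summable (\<lambda>i. cmod (cinner (\<sigma> g (a i)) (b i)))" for g
    by (rule summable_comparison_test'[OF sN, of 0]) (simp add: cle)
  have suminf: "(\<Sum>\<^sub>\<infinity>j. c j) = (\<Sum>j. c j)" if "summable (\<lambda>j. cmod (c j))" for c :: "nat \<Rightarrow> complex"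
    by (rule infsumI[OF norm_summable_imp_has_sum[OF that]])
      (rule summable_sums[OF summable_norm_cancel[OF that]])
  have tr: "op_trace V (\<lambda>x. T (\<sigma> g x)) = (\<Sum>j. cinner (\<sigma> g (a j)) (b j))" for g
    unfolding tr_inf by (rule suminf[OF abs])
  show "cmod (op_trace V (\<lambda>x. T (\<sigma> g x))) \<le> trace_norm V T"
    unfolding tr using summable_norm[OF abs, of g] suminf_le[OF cle abs sN, of g] sN_le by linarith
  show "continuous_on UNIV (\<lambda>g. op_trace V (\<lambda>x. T (\<sigma> g x)))"
    unfolding tr
  proof (rule uniform_limit_theorem)
    show "uniform_limit UNIV (\<lambda>n g. \<Sum>i<n. cinner (\<sigma> g (a i)) (b i))
        (\<lambda>g. \<Sum>j. cinner (\<sigma> g (a j)) (b j)) sequentially"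
      by (rule Weierstrass_m_test[OF cle sN])
  qed (auto intro!: always_eventually continuous_on_sum coefficient_continuous aV)
  show "(\<lambda>i. cinner (T (\<sigma> g (v i))) (v i)) sums op_trace V (\<lambda>x. T (\<sigma> g x))"
    unfolding tr_inf by (rule has_sum_imp_sums[OF nuc[OF v]])
  have Ple: "norm (P (a i)) * norm (b i) \<le> norm (a i) * norm (b i)" for i
    by (intro mult_right_mono norm_P_le) simp
  \<comment> \<open>Since P is self-adjoint, \<open>P T\<close> has the expansion of T with
    \<open>a j\<close> replaced by \<open>P (a j)\<close>; this puts P on the left of T.\<close>
  have PT: "((\<lambda>i. cinner x (b i) * cinner (P (a i)) y) has_sum cinner (P (T x)) y) UNIV"
    if "x \<in> V" "y \<in> V" for x y
    using ab[OF that(1) P_in_V, of y] by (simp add: cinner_P aV TV that)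
  have "op_trace V (\<lambda>x. P (T x)) = (\<Sum>\<^sub>\<infinity>j. cinner (P (a j)) (b j))"
    unfolding op_trace_def
  proof (rule infsumI, rule trace_nuclear[OF B P_in_V bV _ PT, where X = "\<lambda>x. x" and X' = "\<lambda>x. x"])
    show "(\<lambda>j. norm (P (a j)) * norm (b j)) summable_on UNIV"
      by (rule summable_on_comparison_test[OF summ]) (auto simp: Ple)
  qed auto
  also have "\<dots> = (\<Sum>j. cinner (P (a j)) (b j))"
  proof (rule suminf, rule summable_comparison_test'[OF sN, of 0])
    show "norm (cmod (cinner (P (a i)) (b i))) \<le> norm (a i) * norm (b i)" for i
      using cmod_cinner_le[of "P (a i)" "b i"] Ple[of i] by simp
  qed
  finally have trP: "op_trace V (\<lambda>x. P (T x)) = (\<Sum>j. cinner (P (a j)) (b j))" .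
  have "(\<integral>h. (\<Sum>j. cinner (\<sigma> h (a j)) (b j)) \<partial>\<mu>) = (\<Sum>j. \<integral>h. cinner (\<sigma> h (a j)) (b j) \<partial>\<mu>)"
  proof (rule integral_suminf)
    show "integrable \<mu> (\<lambda>h. cinner (\<sigma> h (a j)) (b j))" for j
      by (rule coefficient_integrable[OF aV])
    show "AE h in \<mu>. summable (\<lambda>j. norm (cinner (\<sigma> h (a j)) (b j)))" using abs by simp
    show "summable (\<lambda>j. \<integral>h. norm (cinner (\<sigma> h (a j)) (b j)) \<partial>\<mu>)"
    proof (rule summable_comparison_test'[OF sN, of 0])
      fix j
      have "(\<integral>h. norm (cinner (\<sigma> h (a j)) (b j)) \<partial>\<mu>) \<le> (\<integral>h. norm (a j) * norm (b j) \<partial>\<mu>)"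
        using coefficient_integrable[OF aV] cle by (intro integral_mono) auto
      then show "norm (\<integral>h. norm (cinner (\<sigma> h (a j)) (b j)) \<partial>\<mu>) \<le> norm (a j) * norm (b j)"
        by (simp add: measure_H space_eq)
    qed
  qed
  then show "(\<integral>h. op_trace V (\<lambda>x. T (\<sigma> h x)) \<partial>\<mu>) = op_trace V (\<lambda>x. P (T x))"
    unfolding tr trP by (simp add: integral_rep aV bV)
qed

text \<open>Parseval for \<open>\<sigma> g x\<close> and the adjoint of T at y. A coefficient of the
  product becomes a countable sum of products of coefficients of the two factors, which preserves
  measurability.\<close>

lemma coefficient_frame_sums:
  fixes v :: "nat \<Rightarrow> 'h"
  assumes T: "bounded_operator_on V T" and v: "parseval_frame V UNIV v" and x: "x \<in> V" and y: "y \<in> V"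
  shows "(\<lambda>j. cinner (\<sigma> g x) (v j) * cinner (T (v j)) y) sums cinner (T (\<sigma> g x)) y"
proof -
  have vV: "v j \<in> V" for j using parseval_frameD(1)[OF v] by simp
  show ?thesis
    using has_sum_imp_sums[OF parseval_frameD(2)[OF v rep_in[OF x] cadjoint_on_in[OF V T]]]
    by (simp add: cinner_cadjoint_on[OF V T] vV rep_in x)
qed

text \<open>\<open>cinner (P (v i)) (v i)\<close> is the squared norm of \<open>P (v i)\<close>; if
  all of these vanish, a fixed vector is orthogonal to the frame. With a countable frame this
  expresses the reciprocal space through countably many functions.\<close>

lemma fixed_vectors_nonzero_iff:
  assumes v: "parseval_frame V I v"
  shows "(\<exists>x\<in>fixed_vectors H \<pi>. x \<noteq> 0) \<longleftrightarrow> (\<exists>i\<in>I. cinner (P (v i)) (v i) \<noteq> 0)"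
proof
  assume "\<exists>i\<in>I. cinner (P (v i)) (v i) \<noteq> 0"
  then obtain i where "P (v i) \<noteq> 0" by (metis cinner.zero_left)
  then show "\<exists>x\<in>fixed_vectors H \<pi>. x \<noteq> 0" using P_in by blast
next
  assume "\<exists>x\<in>fixed_vectors H \<pi>. x \<noteq> 0"
  then obtain x where x: "x \<in> fixed_vectors H \<pi>" "x \<noteq> 0" by auto
  show "\<exists>i\<in>I. cinner (P (v i)) (v i) \<noteq> 0"
  proof (rule ccontr)
    assume "\<not> ?thesis"
    then have z: "cinner (P (v i)) (v i) = 0" if "i \<in> I" for i using that by auto
    have "cinner x (v i) = 0" if i: "i \<in> I" for i
    proof -
      have "cinner (P (v i)) (P (v i)) = 0"
        using z[OF i] cinner_orth_proj[OF closed_csubspace_fixed_vectors P_in] by simp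
      then have "P (v i) = 0" by (simp add: cinner_self)
      then show ?thesis
        using cinner_orth_proj[OF closed_csubspace_fixed_vectors x(1), of "v i"] by (simp add: cinner.zero_right)
    qed
    then have "((\<lambda>i. (cmod (cinner x (v i)))\<^sup>2) has_sum 0) I"
      by (intro has_sum_0) simp
    then have "(norm x)\<^sup>2 = 0"
      using has_sum_unique[OF parseval_frame_norm[OF v]] x(1) fixed_vectors_subset by blast
    then show False using x(2) by simp
  qed
qed

end

section \<open>The unitary dual\<close>

lemma unitarily_equivalent_fixed_vectors:
  assumes \<pi>: "unitarily_equivalent \<pi> \<rho>" and rep: "unitary_rep \<pi>"
  shows "(\<exists>x\<in>fixed_vectors H \<pi>. x \<noteq> 0) \<longleftrightarrow> (\<exists>x\<in>fixed_vectors H \<rho>. x \<noteq> 0)"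
proof -
  interpret unitary_representation \<pi> by standard (rule rep)
  obtain U where U: "unitary_between (rep_space \<pi>) (rep_space \<rho>) U"
    and eq: "\<And>g x. x \<in> rep_space \<pi> \<Longrightarrow> U (rep_op \<pi> g x) = rep_op \<rho> g (U x)"
    using \<pi> by (auto simp: unitarily_equivalent_def)
  have bij: "bij_betw U (rep_space \<pi>) (rep_space \<rho>)" and lin: "clinear_on (rep_space \<pi>) U"
    using U by (auto simp: unitary_between_def)
  have U0: "U x = 0 \<longleftrightarrow> x = 0" if "x \<in> rep_space \<pi>" for x
  proof -
    have "U 0 = 0" using clinear_onD(3)[OF lin closed_csubspaceD(2)[OF V], of 0] by simp
    then show ?thesis
      using inj_on_eq_iff[OF bij_betw_imp_inj_on[OF bij] that closed_csubspaceD(2)[OF V]] by simp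
  qed
  show ?thesis
  proof
    assume "\<exists>x\<in>fixed_vectors H \<pi>. x \<noteq> 0"
    then obtain x where x: "x \<in> rep_space \<pi>" "\<forall>h\<in>H. rep_op \<pi> h x = x" "x \<noteq> 0"
      by (auto simp: fixed_vectors_def)
    have "U x \<in> fixed_vectors H \<rho>"
      using x(1,2) bij by (auto simp: fixed_vectors_def bij_betw_def eq[OF x(1), symmetric])
    then show "\<exists>x\<in>fixed_vectors H \<rho>. x \<noteq> 0" using U0[OF x(1)] x(3) by blast
  next
    assume "\<exists>x\<in>fixed_vectors H \<rho>. x \<noteq> 0"
    then obtain y where y: "y \<in> rep_space \<rho>" "\<forall>h\<in>H. rep_op \<rho> h y = y" "y \<noteq> 0"
      by (auto simp: fixed_vectors_def)
    then obtain x where x: "x \<in> rep_space \<pi>" "y = U x" using bij by (auto simp: bij_betw_def)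
    have "rep_op \<pi> h x = x" if "h \<in> H" for h
    proof (rule inj_onD[of U "rep_space \<pi>"])
      show "U (rep_op \<pi> h x) = U x" using eq[OF x(1)] x(2) y(2) that by simp
    qed (use bij x rep_in in \<open>auto simp: bij_betw_def\<close>)
    then have "x \<in> fixed_vectors H \<pi>" using x by (simp add: fixed_vectors_def)
    then show "\<exists>x\<in>fixed_vectors H \<pi>. x \<noteq> 0" using U0[OF x(1)] x(2) y(3) by blast
  qed
qed

lemma unitary_dual_irreducible:
  assumes "c \<in> unitary_dual" "\<pi> \<in> c"
  shows "irreducible_rep \<pi>"
  using assms by (auto simp: unitary_dual_def elim!: quotientE)

text \<open>Every member of the class is compared with the representation generating it, so the
  existence of fixed vectors can be tested on the chosen representative.\<close>

lemma reciprocal_space_iff: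
  assumes c: "c \<in> unitary_dual" and \<pi>: "\<pi> \<in> c"
  shows "c \<in> reciprocal_space H \<longleftrightarrow> (\<exists>x\<in>fixed_vectors H \<pi>. x \<noteq> 0)"
proof -
  obtain \<rho> where \<rho>: "irreducible_rep \<rho>" "\<And>\<sigma>. \<sigma> \<in> c \<Longrightarrow> unitarily_equivalent \<rho> \<sigma>"
    using c by (auto simp: unitary_dual_def elim!: quotientE)
  have "(\<exists>x\<in>fixed_vectors H \<sigma>. x \<noteq> 0) \<longleftrightarrow> (\<exists>x\<in>fixed_vectors H \<rho>. x \<noteq> 0)" if "\<sigma> \<in> c" for \<sigma>
    using unitarily_equivalent_fixed_vectors[OF \<rho>(2)[OF that]] \<rho>(1) by (simp add: irreducible_rep_def)
  then show ?thesis using c \<pi> by (auto simp: reciprocal_space_def)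
qed

section \<open>The Poisson summation formula\<close>

text \<open>The integrability conjunct ensures that the right-hand side is a genuine integral and
  not the default value 0 of a non-integrable function.\<close>

theorem proposition4p2:
  fixes \<mu>G \<mu>H :: "'g::{topological_group_add, t2_space, second_countable_topology} measure"
    and H :: "'g set"
    and R :: "'g dual_point \<Rightarrow> ('g, ell2) urep"
    and M :: "'g dual_point measure"
    and f :: "'g \<Rightarrow> complex"
  assumes "locally_compact_space (euclidean :: 'g topology)"
    and "unimodular TYPE('g)"
    and "type_I TYPE('g)"
    and "left_haar_measure UNIV \<mu>G"
    and "add_subgroup H" and "closed H" and "compact H"
    and "left_haar_measure H \<mu>H" and "emeasure \<mu>H H = 1"
    and "dual_representatives R"
    and "plancherel_measure \<mu>G R M"
    and "continuous_on UNIV f" and "compact (closure {g. f g \<noteq> 0})"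
    and "integrable \<mu>H f"
    and "fourier_integrable \<mu>G R M f"
  shows "integrable (restrict_space M (reciprocal_space H))
      (\<lambda>c. op_trace (rep_space (R c))
        (\<lambda>x. orth_proj (fixed_vectors H (R c)) (fourier \<mu>G f (R c) x))) \<and>
    (\<integral>h. f h \<partial>\<mu>H) =
      (\<integral>c. op_trace (rep_space (R c))
        (\<lambda>x. orth_proj (fixed_vectors H (R c)) (fourier \<mu>G f (R c) x))
        \<partial>restrict_space M (reciprocal_space H))"
proof -
  note haarG = assms(4) and H = assms(5) and haarH = assms(8) and dual = assms(10)
    and plancherel = assms(11) and fi = assms(15)
  let ?V = "\<lambda>c. rep_space (R c)" and ?\<sigma> = "\<lambda>c. rep_op (R c)" and ?T = "\<lambda>c. fourier \<mu>G f (R c)"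
    and ?P = "\<lambda>c. orth_proj (fixed_vectors H (R c))" and ?S = "reciprocal_space H"
  define tr where "tr g c = op_trace (?V c) (\<lambda>x. ?T c (?\<sigma> c g x))" for g c
  define trP where "trP c = op_trace (?V c) (\<lambda>x. ?P c (?T c x))" for c
  define v where "v c i = orth_proj (?V c) (ell2_unit i)" for c i
  interpret borel_probability_on H \<mu>H
    using haarH assms(9) by unfold_locales (auto simp: left_haar_measure_def)
  obtain N where N: "sets N = sets (dual_borel :: 'g dual_point measure)" "M = completion N"
    and inversion: "\<And>f. integrable \<mu>G f \<Longrightarrow> fourier_integrable \<mu>G R M f \<Longrightarrow> (AE g in \<mu>G. f g =
        (\<integral>c. op_trace (rep_space (R c)) (\<lambda>x. fourier \<mu>G f (R c) (rep_op (R c) g x)) \<partial>M))"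
    using plancherel unfolding plancherel_measure_def by blast
  interpret M: complete_measure M unfolding N(2) by (rule completion.complete_measure_axioms)
  have space: "space M = unitary_dual"
    using sets_eq_imp_space_eq[OF N(1)] by (simp add: N(2) dual_borel_def space_measure_of_conv)
  \<comment> \<open>\<open>N\<close> has the measurable sets of \<open>dual_borel\<close>, and
    completion only adds sets.\<close>
  have dual_measurable: "q \<in> borel_measurable M" if "q \<in> borel_measurable dual_borel"
    for q :: "'g dual_point \<Rightarrow> complex"
    using that measurable_cong_sets[OF N(1) refl, of borel] unfolding N(2)
    by (intro measurable_completion) blast
  have Rc: "R c \<in> c" if "c \<in> space M" for c
    using dual that by (simp add: dual_representatives_def space)
  have avg: "compact_subgroup_average H \<mu>H (R c)" if "c \<in> space M" for c
  proof -
    have "unitary_rep (R c)"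
      using unitary_dual_irreducible[OF _ Rc[OF that]] that by (simp add: space irreducible_rep_def)
    then show ?thesis using haarH H by unfold_locales
  qed
  have Vc: "closed_csubspace (?V c)" if "c \<in> space M" for c
    using compact_subgroup_average.axioms(2)[OF avg[OF that]] unitary_representation.V by blast
  have frame: "parseval_frame (?V c) UNIV (v c)" if "c \<in> space M" for c
    unfolding v_def by (rule ell2_parseval_frame[OF Vc[OF that]])
  have vV: "v c i \<in> ?V c" if "c \<in> space M" for c i
    using parseval_frameD(1)[OF frame[OF that]] by simp
  have \<sigma>_meas: "(\<lambda>c. cinner (?\<sigma> c g (v c i)) (v c j)) \<in> borel_measurable M" for g i j
    using dual unfolding dual_representatives_def measurable_operator_field_def v_def
    by (intro dual_measurable) blast
  have T_meas: "(\<lambda>c. cinner (?T c (v c i)) (v c j)) \<in> borel_measurable M" for i j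
    using fi unfolding fourier_integrable_def integrable_operator_field_def measurable_operator_field_def v_def
    by blast
  \<comment> \<open>The points with a trace class fibre. The complement is null, and M is complete,
    so \<open>G\<close> is measurable although its definition gives no direct reason.\<close>
  define G where "G = {c \<in> space M. trace_class_on (?V c) (?T c)}"
  have AE_tc: "AE c in M. trace_class_on (?V c) (?T c)"
    using fi by (simp add: fourier_integrable_def integrable_operator_field_def)
  then have "{c \<in> space M. \<not> trace_class_on (?V c) (?T c)} \<in> null_sets M"
    by (simp add: M.AE_iff_null_sets)
  then have "space M - {c \<in> space M. \<not> trace_class_on (?V c) (?T c)} \<in> sets M" by blast
  moreover have "space M - {c \<in> space M. \<not> trace_class_on (?V c) (?T c)} = G" by (auto simp: G_def)
  ultimately have G: "G \<in> sets M" by simp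
  have AE_G: "AE c in M. c \<in> G"
    using AE_tc AE_space by eventually_elim (simp add: G_def)
  have GM: "c \<in> space M" and Gtc: "trace_class_on (?V c) (?T c)" if "c \<in> G" for c
    using that by (auto simp: G_def)
  \<comment> \<open>Setting the trace to 0 off \<open>G\<close> makes the bound and the continuity
    in g valid at every point, as the interchange lemma requires. The absolute value in
    \<open>w\<close> keeps the majorant nonnegative off \<open>G\<close>.\<close>
  define \<phi> where "\<phi> g c = (if c \<in> G then tr g c else 0)" for g c
  define w where "w c = \<bar>trace_norm (?V c) (?T c)\<bar>" for c
  have w: "integrable M w"
    using fi unfolding w_def fourier_integrable_def integrable_operator_field_def
    by (intro integrable_abs) blast
  have \<phi>_le: "cmod (\<phi> g c) \<le> w c" for g c
    using compact_subgroup_average.cmod_trace_le[OF avg[OF GM] Gtc frame[OF GM], of c g]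
    by (auto simp: \<phi>_def tr_def w_def)
  have \<phi>_cont: "continuous_on UNIV (\<lambda>g. \<phi> g c)" for c
    using compact_subgroup_average.continuous_trace[OF avg[OF GM] Gtc frame[OF GM], of c]
    by (cases "c \<in> G") (simp_all add: \<phi>_def tr_def)
  have meas_If: "(\<lambda>c. if c \<in> G then q c else 0) \<in> borel_measurable M"
    if "q \<in> borel_measurable M" for q :: "'g dual_point \<Rightarrow> complex"
    using that G by (intro measurable_If_set) auto
  have \<phi>_meas: "\<phi> g \<in> borel_measurable M" for g
  proof -
    \<comment> \<open>The trace is an iterated limit: a sum over i of diagonal coefficients at the
      frame vectors, each of them a sum over j of products of measurable coefficients.\<close>
    define q where "q i c = (if c \<in> G then cinner (?T c (?\<sigma> c g (v c i))) (v c i) else 0)" for i c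
    have q: "q i \<in> borel_measurable M" for i
    proof (rule borel_measurable_LIMSEQ_metric)
      fix n
      show "(\<lambda>c. if c \<in> G then \<Sum>j<n. cinner (?\<sigma> c g (v c i)) (v c j) * cinner (?T c (v c j)) (v c i) else 0)
          \<in> borel_measurable M"
        by (intro meas_If borel_measurable_sum borel_measurable_times \<sigma>_meas T_meas)
    next
      fix c
      show "(\<lambda>n. if c \<in> G then \<Sum>j<n. cinner (?\<sigma> c g (v c i)) (v c j) * cinner (?T c (v c j)) (v c i) else 0)
          \<longlonglongrightarrow> q i c"
      proof (cases "c \<in> G")
        case True
        have "bounded_operator_on (?V c) (?T c)" using Gtc[OF True] by (simp add: trace_class_on_def)
        from compact_subgroup_average.coefficient_frame_sums[OF avg[OF GM[OF True]] this frame[OF GM[OF True]]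
            vV[OF GM[OF True]] vV[OF GM[OF True]], of g i i]
        show ?thesis using True by (simp add: q_def sums_def)
      qed (simp add: q_def)
    qed
    show ?thesis
    proof (rule borel_measurable_LIMSEQ_metric)
      show "(\<lambda>c. \<Sum>i<n. q i c) \<in> borel_measurable M" for n
        by (intro borel_measurable_sum q)
      fix c
      show "(\<lambda>n. \<Sum>i<n. q i c) \<longlonglongrightarrow> \<phi> g c"
      proof (cases "c \<in> G")
        case True
        from compact_subgroup_average.trace_frame_sums[OF avg[OF GM[OF True]] Gtc[OF True] frame[OF GM[OF True]], of g]
        show ?thesis using True by (simp add: q_def sums_def \<phi>_def tr_def)
      qed (simp add: q_def \<phi>_def)
    qed
  qed
  define F where "F g = (\<integral>c. \<phi> g c \<partial>M)" for g
  have F_cont: "continuous_on UNIV F"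
  \<comment> \<open>Dominated convergence speaks of sequences; in a second countable group
    sequential continuity suffices.\<close>
  proof (intro continuous_at_imp_continuous_on ballI continuous_at_sequentiallyI)
    fix g :: 'g and u :: "nat \<Rightarrow> 'g" assume u: "u \<longlonglongrightarrow> g"
    show "(\<lambda>n. F (u n)) \<longlonglongrightarrow> F g"
      unfolding F_def
    proof (rule integral_dominated_convergence[OF \<phi>_meas \<phi>_meas w])
      show "AE c in M. (\<lambda>n. \<phi> (u n) c) \<longlonglongrightarrow> \<phi> g c"
        using continuous_on_tendsto_compose[OF \<phi>_cont u] by simp
    qed (simp add: \<phi>_le)
  qed
  have tr_AE: "AE c in M. \<phi> g c = tr g c" for g
    using AE_G by eventually_elim (simp add: \<phi>_def)
  \<comment> \<open>Off \<open>G\<close> nothing is known of \<open>tr g\<close>, so its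
    measurability comes from that of \<open>\<phi> g\<close> and completeness of M.\<close>
  have "F g = (\<integral>c. tr g c \<partial>M)" for g
    unfolding F_def using M.borel_measurable_cong_AE[OF \<phi>_meas tr_AE] \<phi>_meas tr_AE
    by (intro integral_cong_AE)
  then have "AE g in \<mu>G. f g = F g"
    using inversion[OF continuous_compact_support_integrable[OF haarG assms(12,13)] fi]
    by (simp add: tr_def)
  then have "f = F" by (rule haar_continuous_AE_eq[OF haarG assms(12) F_cont])
  define \<psi> where "\<psi> c = (\<integral>h. \<phi> h c \<partial>\<mu>H)" for c
  have \<psi>: "integrable M \<psi>" "(\<integral>h. F h \<partial>\<mu>H) = (\<integral>c. \<psi> c \<partial>M)"
    unfolding \<psi>_def F_def
    by (rule integrable_integral_continuous[OF \<phi>_meas \<phi>_le _ w] integral_swap_continuous[OF \<phi>_meas \<phi>_le _ w];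
      rule continuous_on_subset[OF \<phi>_cont]; simp)+
  have \<psi>_eq: "\<psi> c = trP c" if "c \<in> G" for c
    using compact_subgroup_average.integral_trace[OF avg[OF GM] Gtc frame[OF GM], OF that that that] that
    by (simp add: \<psi>_def \<phi>_def tr_def trP_def)
  have S_iff: "c \<in> ?S \<longleftrightarrow> (\<exists>i. cinner (?P c (v c i)) (v c i) \<noteq> 0)" if c: "c \<in> space M" for c
    using reciprocal_space_iff[OF c[unfolded space] Rc[OF c], of H]
      compact_subgroup_average.fixed_vectors_nonzero_iff[OF avg[OF c] frame[OF c]] by simp
  \<comment> \<open>The projections form no measurable field by assumption; their diagonal
    coefficients are measurable as averages of those of \<sigma>.\<close>
  have "(\<lambda>c. \<integral>h. cinner (?\<sigma> c h (v c i)) (v c i) \<partial>\<mu>H) \<in> borel_measurable M" for i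
  proof (rule measurable_integral_continuous[OF \<sigma>_meas])
    fix c assume c: "c \<in> space M"
    interpret compact_subgroup_average H \<mu>H "R c" by (rule avg[OF c])
    show "cmod (cinner (?\<sigma> c h (v c i)) (v c i)) \<le> norm (v c i) * norm (v c i)" for h
      by (rule coefficient_le[OF vV[OF c]])
    show "continuous_on H (\<lambda>h. cinner (?\<sigma> c h (v c i)) (v c i))"
      by (rule coefficient_continuous[OF vV[OF c]])
  qed
  then have P_meas: "(\<lambda>c. cinner (?P c (v c i)) (v c i)) \<in> borel_measurable M" for i
    by (rule measurable_cong[THEN iffD1, rotated])
      (use compact_subgroup_average.integral_rep[OF avg vV vV] in auto)
  have "?S \<inter> space M = (\<Union>i. {c \<in> space M. cinner (?P c (v c i)) (v c i) \<noteq> 0})"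
    using S_iff by auto
  also have "\<dots> \<in> sets M"
    using P_meas by (intro sets.countable_UN) auto
  finally have S: "?S \<inter> space M \<in> sets M" .
  \<comment> \<open>The indicator may be inserted because off the reciprocal space the only fixed
    vector is 0 and the trace vanishes.\<close>
  have eq: "AE c in M. \<psi> c = indicator ?S c *\<^sub>R trP c"
    using AE_G
  proof eventually_elim
    fix c assume c: "c \<in> G"
    show "\<psi> c = indicator ?S c *\<^sub>R trP c"
    proof (cases "c \<in> ?S")
      case False
      interpret compact_subgroup_average H \<mu>H "R c" by (rule avg[OF GM[OF c]])
      have "?P c x = 0" for x
        using False P_in reciprocal_space_iff[OF GM[OF c, unfolded space] Rc[OF GM[OF c]], of H] by blast
      then have "trP c = 0" by (simp add: trP_def op_trace_def cinner.zero_left)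
      then show ?thesis using \<psi>_eq[OF c] by simp
    qed (simp add: \<psi>_eq[OF c])
  qed
  \<comment> \<open>Again by completeness, from \<psi>: the function \<open>trP\<close> need not be
    controlled on the null set off \<open>G\<close>.\<close>
  have m: "(\<lambda>c. indicator ?S c *\<^sub>R trP c) \<in> borel_measurable M"
    by (rule M.borel_measurable_cong_AE[OF borel_measurable_integrable[OF \<psi>(1)] eq])
  have "integrable (restrict_space M ?S) trP"
    unfolding integrable_restrict_space[OF S] by (rule integrable_cong_AE_imp[OF \<psi>(1) m eq])
  moreover have "(\<integral>h. f h \<partial>\<mu>H) = (\<integral>c. trP c \<partial>restrict_space M ?S)"
    unfolding integral_restrict_space[OF S] \<open>f = F\<close> \<psi>(2)
    by (rule integral_cong_AE[OF borel_measurable_integrable[OF \<psi>(1)] m eq])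
  ultimately show ?thesis unfolding trP_def by simp
qed

end
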